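(* Let $G$ be a finite-dimensional Lie group with a left-invariant metric $\langle\cdot,\cdot\rangle$, let $\gamma(t)$ be a geodesic in $G$ with $\gamma(0)=\mathrm{id}$ and $\gamma'(0)=u_0$, and let $Y(t)$ be a vector field along $\gamma$ vanishing at $t=0$ and $t=\tau$. Let $u(t)=DL_{\gamma(t)^{-1}}\gamma'(t)$ and $y(t)=DL_{\gamma(t)^{-1}}Y(t)$ be the left translations of $\gamma'$ and $Y$ to $\mathfrak{g}$. Then the index form is given by $$I(Y,Y)=\int_0^\tau \langle z(t),z(t)\rangle-\langle[y(t),z(t)],u(t)\rangle\,dt,\qquad z(t):=y'(t)+[u(t),y(t)].$$ If $v(t)=DR_{\gamma(t)^{-1}}Y(t)$ is the right translation of $Y$ to $\mathfrak{g}$, then $$I(Y,Y)=\int_0^\tau \langle \mathrm{Ad}_{\gamma(t)^{-1}}v'(t),\mathrm{Ad}_{\gamma(t)^{-1}}v'(t)\rangle-\langle[v(t),v'(t)],u_0\rangle\,dt .$$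
   Context: $L_g,R_g$ are left and right translations by $g\in G$, and $[\cdot,\cdot]$ is the bracket on $\mathfrak{g}$ (left-invariant vector fields). The index form of $Y$ along $\gamma$ is $I(Y,Y)=\int_0^\tau\langle\frac{DY}{dt},\frac{DY}{dt}\rangle-\langle R(Y,\gamma')\gamma',Y\rangle\,dt$, where $\frac{D}{dt}$ is the covariant derivative along $\gamma$ and $R$ is the curvature tensor, signed so that $\langle R(a,b)b,a\rangle$ is the sectional curvature for orthonormal $a,b$. Vector fields along $\gamma$ are smooth. *)

theory Defs
  imports "HOL-Analysis.Analysis"
begin

section \<open>Smooth maps and manifolds\<close>

text \<open>For open \<open>S\<close> in a finite-dimensional space this is \<open>C\<^sup>k\<close>: the derivative is
  \<open>C\<^sup>k\<close> iff it is so in every fixed direction \<open>v\<close>.\<close>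

primrec Ck_on :: "nat \<Rightarrow> ('a::real_normed_vector \<Rightarrow> 'b::real_normed_vector) \<Rightarrow> 'a set \<Rightarrow> bool" where
  "Ck_on 0 f S \<longleftrightarrow> continuous_on S f"
| "Ck_on (Suc k) f S \<longleftrightarrow>
     (\<exists>f'. (\<forall>x\<in>S. (f has_derivative f' x) (at x)) \<and> (\<forall>v. Ck_on k (\<lambda>x. f' x v) S))"

definition smooth_on :: "('a::real_normed_vector \<Rightarrow> 'b::real_normed_vector) \<Rightarrow> 'a set \<Rightarrow> bool" where
  "smooth_on f S \<longleftrightarrow> (\<forall>k. Ck_on k f S)"

text \<open>A chart is a domain together with a coordinate map; the inverse of the coordinate map
  on the domain \<open>U\<close> is \<open>inv_into U \<phi>\<close>.\<close>

type_synonym ('g, 'e) chart = "'g set \<times> ('g \<Rightarrow> 'e)"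

text \<open>The model space \<open>'e\<close> is any finite-dimensional inner product space.
  The class \<open>euclidean_space\<close> would exclude dimension 0.
  An atlas need not be maximal.\<close>

definition smooth_atlas :: "('g::topological_space, 'e::real_inner) chart set \<Rightarrow> bool" where
  "smooth_atlas A \<longleftrightarrow>
     (\<exists>B::'e set. finite B \<and> span B = UNIV) \<and>
     (\<forall>(U, \<phi>)\<in>A. open U \<and> open (\<phi> ` U) \<and> homeomorphism U (\<phi> ` U) \<phi> (inv_into U \<phi>)) \<and>
     (\<Union>(U, \<phi>)\<in>A. U) = UNIV \<and>
     (\<forall>(U, \<phi>)\<in>A. \<forall>(V, \<psi>)\<in>A. smooth_on (\<psi> \<circ> inv_into U \<phi>) (\<phi> ` (U \<inter> V)))"

definition std_atlas :: "('a::real_normed_vector, 'a) chart set" where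
  "std_atlas = {(UNIV, id)}"

definition prod_atlas ::
    "('g, 'e) chart set \<Rightarrow> ('h, 'f) chart set \<Rightarrow> ('g \<times> 'h, 'e \<times> 'f) chart set" where
  "prod_atlas A B = {(U \<times> V, map_prod \<phi> \<psi>) | U \<phi> V \<psi>. (U, \<phi>) \<in> A \<and> (V, \<psi>) \<in> B}"

text \<open>Smoothness on an open set \<open>W\<close>, between manifolds with atlases \<open>A\<close> and \<open>B\<close>.\<close>

definition smooth_map ::
    "('g::topological_space, 'e::real_normed_vector) chart set \<Rightarrow>
     ('h::topological_space, 'f::real_normed_vector) chart set \<Rightarrow> ('g \<Rightarrow> 'h) \<Rightarrow> 'g set \<Rightarrow> bool" where
  "smooth_map A B F W \<longleftrightarrow> continuous_on W F \<and>
     (\<forall>(U, \<phi>)\<in>A. \<forall>(V, \<psi>)\<in>B.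
        smooth_on (\<psi> \<circ> F \<circ> inv_into U \<phi>) (\<phi> ` {p \<in> U \<inter> W. F p \<in> V}))"

abbreviation smooth_fun ::
    "('g::topological_space, 'e::real_normed_vector) chart set \<Rightarrow> ('g \<Rightarrow> real) \<Rightarrow> 'g set \<Rightarrow> bool" where
  "smooth_fun A f W \<equiv> smooth_map A std_atlas f W"

abbreviation smooth_curve ::
    "('g::topological_space, 'e::real_normed_vector) chart set \<Rightarrow> (real \<Rightarrow> 'g) \<Rightarrow> real set \<Rightarrow> bool" where
  "smooth_curve A c I \<equiv> smooth_map std_atlas A c I"

definition smooth_at ::
    "('g::topological_space, 'e::real_normed_vector) chart set \<Rightarrow> ('g \<Rightarrow> real) \<Rightarrow> 'g \<Rightarrow> bool" where
  "smooth_at A f p \<longleftrightarrow> (\<exists>U. open U \<and> p \<in> U \<and> smooth_fun A f U)"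


section \<open>Tangent vectors and vector fields\<close>

text \<open>The tangent vectors at \<open>p\<close> are the velocities of smooth curves through \<open>p\<close>, a velocity
  being the functional \<open>f \<mapsto> (f \<circ> c)'(t)\<close> on the real functions that are smooth near \<open>c t\<close>.
  Every tangent vector is 0 at functions that are not smooth near its base point, so that equal
  tangent vectors are equal as HOL functions.  Linear operations are pointwise; the zero
  vector is \<open>\<lambda>f. 0\<close>.\<close>

type_synonym 'g tangent = "('g \<Rightarrow> real) \<Rightarrow> real"
type_synonym 'g vfield = "'g \<Rightarrow> 'g tangent"

definition velocity ::
    "('g::topological_space, 'e::real_normed_vector) chart set \<Rightarrow> (real \<Rightarrow> 'g) \<Rightarrow> real \<Rightarrow> 'g tangent" where
  "velocity A c t = (\<lambda>f. if smooth_at A f (c t) then deriv (f \<circ> c) t else 0)"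

definition tangent_space ::
    "('g::topological_space, 'e::real_normed_vector) chart set \<Rightarrow> 'g \<Rightarrow> 'g tangent set" where
  "tangent_space A p =
     {velocity A c 0 | c. c 0 = p \<and> (\<exists>\<epsilon>>0. smooth_curve A c {-\<epsilon><..<\<epsilon>})}"

definition pushforward ::
    "('g::topological_space, 'e::real_normed_vector) chart set \<Rightarrow>
     ('g \<Rightarrow> 'g) \<Rightarrow> 'g \<Rightarrow> 'g tangent \<Rightarrow> 'g tangent" where
  "pushforward A F p x = (\<lambda>f. if smooth_at A f (F p) then x (f \<circ> F) else 0)"

definition vector_field ::
    "('g::topological_space, 'e::real_normed_vector) chart set \<Rightarrow> 'g vfield \<Rightarrow> bool" where
  "vector_field A X \<longleftrightarrow> (\<forall>p. X p \<in> tangent_space A p) \<and>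
     (\<forall>U f. open U \<and> smooth_fun A f U \<longrightarrow> smooth_fun A (\<lambda>p. X p f) U)"

definition vf_bracket ::
    "('g::topological_space, 'e::real_normed_vector) chart set \<Rightarrow>
     'g vfield \<Rightarrow> 'g vfield \<Rightarrow> 'g vfield" where
  "vf_bracket A X Y p =
     (\<lambda>f. if smooth_at A f p then X p (\<lambda>q. Y q f) - Y p (\<lambda>q. X q f) else 0)"

definition field_along ::
    "('g::topological_space, 'e::real_normed_vector) chart set \<Rightarrow>
     (real \<Rightarrow> 'g) \<Rightarrow> real set \<Rightarrow> (real \<Rightarrow> 'g tangent) \<Rightarrow> bool" where
  "field_along A c J V \<longleftrightarrow> (\<forall>t\<in>J. V t \<in> tangent_space A (c t)) \<and>
     (\<forall>U f. open U \<and> smooth_fun A f U \<longrightarrow> smooth_on (\<lambda>t. V t f) {t\<in>J. c t \<in> U})"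


section \<open>Riemannian geometry\<close>

definition riemannian_metric ::
    "('g::topological_space, 'e::real_normed_vector) chart set \<Rightarrow>
     ('g \<Rightarrow> 'g tangent \<Rightarrow> 'g tangent \<Rightarrow> real) \<Rightarrow> bool" where
  "riemannian_metric A g \<longleftrightarrow>
     (\<forall>p. \<forall>x\<in>tangent_space A p. \<forall>y\<in>tangent_space A p.
        g p x y = g p y x \<and>
        (\<forall>z\<in>tangent_space A p. g p (\<lambda>f. x f + y f) z = g p x z + g p y z) \<and>
        (\<forall>c. g p (\<lambda>f. c * x f) y = c * g p x y) \<and>
        (x \<noteq> (\<lambda>f. 0) \<longrightarrow> g p x x > 0)) \<and>
     (\<forall>X Y. vector_field A X \<and> vector_field A Y \<longrightarrow> smooth_fun A (\<lambda>p. g p (X p) (Y p)) UNIV)"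

definition affine_connection ::
    "('g::topological_space, 'e::real_normed_vector) chart set \<Rightarrow>
     ('g vfield \<Rightarrow> 'g vfield \<Rightarrow> 'g vfield) \<Rightarrow> bool" where
  "affine_connection A nabla \<longleftrightarrow>
     (\<forall>X Y. vector_field A X \<and> vector_field A Y \<longrightarrow> vector_field A (nabla X Y)) \<and>
     (\<forall>X X' Y. vector_field A X \<and> vector_field A X' \<and> vector_field A Y \<longrightarrow>
        nabla (\<lambda>p f. X p f + X' p f) Y = (\<lambda>p f. nabla X Y p f + nabla X' Y p f)) \<and>
     (\<forall>X Y Y'. vector_field A X \<and> vector_field A Y \<and> vector_field A Y' \<longrightarrow>
        nabla X (\<lambda>p f. Y p f + Y' p f) = (\<lambda>p f. nabla X Y p f + nabla X Y' p f)) \<and>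
     (\<forall>h X Y. smooth_fun A h UNIV \<and> vector_field A X \<and> vector_field A Y \<longrightarrow>
        nabla (\<lambda>p f. h p * X p f) Y = (\<lambda>p f. h p * nabla X Y p f) \<and>
        nabla X (\<lambda>p f. h p * Y p f) = (\<lambda>p f. X p h * Y p f + h p * nabla X Y p f))"

definition levi_civita ::
    "('g::topological_space, 'e::real_normed_vector) chart set \<Rightarrow>
     ('g \<Rightarrow> 'g tangent \<Rightarrow> 'g tangent \<Rightarrow> real) \<Rightarrow>
     ('g vfield \<Rightarrow> 'g vfield \<Rightarrow> 'g vfield) \<Rightarrow> bool" where
  "levi_civita A g nabla \<longleftrightarrow> affine_connection A nabla \<and>
     (\<forall>X Y. vector_field A X \<and> vector_field A Y \<longrightarrow>
        (\<lambda>p f. nabla X Y p f - nabla Y X p f) = vf_bracket A X Y) \<and>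
     (\<forall>X Y Z p. vector_field A X \<and> vector_field A Y \<and> vector_field A Z \<longrightarrow>
        X p (\<lambda>q. g q (Y q) (Z q)) = g p (nabla X Y p) (Z p) + g p (Y p) (nabla X Z p))"

text \<open>The sign is such that \<open>g (R(a,b)b) a\<close> is the sectional curvature for orthonormal
  \<open>a\<close>, \<open>b\<close>.\<close>

definition curvature ::
    "('g::topological_space, 'e::real_normed_vector) chart set \<Rightarrow>
     ('g vfield \<Rightarrow> 'g vfield \<Rightarrow> 'g vfield) \<Rightarrow> 'g vfield \<Rightarrow> 'g vfield \<Rightarrow> 'g vfield \<Rightarrow> 'g vfield" where
  "curvature A nabla X Y Z =
     (\<lambda>p f. nabla X (nabla Y Z) p f - nabla Y (nabla X Z) p f - nabla (vf_bracket A X Y) Z p f)"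

text \<open>On tangent vectors the curvature is evaluated on extensions to vector fields; for an affine
  connection the value does not depend on the extensions chosen.\<close>

definition curvature_at ::
    "('g::topological_space, 'e::real_normed_vector) chart set \<Rightarrow>
     ('g vfield \<Rightarrow> 'g vfield \<Rightarrow> 'g vfield) \<Rightarrow> 'g \<Rightarrow>
     'g tangent \<Rightarrow> 'g tangent \<Rightarrow> 'g tangent \<Rightarrow> 'g tangent" where
  "curvature_at A nabla p x y z =
     (let ext = (\<lambda>w. SOME X. vector_field A X \<and> X p = w)
      in curvature A nabla (ext x) (ext y) (ext z) p)"

text \<open>These properties determine \<open>D V\<close> on \<open>J\<close> for every smooth field \<open>V\<close> along \<open>c\<close>.
  In the last one, \<open>nabla W X (c t)\<close> depends only on \<open>W (c t)\<close> and is the covariant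
  derivative of \<open>X\<close> in the direction of the velocity of \<open>c\<close>.\<close>

definition covariant_derivative_along ::
    "('g::topological_space, 'e::real_normed_vector) chart set \<Rightarrow>
     ('g vfield \<Rightarrow> 'g vfield \<Rightarrow> 'g vfield) \<Rightarrow> (real \<Rightarrow> 'g) \<Rightarrow> real set \<Rightarrow>
     ((real \<Rightarrow> 'g tangent) \<Rightarrow> real \<Rightarrow> 'g tangent) \<Rightarrow> bool" where
  "covariant_derivative_along A nabla c J D \<longleftrightarrow>
     (\<forall>V. field_along A c J V \<longrightarrow> field_along A c J (D V)) \<and>
     (\<forall>V W. field_along A c J V \<and> field_along A c J W \<longrightarrow>
        (\<forall>t\<in>J. D (\<lambda>s f. V s f + W s f) t = (\<lambda>f. D V t f + D W t f))) \<and>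
     (\<forall>h V. smooth_on h J \<and> field_along A c J V \<longrightarrow>
        (\<forall>t\<in>J. D (\<lambda>s f. h s * V s f) t = (\<lambda>f. deriv h t * V t f + h t * D V t f))) \<and>
     (\<forall>X. vector_field A X \<longrightarrow>
        (\<forall>t\<in>J. \<forall>W. vector_field A W \<and> W (c t) = velocity A c t \<longrightarrow>
           D (\<lambda>s. X (c s)) t = nabla W X (c t)))"

definition geodesic ::
    "('g::topological_space, 'e::real_normed_vector) chart set \<Rightarrow>
     ((real \<Rightarrow> 'g tangent) \<Rightarrow> real \<Rightarrow> 'g tangent) \<Rightarrow> (real \<Rightarrow> 'g) \<Rightarrow> real set \<Rightarrow> bool" where
  "geodesic A D c J \<longleftrightarrow> smooth_curve A c J \<and> (\<forall>t\<in>J. D (velocity A c) t = (\<lambda>f. 0))"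

definition index_form ::
    "('g::topological_space, 'e::real_normed_vector) chart set \<Rightarrow>
     ('g \<Rightarrow> 'g tangent \<Rightarrow> 'g tangent \<Rightarrow> real) \<Rightarrow>
     ('g vfield \<Rightarrow> 'g vfield \<Rightarrow> 'g vfield) \<Rightarrow>
     ((real \<Rightarrow> 'g tangent) \<Rightarrow> real \<Rightarrow> 'g tangent) \<Rightarrow>
     (real \<Rightarrow> 'g) \<Rightarrow> real \<Rightarrow> (real \<Rightarrow> 'g tangent) \<Rightarrow> real" where
  "index_form A g nabla D c \<tau> Y = integral {0..\<tau>} (\<lambda>t.
     g (c t) (D Y t) (D Y t) -
     g (c t) (curvature_at A nabla (c t) (Y t) (velocity A c t) (velocity A c t)) (Y t))"


section \<open>Lie groups\<close>

definition lie_group ::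
    "('g::{t2_space, second_countable_topology}, 'e::real_inner) chart set \<Rightarrow>
     ('g \<Rightarrow> 'g \<Rightarrow> 'g) \<Rightarrow> 'g \<Rightarrow> ('g \<Rightarrow> 'g) \<Rightarrow> bool" where
  "lie_group A mul e iv \<longleftrightarrow> smooth_atlas A \<and> group mul e iv \<and>
     smooth_map (prod_atlas A A) A (\<lambda>(a, b). mul a b) UNIV \<and> smooth_map A A iv UNIV"

definition left_invariant_metric ::
    "('g::topological_space, 'e::real_normed_vector) chart set \<Rightarrow> ('g \<Rightarrow> 'g \<Rightarrow> 'g) \<Rightarrow>
     ('g \<Rightarrow> 'g tangent \<Rightarrow> 'g tangent \<Rightarrow> real) \<Rightarrow> bool" where
  "left_invariant_metric A mul g \<longleftrightarrow> riemannian_metric A g \<and>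
     (\<forall>a p. \<forall>x\<in>tangent_space A p. \<forall>y\<in>tangent_space A p.
        g (mul a p) (pushforward A (mul a) p x) (pushforward A (mul a) p y) = g p x y)"

text \<open>The Lie algebra is \<open>tangent_space A e\<close>, identified with the left-invariant
  vector fields through \<open>left_field\<close>.\<close>

definition left_field ::
    "('g::topological_space, 'e::real_normed_vector) chart set \<Rightarrow> ('g \<Rightarrow> 'g \<Rightarrow> 'g) \<Rightarrow> 'g \<Rightarrow>
     'g tangent \<Rightarrow> 'g vfield" where
  "left_field A mul e x p = pushforward A (mul p) e x"

definition lie_bracket ::
    "('g::topological_space, 'e::real_normed_vector) chart set \<Rightarrow> ('g \<Rightarrow> 'g \<Rightarrow> 'g) \<Rightarrow> 'g \<Rightarrow>
     'g tangent \<Rightarrow> 'g tangent \<Rightarrow> 'g tangent" where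
  "lie_bracket A mul e x y = vf_bracket A (left_field A mul e x) (left_field A mul e y) e"

definition Ad ::
    "('g::topological_space, 'e::real_normed_vector) chart set \<Rightarrow> ('g \<Rightarrow> 'g \<Rightarrow> 'g) \<Rightarrow> 'g \<Rightarrow> ('g \<Rightarrow> 'g) \<Rightarrow>
     'g \<Rightarrow> 'g tangent \<Rightarrow> 'g tangent" where
  "Ad A mul e iv a x = pushforward A (\<lambda>q. mul (mul a q) (iv a)) e x"

text \<open>The derivative of a curve in a fixed tangent space; since that space is
  finite-dimensional, it may be taken pointwise.\<close>

definition tderiv :: "(real \<Rightarrow> 'g tangent) \<Rightarrow> real \<Rightarrow> 'g tangent" where
  "tderiv w t = (\<lambda>f. deriv (\<lambda>s. w s f) t)"

end

theory Submission
  imports Defs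
begin

text \<open>In the left-invariant frame \<open>E\<close> indexed by the model space, the Koszul formula gives a
  bilinear map \<open>N\<close> with \<open>nabla (E a) (E b) = E (N a b)\<close> and \<open>[a, b] = N a b - N b a\<close>. Writing \<open>u\<close> and \<open>y\<close>
  for the frame coefficients of the velocity and of the field, the covariant derivative of the
  field is \<open>y' + N u y\<close>, the geodesic equation is \<open>u' = - N u u\<close>, and the curvature is
  \<open>N x (N y z) - N y (N x z) - N [x, y] z\<close>. With these the integrand of the index form differs from
  the one claimed by the derivative of \<open>G (N y u) y\<close>, where \<open>G\<close> is the inner product; this term
  vanishes at both ends.

  For the second formula, \<open>v = Ad\<^sub>\<gamma> y\<close> has derivative \<open>Ad\<^sub>\<gamma> (y' + [u, y]) = Ad\<^sub>\<gamma> z\<close>, the adjoint maps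
  are Lie algebra homomorphisms, and \<open>G (Ad\<^sub>\<gamma> a) u\<^sub>0 = G a u\<close> by conservation of momentum.\<close>

section \<open>Calculus in finite-dimensional inner product spaces\<close>

text \<open>The model space is only known to have a finite spanning set, so the calculus is rebuilt
  on orthonormal frames: a direction that varies is expanded in a frame, which reduces its
  derivative to the fixed directions of \<open>Ck_on\<close>. Connection and curvature act on global
  vector fields. The left-invariant frame is global, so every vector field is a combination of frame
  fields with coefficients smooth on the whole group, and no cut-off functions on the group enter.
  Because this expansion covers all vector fields, the curvature formula holds for every extension
  of given tangent vectors, hence for the arbitrary ones picked by \<open>curvature_at\<close>. The
  analytic obstacle in the second formula is the derivative of Ad along a curve: tangent vectors are
  functionals on test functions, so this derivative is a mixed second derivative of a test function
  composed with a group-valued map. This is why the symmetry of second derivatives is proved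
  first.\<close>

definition fin_dim :: "'a::real_inner itself \<Rightarrow> bool" where
  "fin_dim T \<longleftrightarrow> (\<exists>B::'a set. finite B \<and> span B = UNIV)"

text \<open>Gram-Schmidt, for an abstract positive definite form \<open>G\<close> so that it serves
  both the inner product of the model space and, later, the invariant metric at the identity. The
  frame may be empty, which covers dimension 0.\<close>

lemma orthonormal_expansion_exists:
  fixes B :: "'a::real_vector set" and G :: "'a \<Rightarrow> 'a \<Rightarrow> real"
  assumes B: "finite B" "span B = UNIV"
    and add: "\<And>x y z. G (x + y) z = G x z + G y z"
    and scale: "\<And>c x z. G (c *\<^sub>R x) z = c * G x z"
    and sym: "\<And>x y. G x y = G y x"
    and pos: "\<And>x. x \<noteq> 0 \<Longrightarrow> G x x > 0"
  shows "\<exists>C. finite C \<and> (\<forall>a\<in>C. \<forall>b\<in>C. G a b = (if a = b then 1 else 0)) \<and>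
    (\<forall>x. (\<Sum>c\<in>C. G x c *\<^sub>R c) = x)"
proof -
  have lin: "linear (\<lambda>x. G x z)" for z by (rule linearI) (simp_all add: add scale)
  have scaler: "G x (c *\<^sub>R y) = c * G x y" for c x y by (metis sym scale)
  have sub: "subspace {x. (\<Sum>c\<in>C. G x c *\<^sub>R c) = x}" for C
  proof (rule subspaceI)
    show "0 \<in> {x. (\<Sum>c\<in>C. G x c *\<^sub>R c) = x}" using linear_0[OF lin] by simp
  next
    fix x y assume "x \<in> {x. (\<Sum>c\<in>C. G x c *\<^sub>R c) = x}" "y \<in> {x. (\<Sum>c\<in>C. G x c *\<^sub>R c) = x}"
    then show "x + y \<in> {x. (\<Sum>c\<in>C. G x c *\<^sub>R c) = x}"
      by (simp add: add scaleR_add_left sum.distrib)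
  next
    fix r x assume x: "x \<in> {x. (\<Sum>c\<in>C. G x c *\<^sub>R c) = x}"
    have "(\<Sum>c\<in>C. G (r *\<^sub>R x) c *\<^sub>R c) = r *\<^sub>R (\<Sum>c\<in>C. G x c *\<^sub>R c)"
      unfolding scaleR_sum_right by (simp add: scale)
    then show "r *\<^sub>R x \<in> {x. (\<Sum>c\<in>C. G x c *\<^sub>R c) = x}" using x by simp
  qed
  have "\<exists>C. finite C \<and> (\<forall>a\<in>C. \<forall>b\<in>C. G a b = (if a = b then 1 else 0)) \<and>
    (\<forall>x\<in>span B. (\<Sum>c\<in>C. G x c *\<^sub>R c) = x)"
    using B(1)
  proof (induction B rule: finite_induct)
    case empty
    show ?case using linear_0[OF lin] by (intro exI[of _ "{}"]) auto
  next
    case (insert b B)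
    then obtain C where C: "finite C" and on: "\<And>a b. a\<in>C \<Longrightarrow> b\<in>C \<Longrightarrow> G a b = (if a = b then 1 else 0)"
      and ex: "\<And>x. x \<in> span B \<Longrightarrow> (\<Sum>c\<in>C. G x c *\<^sub>R c) = x" by blast
    \<comment> \<open>\<open>r\<close> is the part of \<open>b\<close> orthogonal to the frame. If
      it vanishes, the frame is kept; otherwise the normalised \<open>r\<close> joins it as
      \<open>c0\<close>.\<close>
    define r where "r = b - (\<Sum>c\<in>C. G b c *\<^sub>R c)"
    have sumG: "G (\<Sum>c\<in>C. f c *\<^sub>R c) d = f d" if "d \<in> C" for f d
    proof -
      have "G (\<Sum>c\<in>C. f c *\<^sub>R c) d = (\<Sum>c\<in>C. f c * G c d)"
        by (simp add: linear_sum[OF lin] scale)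
      also have "\<dots> = (\<Sum>c\<in>C. if c = d then f c else 0)"
        by (rule sum.cong) (auto simp: on that)
      finally show ?thesis using C that by simp
    qed
    have rC: "G r d = 0" if "d \<in> C" for d
      using sumG[OF that] by (simp add: r_def linear_diff[OF lin])
    show ?case
    proof (cases "r = 0")
      case True
      then have "b \<in> {x. (\<Sum>c\<in>C. G x c *\<^sub>R c) = x}" by (simp add: r_def)
      moreover have "B \<subseteq> {x. (\<Sum>c\<in>C. G x c *\<^sub>R c) = x}" using ex span_base by blast
      ultimately have "span (insert b B) \<subseteq> {x. (\<Sum>c\<in>C. G x c *\<^sub>R c) = x}"
        by (intro span_minimal sub) auto
      then show ?thesis using C on by blast
    next
      case False
      define c0 where "c0 = (1 / sqrt (G r r)) *\<^sub>R r"
      have rr: "G r r > 0" using pos False by blast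
      have c0C: "G c0 d = 0" if "d \<in> C" for d using rC[OF that] by (simp add: c0_def scale)
      have c00: "G c0 c0 = 1" using rr by (simp add: c0_def scale scaler real_div_sqrt)
      have c0C': "G d c0 = 0" if "d \<in> C" for d using c0C[OF that] sym by metis
      have nin: "c0 \<notin> C" using c0C c00 by force
      let ?S = "{x. (\<Sum>c\<in>insert c0 C. G x c *\<^sub>R c) = x}"
      have "x \<in> ?S" if "x \<in> B" for x
      proof -
        have e: "(\<Sum>c\<in>C. G x c *\<^sub>R c) = x" using ex that span_base by blast
        have "G x c0 = (\<Sum>c\<in>C. G x c * G c c0)"
          by (subst e[symmetric], simp only: linear_sum[OF lin] scale)
        also have "\<dots> = 0" using c0C sym by simp
        finally show ?thesis using e C nin by simp
      qed
      moreover have "b \<in> ?S"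
      proof -
        have "b = r + (\<Sum>c\<in>C. G b c *\<^sub>R c)" by (simp add: r_def)
        then have "G b c0 = G r c0 + (\<Sum>c\<in>C. G b c * G c c0)"
          by (metis (no_types, lifting) add linear_sum[OF lin] scale sum.cong)
        also have "(\<Sum>c\<in>C. G b c * G c c0) = 0" using c0C sym by simp
        also have "G r c0 = sqrt (G r r)"
          using rr by (simp add: c0_def scaler real_div_sqrt)
        finally have "G b c0 *\<^sub>R c0 = r" using rr by (simp add: c0_def)
        then show ?thesis using C nin by (simp add: r_def)
      qed
      ultimately have "span (insert b B) \<subseteq> ?S" by (intro span_minimal sub) auto
      then show ?thesis using C on c0C c0C' c00 nin by (intro exI[of _ "insert c0 C"]) auto
    qed
  qed
  then show ?thesis using B by auto
qed

lemma fin_dim_frame: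
  assumes "fin_dim TYPE('a::real_inner)"
  obtains B :: "'a::real_inner set" where "finite B" "\<And>x. (\<Sum>b\<in>B. (x \<bullet> b) *\<^sub>R b) = x"
    "\<And>a b. a \<in> B \<Longrightarrow> b \<in> B \<Longrightarrow> a \<bullet> b = (if a = b then 1 else 0)"
proof -
  obtain B :: "'a set" where "finite B" "span B = UNIV" using assms by (auto simp: fin_dim_def)
  then have "\<exists>C::'a set. finite C \<and> (\<forall>a\<in>C. \<forall>b\<in>C. a \<bullet> b = (if a = b then 1 else 0)) \<and>
    (\<forall>x. (\<Sum>c\<in>C. (x \<bullet> c) *\<^sub>R c) = x)"
    by (rule orthonormal_expansion_exists) (simp_all add: inner_add_left, rule inner_commute)
  then show ?thesis using that by blast
qed

lemma fin_dim_euclidean: "fin_dim TYPE('a::euclidean_space)"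
  unfolding fin_dim_def using finite_Basis span_Basis by blast

lemma fin_dim_prod:
  assumes "fin_dim TYPE('a::real_inner)" "fin_dim TYPE('b::real_inner)"
  shows "fin_dim TYPE('a::real_inner \<times> 'b::real_inner)"
proof -
  obtain B :: "'a set" where B: "finite B" "span B = UNIV" using assms by (auto simp: fin_dim_def)
  obtain C :: "'b set" where C: "finite C" "span C = UNIV" using assms by (auto simp: fin_dim_def)
  let ?D = "(\<lambda>b. (b, 0)) ` B \<union> (\<lambda>c. (0, c)) ` C"
  have "(a, 0) \<in> span ?D" for a
  proof -
    have "a \<in> span B" using B by simp
    then have "(a, 0) \<in> span ((\<lambda>b. (b, 0::'b)) ` B)"
      by (subst linear_span_image) (auto intro!: linearI)
    then show ?thesis using span_mono[of _ ?D] by blast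
  qed
  moreover have "(0, c) \<in> span ?D" for c
  proof -
    have "c \<in> span C" using C by simp
    then have "(0, c) \<in> span ((\<lambda>b. (0::'a, b)) ` C)"
      by (subst linear_span_image) (auto intro!: linearI)
    then show ?thesis using span_mono[of _ ?D] by blast
  qed
  ultimately have "(a, 0) + (0, c) \<in> span ?D" for a c by (intro span_add) auto
  then have "span ?D = UNIV" by auto
  then show ?thesis unfolding fin_dim_def using B C by (intro exI[of _ ?D]) auto
qed

text \<open>Expansion in an orthonormal frame writes \<open>f\<close> as a finite sum of bounded
  linear maps.\<close>

lemma linear_imp_bounded_linear_fin_dim:
  fixes f :: "'a::real_inner \<Rightarrow> 'b::real_normed_vector"
  assumes "fin_dim TYPE('a)" "linear f"
  shows "bounded_linear f"
proof -
  obtain B :: "'a set" where B: "finite B" "\<And>x. (\<Sum>b\<in>B. (x \<bullet> b) *\<^sub>R b) = x"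
    using fin_dim_frame[OF assms(1)] by metis
  have "f = (\<lambda>x. \<Sum>b\<in>B. (x \<bullet> b) *\<^sub>R f b)"
  proof
    fix x
    have "f x = f (\<Sum>b\<in>B. (x \<bullet> b) *\<^sub>R b)" by (simp add: B)
    then show "f x = (\<Sum>b\<in>B. (x \<bullet> b) *\<^sub>R f b)"
      using assms(2) by (simp add: linear_sum linear_scale)
  qed
  moreover have "bounded_linear (\<lambda>x. \<Sum>b\<in>B. (x \<bullet> b) *\<^sub>R f b)"
    by (intro bounded_linear_sum bounded_linear_scaleR_const bounded_linear_inner_left)
  ultimately show ?thesis by simp
qed

text \<open>Each \<open>f b\<close> with \<open>b\<close> in the frame has its own bound
  \<open>K b\<close>; by Cauchy-Schwarz the coefficients of \<open>x\<close> are at most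
  \<open>norm x\<close>, so the sum of the \<open>K b\<close> bounds \<open>f\<close>.\<close>

lemma bilinear_imp_bounded_bilinear_fin_dim:
  fixes f :: "'a::real_inner \<Rightarrow> 'b::real_inner \<Rightarrow> 'c::real_normed_vector"
  assumes fa: "fin_dim TYPE('a)" and fb: "fin_dim TYPE('b)"
    and "\<And>y. linear (\<lambda>x. f x y)" "\<And>x. linear (f x)"
  shows "bounded_bilinear f"
proof -
  obtain B :: "'a set" where B: "finite B" "\<And>x. (\<Sum>b\<in>B. (x \<bullet> b) *\<^sub>R b) = x"
     "\<And>a b. a \<in> B \<Longrightarrow> b \<in> B \<Longrightarrow> a \<bullet> b = (if a = b then 1 else 0)"
    using fin_dim_frame[OF fa] by metis
  have bd: "\<exists>K. \<forall>y. norm (f b y) \<le> norm y * K" for b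
    using linear_imp_bounded_linear_fin_dim[OF fb assms(4)[of b]]
    by (simp add: bounded_linear_def bounded_linear_axioms_def)
  then obtain K where K: "\<And>b y. norm (f b y) \<le> norm y * K b" by metis
  have ex: "f x y = (\<Sum>b\<in>B. (x \<bullet> b) *\<^sub>R f b y)" for x y
  proof -
    have "f x y = f (\<Sum>b\<in>B. (x \<bullet> b) *\<^sub>R b) y" by (simp add: B)
    also have "\<dots> = (\<Sum>b\<in>B. (x \<bullet> b) *\<^sub>R f b y)"
      by (simp add: linear_sum[OF assms(3)] linear_scale[OF assms(3)])
    finally show ?thesis .
  qed
  have "norm (f x y) \<le> norm x * norm y * (\<Sum>b\<in>B. K b)" for x y
  proof -
    have "norm (f x y) \<le> (\<Sum>b\<in>B. norm ((x \<bullet> b) *\<^sub>R f b y))" unfolding ex[of x] by (rule norm_sum)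
    also have "\<dots> \<le> (\<Sum>b\<in>B. norm x * (norm y * K b))"
    proof (rule sum_mono)
      fix b assume "b \<in> B"
      then have "norm b = 1" using B(3)[of b b] by (simp add: norm_eq_sqrt_inner)
      then have "\<bar>x \<bullet> b\<bar> \<le> norm x" using Cauchy_Schwarz_ineq2[of x b] by simp
      then show "norm ((x \<bullet> b) *\<^sub>R f b y) \<le> norm x * (norm y * K b)"
        using K by (simp, intro mult_mono) auto
    qed
    finally show ?thesis by (simp add: sum_distrib_left mult.assoc)
  qed
  then show ?thesis
    using linear_add[OF assms(3)] linear_scale[OF assms(3)] linear_add[OF assms(4)] linear_scale[OF assms(4)]
    by (intro bounded_bilinear.intro) auto
qed


section \<open>Closure properties of C^k and smooth functions\<close>

lemma Ck_on_cong:
  assumes "open S" "\<And>x. x \<in> S \<Longrightarrow> f x = g x" "Ck_on k f S"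
  shows "Ck_on k g S"
proof (cases k)
  case 0
  then show ?thesis using assms continuous_on_cong[of S S f g] by simp
next
  case (Suc n)
  then show ?thesis using assms has_derivative_transform_within_open[of f _ _ UNIV S g]
    by (auto simp: ) blast
qed

lemma Ck_on_subset: "Ck_on k f S \<Longrightarrow> T \<subseteq> S \<Longrightarrow> Ck_on k f T"
proof (induction k arbitrary: f)
  case 0
  then show ?case using continuous_on_subset by auto
next
  case (Suc k)
  from Suc.prems obtain f' where
     "\<forall>x\<in>S. (f has_derivative f' x) (at x)" "\<And>v. Ck_on k (\<lambda>x. f' x v) S" by auto
  then show ?case using Suc.IH Suc.prems(2) by (auto intro!: exI[of _ f'])
qed

lemma Ck_on_Suc_imp: "Ck_on (Suc k) f S \<Longrightarrow> Ck_on k f S"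
proof (induction k arbitrary: f)
  case 0
  then show ?case
    by (auto intro!: continuous_at_imp_continuous_on intro: has_derivative_continuous)
next
  case (Suc k)
  from Suc.prems obtain f' where f': "\<forall>x\<in>S. (f has_derivative f' x) (at x)"
     "\<And>v. Ck_on (Suc k) (\<lambda>x. f' x v) S" unfolding Ck_on.simps(2)[of "Suc k"] by blast
  then show ?case using Suc.IH unfolding Ck_on.simps(2)[of k] by blast
qed

text \<open>Replaces the existentially quantified derivative by the canonical one. Derivatives
  obtained on different open sets then agree, which is what gluing in \<open>Ck_on_local\<close>
  needs.\<close>

lemma Ck_on_Suc_iff:
  assumes "open S"
  shows "Ck_on (Suc k) f S \<longleftrightarrow> (\<forall>x\<in>S. f differentiable at x) \<and>
    (\<forall>v. Ck_on k (\<lambda>x. frechet_derivative f (at x) v) S)"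
proof
  assume "Ck_on (Suc k) f S"
  then obtain f' where f': "\<And>x. x \<in> S \<Longrightarrow> (f has_derivative f' x) (at x)"
     "\<And>v. Ck_on k (\<lambda>x. f' x v) S" by auto
  have "Ck_on k (\<lambda>x. frechet_derivative f (at x) v) S" for v
    using f'(2) by (rule Ck_on_cong[OF assms, rotated]) (simp add: frechet_derivative_at[OF f'(1)])
  then show "(\<forall>x\<in>S. f differentiable at x) \<and> (\<forall>v. Ck_on k (\<lambda>x. frechet_derivative f (at x) v) S)"
    using f'(1) differentiableI by blast
qed (auto simp: frechet_derivative_works)

lemma Ck_on_local:
  assumes "open S" "\<And>x. x \<in> S \<Longrightarrow> \<exists>U. open U \<and> x \<in> U \<and> Ck_on k f (U \<inter> S)"
  shows "Ck_on k f S"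
  using assms(2)
proof (induction k arbitrary: f)
  case 0
  have "isCont f x" if "x \<in> S" for x
    using 0[OF that] assms(1) that by (metis Ck_on.simps(1) IntI continuous_on_eq_continuous_at open_Int)
  then show ?case using continuous_at_imp_continuous_on by auto
next
  case (Suc k)
  show ?case unfolding Ck_on_Suc_iff[OF assms(1)]
  proof (intro conjI allI ballI)
    fix x assume "x \<in> S"
    then show "f differentiable at x"
      using Suc.prems[of x] assms(1) Ck_on_Suc_iff[of "_ \<inter> S" k f] by (metis IntI open_Int)
  next
    fix v
    show "Ck_on k (\<lambda>x. frechet_derivative f (at x) v) S"
    proof (rule Suc.IH)
      fix x assume "x \<in> S"
      then show "\<exists>U. open U \<and> x \<in> U \<and> Ck_on k (\<lambda>x. frechet_derivative f (at x) v) (U \<inter> S)"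
        using Suc.prems[of x] assms(1) Ck_on_Suc_iff[of "_ \<inter> S" k f] by (metis open_Int)
    qed
  qed
qed

lemma Ck_on_const: "Ck_on k (\<lambda>x. c) S"
proof (induction k arbitrary: c)
  case (Suc k)
  show ?case using Suc[of 0] by (auto intro!: exI[of _ "\<lambda>x v. 0"] derivative_intros)
qed simp

lemma Ck_on_bounded_linear:
  assumes "bounded_linear f"
  shows "Ck_on k f S"
proof (cases k)
  case 0
  then show ?thesis using assms by (simp add: linear_continuous_on)
next
  case (Suc n)
  then show ?thesis using bounded_linear_imp_has_derivative[OF assms] Ck_on_const
    by (auto intro!: exI[of _ "\<lambda>x. f"])
qed

lemma Ck_on_add: "Ck_on k f S \<Longrightarrow> Ck_on k g S \<Longrightarrow> Ck_on k (\<lambda>x. f x + g x) S"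
proof (induction k arbitrary: f g)
  case 0
  then show ?case by (auto intro: continuous_intros)
next
  case (Suc k)
  from Suc.prems obtain f' g' where
     "\<forall>x\<in>S. (f has_derivative f' x) (at x)" "\<And>v. Ck_on k (\<lambda>x. f' x v) S"
     "\<forall>x\<in>S. (g has_derivative g' x) (at x)" "\<And>v. Ck_on k (\<lambda>x. g' x v) S" by auto
  then show ?case using Suc.IH
    by (auto intro!: exI[of _ "\<lambda>x v. f' x v + g' x v"] derivative_intros)
qed

lemma Ck_on_sum:
  "(\<And>i. i \<in> I \<Longrightarrow> Ck_on k (f i) S) \<Longrightarrow> Ck_on k (\<lambda>x. \<Sum>i\<in>I. f i x) S"
  by (induction I rule: infinite_finite_induct) (auto simp: Ck_on_const Ck_on_add)

lemma Ck_on_linear_compose: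
  assumes "bounded_linear L" shows "Ck_on k f S \<Longrightarrow> Ck_on k (\<lambda>x. L (f x)) S"
proof (induction k arbitrary: f)
  case 0
  then show ?case using bounded_linear.continuous_on[OF assms] by auto
next
  case (Suc k)
  from Suc.prems obtain f' where
     f': "\<forall>x\<in>S. (f has_derivative f' x) (at x)" "\<And>v. Ck_on k (\<lambda>x. f' x v) S" by auto
  have "\<forall>x\<in>S. ((\<lambda>x. L (f x)) has_derivative (\<lambda>v. L (f' x v))) (at x)"
    using f'(1) by (intro ballI bounded_linear.has_derivative[OF assms]) blast
  then show ?case using Suc.IH[OF f'(2)] by (auto intro!: exI[of _ "\<lambda>x v. L (f' x v)"])
qed

lemma Ck_on_bilinear:
  assumes "bounded_bilinear B"
  shows "Ck_on k f S \<Longrightarrow> Ck_on k g S \<Longrightarrow> Ck_on k (\<lambda>x. B (f x) (g x)) S"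
proof (induction k arbitrary: f g)
  case 0
  then show ?case using bounded_bilinear.continuous_on[OF assms] by auto
next
  case (Suc k)
  from Suc.prems obtain f' g' where d:
     "\<forall>x\<in>S. (f has_derivative f' x) (at x)" "\<And>v. Ck_on k (\<lambda>x. f' x v) S"
     "\<forall>x\<in>S. (g has_derivative g' x) (at x)" "\<And>v. Ck_on k (\<lambda>x. g' x v) S" by auto
  show ?case using d Suc.IH Ck_on_Suc_imp[OF Suc.prems(1)] Ck_on_Suc_imp[OF Suc.prems(2)]
    by (auto intro!: exI[of _ "\<lambda>x v. B (f x) (g' x v) + B (f' x v) (g x)"] Ck_on_add
        bounded_bilinear.FDERIV[OF assms])
qed

text \<open>The chain rule yields \<open>f' (g x) (g' x v)\<close>, whose direction moves with
  \<open>x\<close>, while \<open>Ck_on\<close> speaks of fixed directions only. Expanding the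
  direction in a frame leaves products of coefficient functions with derivatives of \<open>f\<close>
  in fixed directions, and the induction hypothesis applies to these.\<close>

lemma Ck_on_compose:
  fixes f :: "'b::real_inner \<Rightarrow> 'c::real_normed_vector" and g :: "'a::real_normed_vector \<Rightarrow> 'b"
  assumes "fin_dim TYPE('b)"
  shows "Ck_on k f T \<Longrightarrow> Ck_on k g S \<Longrightarrow> g ` S \<subseteq> T \<Longrightarrow> Ck_on k (\<lambda>x. f (g x)) S"
proof (induction k arbitrary: f g)
  case 0
  then show ?case using continuous_on_compose2 by auto
next
  case (Suc k)
  obtain B :: "'b set" where B: "finite B" "\<And>x. (\<Sum>b\<in>B. (x \<bullet> b) *\<^sub>R b) = x"
    using fin_dim_frame[OF assms(1)] by metis
  from Suc.prems(1) obtain f' where f': "\<forall>x\<in>T. (f has_derivative f' x) (at x)"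
     "\<forall>v. Ck_on k (\<lambda>x. f' x v) T" unfolding Ck_on.simps by (elim exE conjE)
  from Suc.prems(2) obtain g' where g': "\<forall>x\<in>S. (g has_derivative g' x) (at x)"
     "\<forall>v. Ck_on k (\<lambda>x. g' x v) S" unfolding Ck_on.simps by (elim exE conjE)
  note d = bspec[OF f'(1)] spec[OF f'(2)] bspec[OF g'(1)] spec[OF g'(2)]
  let ?h = "\<lambda>x v. \<Sum>b\<in>B. (g' x v \<bullet> b) *\<^sub>R f' (g x) b"
  have "((\<lambda>x. f (g x)) has_derivative ?h x) (at x)" if "x \<in> S" for x
  proof -
    have 1: "((\<lambda>x. f (g x)) has_derivative (\<lambda>v. f' (g x) (g' x v))) (at x)"
      using d(1)[of "g x"] d(3)[OF that] that Suc.prems(3) has_derivative_compose by blast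
    have l: "linear (f' (g x))"
      using d(1)[of "g x"] that Suc.prems(3) has_derivative_linear by blast
    have "f' (g x) (g' x v) = ?h x v" for v
    proof -
      have "f' (g x) (g' x v) = f' (g x) (\<Sum>b\<in>B. (g' x v \<bullet> b) *\<^sub>R b)" by (simp add: B)
      also have "\<dots> = ?h x v" by (simp add: linear_sum[OF l] linear_scale[OF l])
      finally show ?thesis .
    qed
    then show ?thesis using 1 by presburger
  qed
  moreover have "Ck_on k (\<lambda>x. ?h x v) S" for v
    by (intro Ck_on_sum Ck_on_bilinear[OF bounded_bilinear_scaleR]
        Ck_on_linear_compose[OF bounded_linear_inner_left] d Suc.IH[OF d(2)]
        Ck_on_Suc_imp[OF Suc.prems(2)] Suc.prems(3))
  ultimately show ?case unfolding Ck_on.simps by (intro exI[of _ ?h] conjI ballI allI)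
qed

lemma smooth_on_cong:
  assumes "open S" "\<And>x. x \<in> S \<Longrightarrow> f x = g x" "smooth_on f S"
  shows "smooth_on g S"
  using assms Ck_on_cong unfolding smooth_on_def by blast

lemma smooth_on_subset: "smooth_on f S \<Longrightarrow> T \<subseteq> S \<Longrightarrow> smooth_on f T"
  unfolding smooth_on_def using Ck_on_subset by blast

lemma smooth_on_local:
  assumes "open S" "\<And>x. x \<in> S \<Longrightarrow> \<exists>U. open U \<and> x \<in> U \<and> smooth_on f (U \<inter> S)"
  shows "smooth_on f S"
  unfolding smooth_on_def
proof
  fix k show "Ck_on k f S"
    using assms unfolding smooth_on_def by (intro Ck_on_local) meson+
qed

lemma smooth_on_const [simp]: "smooth_on (\<lambda>x. c) S"
  by (simp add: smooth_on_def Ck_on_const)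

lemma smooth_on_bounded_linear: "bounded_linear f \<Longrightarrow> smooth_on f S"
  by (simp add: smooth_on_def Ck_on_bounded_linear)

lemma smooth_on_ident [simp]: "smooth_on (\<lambda>x. x) S" "smooth_on id S"
  by (simp_all add: smooth_on_bounded_linear bounded_linear_ident id_def)

lemma smooth_on_add: "smooth_on f S \<Longrightarrow> smooth_on g S \<Longrightarrow> smooth_on (\<lambda>x. f x + g x) S"
  by (simp add: smooth_on_def Ck_on_add)

lemma smooth_on_sum:
  "(\<And>i. i \<in> I \<Longrightarrow> smooth_on (f i) S) \<Longrightarrow> smooth_on (\<lambda>x. \<Sum>i\<in>I. f i x) S"
  by (simp add: smooth_on_def Ck_on_sum)

lemma smooth_on_linear_compose:
  "bounded_linear L \<Longrightarrow> smooth_on f S \<Longrightarrow> smooth_on (\<lambda>x. L (f x)) S"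
  by (simp add: smooth_on_def Ck_on_linear_compose)

lemma smooth_on_bilinear:
  "bounded_bilinear B \<Longrightarrow> smooth_on f S \<Longrightarrow> smooth_on g S \<Longrightarrow> smooth_on (\<lambda>x. B (f x) (g x)) S"
  by (simp add: smooth_on_def Ck_on_bilinear)

lemma smooth_on_mult:
  fixes f g :: "'a::real_normed_vector \<Rightarrow> real"
  shows "smooth_on f S \<Longrightarrow> smooth_on g S \<Longrightarrow> smooth_on (\<lambda>x. f x * g x) S"
  by (rule smooth_on_bilinear[OF bounded_bilinear_mult])

lemma smooth_on_scaleR:
  "smooth_on f S \<Longrightarrow> smooth_on g S \<Longrightarrow> smooth_on (\<lambda>x. f x *\<^sub>R g x) S"
  by (rule smooth_on_bilinear[OF bounded_bilinear_scaleR])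

lemma smooth_on_compose:
  fixes f :: "'b::real_inner \<Rightarrow> 'c::real_normed_vector"
  assumes "fin_dim TYPE('b)" "smooth_on f T" "smooth_on g S" "g ` S \<subseteq> T"
  shows "smooth_on (\<lambda>x. f (g x)) S"
  using assms Ck_on_compose unfolding smooth_on_def by blast

lemma smooth_on_Pair:
  assumes "smooth_on f S" "smooth_on g S"
  shows "smooth_on (\<lambda>x. (f x, g x)) S"
proof -
  have "smooth_on (\<lambda>x. (f x, 0) + (0, g x)) S"
    by (intro smooth_on_add smooth_on_linear_compose[of "\<lambda>x. (x, 0)"]
        smooth_on_linear_compose[of "\<lambda>x. (0, x)"] assms bounded_linear_Pair
        bounded_linear_ident bounded_linear_zero)
  then show ?thesis by simp
qed

lemma smooth_on_imp_continuous_on: "smooth_on f S \<Longrightarrow> continuous_on S f"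
  unfolding smooth_on_def using Ck_on.simps(1) by blast

lemma smooth_on_has_derivative:
  "smooth_on f S \<Longrightarrow> x \<in> S \<Longrightarrow> (f has_derivative frechet_derivative f (at x)) (at x)"
  unfolding smooth_on_def using Ck_on.simps(2)[of 0 f S]
  by (metis differentiableI frechet_derivative_works)

lemma smooth_on_frechet_derivative:
  assumes "smooth_on f S" "open S"
  shows "smooth_on (\<lambda>x. frechet_derivative f (at x) v) S"
  using assms Ck_on_Suc_iff unfolding smooth_on_def by blast

text \<open>The frame expansion from the chain rule again, now with a base point \<open>h x\<close>
  and a direction \<open>w x\<close> that both vary.\<close>

lemma smooth_on_frechet_derivative_field:
  fixes f :: "'a::real_inner \<Rightarrow> 'b::real_normed_vector" and w :: "'c::real_normed_vector \<Rightarrow> 'a"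
  assumes fin: "fin_dim TYPE('a)" and f: "smooth_on f S" and S: "open S"
    and h: "smooth_on h R" "h ` R \<subseteq> S" and w: "smooth_on w R" and R: "open R"
  shows "smooth_on (\<lambda>x. frechet_derivative f (at (h x)) (w x)) R"
proof -
  obtain B :: "'a set" where B: "finite B" "\<And>x. (\<Sum>b\<in>B. (x \<bullet> b) *\<^sub>R b) = x"
    using fin_dim_frame[OF fin] by metis
  have eq: "(\<Sum>b\<in>B. (w x \<bullet> b) *\<^sub>R frechet_derivative f (at (h x)) b) =
      frechet_derivative f (at (h x)) (w x)" if "x \<in> R" for x
  proof -
    have l: "linear (frechet_derivative f (at (h x)))"
      using smooth_on_has_derivative[OF f] h(2) that has_derivative_linear by blast
    have "frechet_derivative f (at (h x)) (w x) =
        frechet_derivative f (at (h x)) (\<Sum>b\<in>B. (w x \<bullet> b) *\<^sub>R b)" by (simp add: B)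
    also have "\<dots> = (\<Sum>b\<in>B. (w x \<bullet> b) *\<^sub>R frechet_derivative f (at (h x)) b)"
      by (simp add: linear_sum[OF l] linear_scale[OF l])
    finally show ?thesis ..
  qed
  show ?thesis
    by (rule smooth_on_cong[OF R eq], assumption) (intro smooth_on_sum smooth_on_scaleR w
        smooth_on_linear_compose[OF bounded_linear_inner_left]
        smooth_on_compose[OF fin smooth_on_frechet_derivative[OF f S] h])+
qed

text \<open>The quotient on the left is symmetric in \<open>v\<close> and \<open>w\<close>, while
  the limit names one order of differentiation; uniqueness of limits then gives the symmetry of
  second derivatives.\<close>

lemma second_difference_tendsto:
  fixes f :: "'a::real_normed_vector \<Rightarrow> real"
  assumes f: "smooth_on f S" and S: "open S" and x: "x \<in> S"
  shows "((\<lambda>h. (f (x + h *\<^sub>R w + h *\<^sub>R v) - f (x + h *\<^sub>R w) - f (x + h *\<^sub>R v) + f x) / h\<^sup>2) \<longlongrightarrow>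
    frechet_derivative (\<lambda>y. frechet_derivative f (at y) w) (at x) v) (at_right 0)"
proof (rule tendstoI)
  define f1 where "f1 = (\<lambda>y. frechet_derivative f (at y) w)"
  define g where "g = (\<lambda>y. frechet_derivative f1 (at y) v)"
  have f1s: "smooth_on f1 S" unfolding f1_def by (rule smooth_on_frechet_derivative[OF f S])
  have gs: "smooth_on g S" unfolding g_def by (rule smooth_on_frechet_derivative[OF f1s S])
  fix \<epsilon> :: real assume "\<epsilon> > 0"
  have "isCont g x"
    using smooth_on_imp_continuous_on[OF gs] S x continuous_on_eq_continuous_at by blast
  then obtain d1 where d1: "d1 > 0" "\<And>y. dist y x < d1 \<Longrightarrow> dist (g y) (g x) < \<epsilon>"
    using \<open>\<epsilon> > 0\<close> by (auto simp: continuous_at_eps_delta)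
  obtain d2 where d2: "d2 > 0" "ball x d2 \<subseteq> S" using S x openE by blast
  \<comment> \<open>With this \<open>d\<close>, every point \<open>x + p w + q v\<close> with
    \<open>p\<close> and \<open>q\<close> between 0 and some \<open>h < d\<close> is closer to
    \<open>x\<close> than both \<open>d1\<close> and \<open>d2\<close>. The summand 1 keeps the
    denominator positive when \<open>v\<close> and \<open>w\<close> vanish.\<close>
  define d where "d = min d1 d2 / (norm w + norm v + 1)"
  have pos: "norm w + norm v + 1 > 0" by (smt (verit) norm_ge_zero)
  have d: "d > 0" unfolding d_def using d1 d2 pos by simp
  have near: "dist (x + p *\<^sub>R w + q *\<^sub>R v) x < min d1 d2"
    if "0 \<le> p" "p \<le> h" "0 \<le> q" "q \<le> h" "h < d" for p q h
  proof -
    have "dist (x + p *\<^sub>R w + q *\<^sub>R v) x \<le> p * norm w + q * norm v"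
      unfolding dist_norm using norm_triangle_ineq[of "p *\<^sub>R w" "q *\<^sub>R v"] that
      by (simp add: add.assoc)
    also have "\<dots> \<le> h * norm w + h * norm v"
      using that by (intro add_mono mult_right_mono) auto
    also have "\<dots> \<le> h * (norm w + norm v + 1)" using that by (simp add: algebra_simps)
    also have "\<dots> < d * (norm w + norm v + 1)" using that pos by simp
    also have "\<dots> = min d1 d2" unfolding d_def using pos by simp
    finally show ?thesis .
  qed
  then have inS: "x + p *\<^sub>R w + q *\<^sub>R v \<in> S"
    if "0 \<le> p" "p \<le> h" "0 \<le> q" "q \<le> h" "h < d" for p q h
    using that d2(2) by (metis dist_commute mem_ball min_less_iff_conj subsetD)
  have dir: "((\<lambda>t. k (a + t *\<^sub>R u)) has_real_derivative frechet_derivative k (at (a + t *\<^sub>R u)) u) (at t)"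
    if "smooth_on k S" "a + t *\<^sub>R u \<in> S" for k :: "'a \<Rightarrow> real" and a u t
  proof -
    have k: "(k has_derivative frechet_derivative k (at (a + t *\<^sub>R u))) (at (a + t *\<^sub>R u))"
      using smooth_on_has_derivative that by blast
    have "((\<lambda>t. k (a + t *\<^sub>R u)) has_derivative
        (\<lambda>s. frechet_derivative k (at (a + t *\<^sub>R u)) (s *\<^sub>R u))) (at t)"
      by (rule has_derivative_compose[where g = k and f = "\<lambda>t. a + t *\<^sub>R u", OF _ k]) (auto intro!: derivative_eq_intros)
    moreover have "frechet_derivative k (at (a + t *\<^sub>R u)) (s *\<^sub>R u) =
        frechet_derivative k (at (a + t *\<^sub>R u)) u * s" for s
      using linear_scale[OF has_derivative_linear[OF k]] by (simp add: mult.commute)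
    ultimately show ?thesis by (simp add: has_field_derivative_def)
  qed
  have key: "dist ((f (x + h *\<^sub>R w + h *\<^sub>R v) - f (x + h *\<^sub>R w) - f (x + h *\<^sub>R v) + f x) / h\<^sup>2) (g x) < \<epsilon>"
    if h: "0 < h" "h < d" for h
  proof -
    \<comment> \<open>The second difference is the increment of \<open>?\<phi>\<close> over the
      interval from 0 to \<open>h\<close>. The mean value theorem is applied to it in direction
      \<open>w\<close>, then to the resulting increment of \<open>f1\<close> in direction
      \<open>v\<close>.\<close>
    let ?\<phi> = "\<lambda>s. f ((x + h *\<^sub>R v) + s *\<^sub>R w) - f (x + s *\<^sub>R w)"
    have "\<exists>\<xi>>0. \<xi> < h \<and> ?\<phi> h - ?\<phi> 0 =
      (h - 0) * (f1 ((x + h *\<^sub>R v) + \<xi> *\<^sub>R w) - f1 (x + \<xi> *\<^sub>R w))"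
    proof (rule MVT2)
      fix s assume s: "0 \<le> s" "s \<le> h"
      have "(x + h *\<^sub>R v) + s *\<^sub>R w \<in> S" "x + s *\<^sub>R w \<in> S"
        using inS[of s h h] inS[of s h 0] s h by (simp_all add: algebra_simps)
      then show "(?\<phi> has_real_derivative f1 ((x + h *\<^sub>R v) + s *\<^sub>R w) - f1 (x + s *\<^sub>R w)) (at s)"
        unfolding f1_def by (intro DERIV_diff dir f)
    qed fact
    then obtain \<xi> where xi: "\<xi> > 0" "\<xi> < h"
      "?\<phi> h - ?\<phi> 0 = h * (f1 ((x + h *\<^sub>R v) + \<xi> *\<^sub>R w) - f1 (x + \<xi> *\<^sub>R w))" by auto
    have "\<exists>\<eta>>0. \<eta> < h \<and> f1 ((x + \<xi> *\<^sub>R w) + h *\<^sub>R v) - f1 ((x + \<xi> *\<^sub>R w) + 0 *\<^sub>R v) =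
      (h - 0) * g ((x + \<xi> *\<^sub>R w) + \<eta> *\<^sub>R v)"
    proof (rule MVT2)
      fix s assume s: "0 \<le> s" "s \<le> h"
      have "(x + \<xi> *\<^sub>R w) + s *\<^sub>R v \<in> S" using inS[of \<xi> h s] s h xi by simp
      then show "((\<lambda>s. f1 ((x + \<xi> *\<^sub>R w) + s *\<^sub>R v)) has_real_derivative
          g ((x + \<xi> *\<^sub>R w) + s *\<^sub>R v)) (at s)"
        unfolding g_def by (intro dir f1s)
    qed fact
    then obtain \<eta> where eta: "\<eta> > 0" "\<eta> < h"
      "f1 ((x + \<xi> *\<^sub>R w) + h *\<^sub>R v) - f1 (x + \<xi> *\<^sub>R w) = h * g ((x + \<xi> *\<^sub>R w) + \<eta> *\<^sub>R v)" by auto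
    have "(f (x + h *\<^sub>R w + h *\<^sub>R v) - f (x + h *\<^sub>R w) - f (x + h *\<^sub>R v) + f x) = ?\<phi> h - ?\<phi> 0"
      by (simp add: algebra_simps)
    also have "\<dots> = h * (h * g ((x + \<xi> *\<^sub>R w) + \<eta> *\<^sub>R v))"
      using xi(3) eta(3) by (simp add: algebra_simps)
    finally have "(f (x + h *\<^sub>R w + h *\<^sub>R v) - f (x + h *\<^sub>R w) - f (x + h *\<^sub>R v) + f x) / h\<^sup>2
       = g ((x + \<xi> *\<^sub>R w) + \<eta> *\<^sub>R v)" using h by (simp add: power2_eq_square)
    then show ?thesis using d1(2) near[of \<xi> h \<eta>] xi eta h by simp
  qed
  show "\<forall>\<^sub>F h in at_right 0. dist ((f (x + h *\<^sub>R w + h *\<^sub>R v) - f (x + h *\<^sub>R w) - f (x + h *\<^sub>R v) + f x) / h\<^sup>2)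
      (frechet_derivative (\<lambda>y. frechet_derivative f (at y) w) (at x) v) < \<epsilon>"
    using key d unfolding g_def f1_def eventually_at_right_field by auto
qed

lemma second_derivative_commute:
  fixes f :: "'a::real_normed_vector \<Rightarrow> real"
  assumes f: "smooth_on f S" "open S" "x \<in> S"
  shows "frechet_derivative (\<lambda>y. frechet_derivative f (at y) w) (at x) v =
    frechet_derivative (\<lambda>y. frechet_derivative f (at y) v) (at x) w"
  by (rule tendsto_unique[OF _ second_difference_tendsto[OF f]])
    (use second_difference_tendsto[OF f, of v w] in \<open>simp_all add: algebra_simps\<close>)

section \<open>Smooth maps\<close>

lemma smooth_atlasD:
  assumes "smooth_atlas A" "(U, \<phi>) \<in> A"
  shows "open U" "open (\<phi> ` U)" "continuous_on U \<phi>" "continuous_on (\<phi> ` U) (inv_into U \<phi>)"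
    "inj_on \<phi> U"
proof -
  have "open U \<and> open (\<phi> ` U) \<and> homeomorphism U (\<phi> ` U) \<phi> (inv_into U \<phi>)"
    using assms unfolding smooth_atlas_def by blast
  then show "open U" "open (\<phi> ` U)" "continuous_on U \<phi>" "continuous_on (\<phi> ` U) (inv_into U \<phi>)"
    "inj_on \<phi> U" unfolding homeomorphism_def by (auto intro: inj_on_inverseI)
qed

lemma smooth_atlas_inv [simp]:
  assumes "smooth_atlas A" "(U, \<phi>) \<in> A" "p \<in> U"
  shows "inv_into U \<phi> (\<phi> p) = p"
  using smooth_atlasD(5)[OF assms(1,2)] assms(3) by simp

lemma smooth_atlas_fin_dim: "smooth_atlas (A :: ('g::topological_space, 'e::real_inner) chart set) \<Longrightarrow> fin_dim TYPE('e)"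
  unfolding smooth_atlas_def fin_dim_def by blast

lemma smooth_atlas_cover:
  assumes "smooth_atlas A"
  obtains U \<phi> where "(U, \<phi>) \<in> A" "p \<in> U"
proof -
  have "(\<Union>(U, \<phi>)\<in>A. U) = UNIV" using assms unfolding smooth_atlas_def by blast
  then show ?thesis using that by (metis (no_types, lifting) UNIV_I UN_E case_prod_beta prod.collapse)
qed

lemma chart_open_image:
  assumes "smooth_atlas A" "(U, \<phi>) \<in> A" "open W"
  shows "open (\<phi> ` (U \<inter> W))"
proof -
  note c = smooth_atlasD[OF assms(1,2)]
  have "\<phi> ` (U \<inter> W) = \<phi> ` U \<inter> inv_into U \<phi> -` W"
    using c(5) by (auto simp: image_iff)
  then show ?thesis using continuous_open_preimage[OF c(4) c(2) assms(3)] by simp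
qed

lemma smooth_mapI:
  assumes "continuous_on W F"
    "\<And>U \<phi> V \<psi>. (U, \<phi>) \<in> A \<Longrightarrow> (V, \<psi>) \<in> B \<Longrightarrow>
      smooth_on (\<psi> \<circ> F \<circ> inv_into U \<phi>) (\<phi> ` {p \<in> U \<inter> W. F p \<in> V})"
  shows "smooth_map A B F W"
  using assms unfolding smooth_map_def by blast

lemma smooth_mapD:
  assumes "smooth_map A B F W"
  shows "continuous_on W F"
    "(U, \<phi>) \<in> A \<Longrightarrow> (V, \<psi>) \<in> B \<Longrightarrow>
      smooth_on (\<psi> \<circ> F \<circ> inv_into U \<phi>) (\<phi> ` {p \<in> U \<inter> W. F p \<in> V})"
  using assms unfolding smooth_map_def by blast+

lemma smooth_map_subset:
  assumes F: "smooth_map A B F W" and sub: "W' \<subseteq> W"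
  shows "smooth_map A B F W'"
proof (rule smooth_mapI)
  fix U \<phi> V \<psi> assume "(U, \<phi>) \<in> A" "(V, \<psi>) \<in> B"
  then show "smooth_on (\<psi> \<circ> F \<circ> inv_into U \<phi>) (\<phi> ` {p \<in> U \<inter> W'. F p \<in> V})"
    by (rule smooth_on_subset[OF smooth_mapD(2)[OF F]]) (use sub in auto)
qed (use continuous_on_subset[OF smooth_mapD(1)[OF F] sub] in simp)

lemma smooth_map_preimage_open:
  assumes "open W" "continuous_on W F" "open V"
  shows "open {p \<in> W. F p \<in> V}"
proof -
  have "{p \<in> W. F p \<in> V} = W \<inter> F -` V" by auto
  then show ?thesis using continuous_open_preimage[OF assms(2,1,3)] by simp
qed

lemma smooth_map_chart_domain_open:
  assumes "smooth_atlas A" "(U, \<phi>) \<in> A" "open W" "continuous_on W F" "open V"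
  shows "open (\<phi> ` {p \<in> U \<inter> W. F p \<in> V})"
proof -
  have "{p \<in> U \<inter> W. F p \<in> V} = U \<inter> {p \<in> W. F p \<in> V}" by auto
  then show ?thesis using chart_open_image[OF assms(1,2) smooth_map_preimage_open[OF assms(3-5)]] by simp
qed

lemma smooth_map_local:
  assumes A: "smooth_atlas A" and B: "smooth_atlas B" and W: "open W"
    and loc: "\<And>p. p \<in> W \<Longrightarrow> \<exists>W'. open W' \<and> p \<in> W' \<and> smooth_map A B F (W' \<inter> W)"
  shows "smooth_map A B F W"
proof (rule smooth_mapI)
  let ?\<W> = "{W' \<inter> W | W'. open W' \<and> smooth_map A B F (W' \<inter> W)}"
  have "continuous_on (\<Union>?\<W>) F" by (intro continuous_on_open_Union) (auto simp: W dest: smooth_mapD(1))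
  moreover have "\<Union>?\<W> = W" using loc by blast
  ultimately show cont: "continuous_on W F" by simp
  fix U \<phi> V \<psi> assume U: "(U, \<phi>) \<in> A" and V: "(V, \<psi>) \<in> B"
  let ?S = "\<phi> ` {p \<in> U \<inter> W. F p \<in> V}"
  show "smooth_on (\<psi> \<circ> F \<circ> inv_into U \<phi>) ?S"
  proof (rule smooth_on_local)
    show "open ?S" by (rule smooth_map_chart_domain_open[OF A U W cont smooth_atlasD(1)[OF B V]])
    fix x assume "x \<in> ?S"
    then obtain p where p: "p \<in> U" "p \<in> W" "F p \<in> V" "x = \<phi> p" by auto
    obtain W' where W': "open W'" "p \<in> W'" "smooth_map A B F (W' \<inter> W)" using loc p by blast
    have "smooth_on (\<psi> \<circ> F \<circ> inv_into U \<phi>) (\<phi> ` {p \<in> U \<inter> (W' \<inter> W). F p \<in> V})"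
      using W'(3) U V unfolding smooth_map_def by blast
    moreover have "\<phi> ` (U \<inter> W') \<inter> ?S \<subseteq> \<phi> ` {p \<in> U \<inter> (W' \<inter> W). F p \<in> V}"
      using smooth_atlasD(5)[OF A U] by (auto dest: inj_onD)
    ultimately have "smooth_on (\<psi> \<circ> F \<circ> inv_into U \<phi>) (\<phi> ` (U \<inter> W') \<inter> ?S)"
      using smooth_on_subset by blast
    moreover have "open (\<phi> ` (U \<inter> W'))" by (rule chart_open_image[OF A U W'(1)])
    ultimately show "\<exists>U'. open U' \<and> x \<in> U' \<and> smooth_on (\<psi> \<circ> F \<circ> inv_into U \<phi>) (U' \<inter> ?S)"
      using p W'(2) by blast
  qed
qed

lemma smooth_map_cong:
  assumes A: "smooth_atlas A" and B: "smooth_atlas B" and W: "open W"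
    and eq: "\<And>p. p \<in> W \<Longrightarrow> F p = H p" and F: "smooth_map A B F W"
  shows "smooth_map A B H W"
proof (rule smooth_mapI)
  show "continuous_on W H" using smooth_mapD(1)[OF F] eq continuous_on_cong[of W W F H] by simp
next
  fix U \<phi> V \<psi> assume U: "(U, \<phi>) \<in> A" and V: "(V, \<psi>) \<in> B"
  have "smooth_on (\<psi> \<circ> H \<circ> inv_into U \<phi>) (\<phi> ` {p \<in> U \<inter> W. F p \<in> V})"
  proof (rule smooth_on_cong[OF _ _ smooth_mapD(2)[OF F U V]])
    show "open (\<phi> ` {p \<in> U \<inter> W. F p \<in> V})"
      by (rule smooth_map_chart_domain_open[OF A U W smooth_mapD(1)[OF F] smooth_atlasD(1)[OF B V]])
    fix x assume "x \<in> \<phi> ` {p \<in> U \<inter> W. F p \<in> V}"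
    then obtain p where "p \<in> U" "p \<in> W" "x = \<phi> p" by auto
    then show "(\<psi> \<circ> F \<circ> inv_into U \<phi>) x = (\<psi> \<circ> H \<circ> inv_into U \<phi>) x"
      using smooth_atlas_inv[OF A U] eq by simp
  qed
  moreover have "{p \<in> U \<inter> W. F p \<in> V} = {p \<in> U \<inter> W. H p \<in> V}" using eq by auto
  ultimately show "smooth_on (\<psi> \<circ> H \<circ> inv_into U \<phi>) (\<phi> ` {p \<in> U \<inter> W. H p \<in> V})" by simp
qed

text \<open>Near each point a chart of the middle manifold is inserted, so that the coordinate
  expression of the composite factors into two smooth maps between model spaces; the local results
  are then glued.\<close>

lemma smooth_map_compose:
  fixes A :: "('g::topological_space, 'e::real_inner) chart set"
    and B :: "('h::topological_space, 'f::real_inner) chart set"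
    and C :: "('i::topological_space, 'k::real_inner) chart set"
  assumes A: "smooth_atlas A" and B: "smooth_atlas B" and C: "smooth_atlas C"
    and F: "smooth_map A B F W" and H: "smooth_map B C H W'"
    and W: "open W" "open W'" and sub: "F ` W \<subseteq> W'"
  shows "smooth_map A C (\<lambda>x. H (F x)) W"
proof (rule smooth_mapI, goal_cases)
  case 1
  show ?case using F H sub unfolding smooth_map_def using continuous_on_compose2 by blast
next
  case (2 U \<phi> V \<psi>)
  note U = 2(1) and V = 2(2)
  have cF: "continuous_on W F" and cH: "continuous_on W' H" using F H unfolding smooth_map_def by blast+
  have cont: "continuous_on W (\<lambda>x. H (F x))" using cF cH sub continuous_on_compose2 by blast
  let ?S = "\<phi> ` {p \<in> U \<inter> W. H (F p) \<in> V}"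
  have oS: "open ?S" by (rule smooth_map_chart_domain_open[OF A U W(1) cont smooth_atlasD(1)[OF C V]])
  have "smooth_on (\<psi> \<circ> (\<lambda>x. H (F x)) \<circ> inv_into U \<phi>) ?S"
  proof (rule smooth_on_local[OF oS])
    fix x assume "x \<in> ?S"
    then obtain p where p: "p \<in> U" "p \<in> W" "H (F p) \<in> V" "x = \<phi> p" by auto
    obtain Q \<theta> where Q: "(Q, \<theta>) \<in> B" "F p \<in> Q" using smooth_atlas_cover[OF B] by metis
    let ?U0 = "\<phi> ` {p \<in> U \<inter> W. F p \<in> Q}"
    have U0: "open ?U0" by (rule smooth_map_chart_domain_open[OF A U W(1) cF smooth_atlasD(1)[OF B Q(1)]])
    have s1: "smooth_on (\<theta> \<circ> F \<circ> inv_into U \<phi>) ?U0" using F U Q unfolding smooth_map_def by blast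
    have s2: "smooth_on (\<psi> \<circ> H \<circ> inv_into Q \<theta>) (\<theta> ` {q \<in> Q \<inter> W'. H q \<in> V})"
      using H V Q unfolding smooth_map_def by blast
    \<comment> \<open>A point in both chart images comes with two preimages; injectivity of the
      chart identifies them, so one point satisfies all conditions.\<close>
    have im: "\<exists>p. p \<in> U \<and> F p \<in> Q \<and> H (F p) \<in> V \<and> F p \<in> W' \<and> y = \<phi> p"
      if y: "y \<in> ?U0 \<inter> ?S" for y
    proof -
      obtain p1 p2 where "y = \<phi> p1" "p1 \<in> U" "p1 \<in> W" "F p1 \<in> Q" "y = \<phi> p2" "p2 \<in> U" "H (F p2) \<in> V"
        using y by blast
      moreover from this have "p1 = p2" using inj_onD[OF smooth_atlasD(5)[OF A U]] by metis
      ultimately show ?thesis using sub by blast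
    qed
    have "smooth_on (\<lambda>y. (\<psi> \<circ> H \<circ> inv_into Q \<theta>) ((\<theta> \<circ> F \<circ> inv_into U \<phi>) y)) (?U0 \<inter> ?S)"
    proof (rule smooth_on_compose[OF smooth_atlas_fin_dim[OF B] s2])
      show "smooth_on (\<theta> \<circ> F \<circ> inv_into U \<phi>) (?U0 \<inter> ?S)" using s1 smooth_on_subset by blast
      show "(\<theta> \<circ> F \<circ> inv_into U \<phi>) ` (?U0 \<inter> ?S) \<subseteq> \<theta> ` {q \<in> Q \<inter> W'. H q \<in> V}"
      proof (rule image_subsetI)
        fix y assume "y \<in> ?U0 \<inter> ?S"
        then obtain p where "p \<in> U" "F p \<in> Q" "H (F p) \<in> V" "F p \<in> W'" "y = \<phi> p" using im by blast
        then show "(\<theta> \<circ> F \<circ> inv_into U \<phi>) y \<in> \<theta> ` {q \<in> Q \<inter> W'. H q \<in> V}"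
          using smooth_atlas_inv[OF A U] by auto
      qed
    qed
    then have "smooth_on (\<psi> \<circ> (\<lambda>x. H (F x)) \<circ> inv_into U \<phi>) (?U0 \<inter> ?S)"
    proof (rule smooth_on_cong[rotated 2])
      show "open (?U0 \<inter> ?S)" using U0 oS by blast
      fix y assume "y \<in> ?U0 \<inter> ?S"
      then obtain p where "p \<in> U" "F p \<in> Q" "y = \<phi> p" using im by blast
      then show "(\<psi> \<circ> H \<circ> inv_into Q \<theta>) ((\<theta> \<circ> F \<circ> inv_into U \<phi>) y) =
          (\<psi> \<circ> (\<lambda>x. H (F x)) \<circ> inv_into U \<phi>) y"
        using smooth_atlas_inv[OF A U] smooth_atlas_inv[OF B Q(1)] by simp
    qed
    then show "\<exists>U'. open U' \<and> x \<in> U' \<and> smooth_on (\<psi> \<circ> (\<lambda>x. H (F x)) \<circ> inv_into U \<phi>) (U' \<inter> ?S)"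
      using U0 p Q(2) by blast
  qed
  then show ?case .
qed

lemma smooth_atlas_std: "fin_dim TYPE('a::real_inner) \<Longrightarrow> smooth_atlas (std_atlas :: ('a, 'a) chart set)"
  unfolding smooth_atlas_def std_atlas_def fin_dim_def
  by (auto simp: homeomorphism_def inv_id o_def id_def continuous_on_id)

lemma smooth_map_std_std:
  "smooth_map std_atlas std_atlas f W \<longleftrightarrow> smooth_on f W"
  unfolding smooth_map_def std_atlas_def
  using smooth_on_imp_continuous_on by (auto simp: inv_id)

lemma smooth_map_id:
  assumes "smooth_atlas A" shows "smooth_map A A (\<lambda>x. x) W"
proof -
  have "smooth_on (\<psi> \<circ> inv_into U \<phi>) (\<phi> ` {p \<in> U \<inter> W. p \<in> V})" if "(U, \<phi>) \<in> A" "(V, \<psi>) \<in> A" for U \<phi> V \<psi>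
  proof -
    have "smooth_on (\<psi> \<circ> inv_into U \<phi>) (\<phi> ` (U \<inter> V))"
      using assms that unfolding smooth_atlas_def by blast
    then show ?thesis by (rule smooth_on_subset) auto
  qed
  then show ?thesis by (auto simp: smooth_map_def o_def)
qed

lemma smooth_map_const: "smooth_map A B (\<lambda>x. c) W"
  by (auto simp: smooth_map_def o_def)

lemma smooth_map_chart:
  assumes A: "smooth_atlas A" and U: "(U, \<phi>) \<in> A" shows "smooth_map A std_atlas \<phi> U"
proof (rule smooth_mapI, goal_cases)
  case 1
  show ?case by (rule smooth_atlasD(3)[OF A U])
next
  case (2 V \<psi> W \<theta>)
  then have cd: "(V, \<psi>) \<in> A" "W = UNIV" "\<theta> = id" by (auto simp: std_atlas_def)
  have "smooth_on (\<phi> \<circ> inv_into V \<psi>) (\<psi> ` (V \<inter> U))"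
    using A U cd unfolding smooth_atlas_def by blast
  then show ?case using cd by (simp add: Int_def)
qed

lemma smooth_map_inv_chart:
  assumes A: "smooth_atlas A" and U: "(U, \<phi>) \<in> A"
  shows "smooth_map std_atlas A (inv_into U \<phi>) (\<phi> ` U)"
proof (rule smooth_mapI, goal_cases)
  case 1
  show ?case by (rule smooth_atlasD(4)[OF A U])
next
  case (2 W \<theta> V \<psi>)
  then have cd: "(V, \<psi>) \<in> A" "W = UNIV" "\<theta> = id" by (auto simp: std_atlas_def)
  have "smooth_on (\<psi> \<circ> inv_into U \<phi>) (\<phi> ` (U \<inter> V))"
    using A U cd unfolding smooth_atlas_def by blast
  moreover have "{p \<in> UNIV \<inter> \<phi> ` U. inv_into U \<phi> p \<in> V} = \<phi> ` (U \<inter> V)"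
    using smooth_atlasD(5)[OF A U] by (auto simp: image_iff)
  ultimately show ?case using cd by (simp add: inv_id)
qed

lemma inv_into_map_prod:
  assumes "inj_on f S" "inj_on g T" "x \<in> f ` S" "y \<in> g ` T"
  shows "inv_into (S \<times> T) (map_prod f g) (x, y) = (inv_into S f x, inv_into T g y)"
proof -
  have "inj_on (map_prod f g) (S \<times> T)" using assms by (rule_tac map_prod_inj_on)
  moreover have "(x, y) = map_prod f g (inv_into S f x, inv_into T g y)"
    using assms by (simp add: f_inv_into_f)
  ultimately show ?thesis using assms(3,4) by (intro inv_into_f_eq) (auto intro: inv_into_into)
qed

lemma smooth_map_Pair:
  fixes A :: "('g::topological_space, 'e::real_inner) chart set"
    and B :: "('h::topological_space, 'f::real_inner) chart set"
    and C :: "('i::topological_space, 'k::real_inner) chart set"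
  assumes A: "smooth_atlas A" and B: "smooth_atlas B" and C: "smooth_atlas C"
    and F: "smooth_map A B F W" and H: "smooth_map A C H W" and W: "open W"
  shows "smooth_map A (prod_atlas B C) (\<lambda>x. (F x, H x)) W"
proof (rule smooth_mapI, goal_cases)
  case 1
  show ?case using F H unfolding smooth_map_def by (auto intro: continuous_on_Pair)
next
  case (2 U \<phi> V' \<psi>')
  then obtain V \<psi> Q \<theta> where cd: "V' = V \<times> Q" "\<psi>' = map_prod \<psi> \<theta>"
    "(U, \<phi>) \<in> A" "(V, \<psi>) \<in> B" "(Q, \<theta>) \<in> C" unfolding prod_atlas_def by auto
  have "smooth_on (\<psi> \<circ> F \<circ> inv_into U \<phi>) (\<phi> ` {p \<in> U \<inter> W. F p \<in> V})"
     "smooth_on (\<theta> \<circ> H \<circ> inv_into U \<phi>) (\<phi> ` {p \<in> U \<inter> W. H p \<in> Q})"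
    using F H cd unfolding smooth_map_def by blast+
  then have "smooth_on (\<psi> \<circ> F \<circ> inv_into U \<phi>) (\<phi> ` {p \<in> U \<inter> W. F p \<in> V \<and> H p \<in> Q})"
     "smooth_on (\<theta> \<circ> H \<circ> inv_into U \<phi>) (\<phi> ` {p \<in> U \<inter> W. F p \<in> V \<and> H p \<in> Q})"
    by (auto elim!: smooth_on_subset)
  from smooth_on_Pair[OF this] show ?case by (simp add: cd o_def)
qed

lemma smooth_atlas_prod:
  fixes A :: "('g::topological_space, 'e::real_inner) chart set"
    and B :: "('h::topological_space, 'f::real_inner) chart set"
  assumes A: "smooth_atlas A" and B: "smooth_atlas B"
  shows "smooth_atlas (prod_atlas A B)"
  unfolding smooth_atlas_def
proof (intro conjI ballI, goal_cases)
  case 1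
  show ?case using fin_dim_prod[OF smooth_atlas_fin_dim[OF A] smooth_atlas_fin_dim[OF B]]
    unfolding fin_dim_def .
next
  case (2 c)
  then obtain U \<phi> V \<psi> where c: "c = (U \<times> V, map_prod \<phi> \<psi>)" "(U, \<phi>) \<in> A" "(V, \<psi>) \<in> B"
    unfolding prod_atlas_def by auto
  note a = smooth_atlasD[OF A c(2)] and b = smooth_atlasD[OF B c(3)]
  have im: "map_prod \<phi> \<psi> ` (U \<times> V) = \<phi> ` U \<times> \<psi> ` V" by auto
  have cont: "continuous_on (U \<times> V) (map_prod \<phi> \<psi>)"
    unfolding map_prod_def case_prod_beta
    by (intro continuous_on_Pair continuous_on_compose2[OF a(3)] continuous_on_compose2[OF b(3)]
        continuous_on_fst continuous_on_snd continuous_on_id) auto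
  have "continuous_on (\<phi> ` U \<times> \<psi> ` V) (\<lambda>x. (inv_into U \<phi> (fst x), inv_into V \<psi> (snd x)))"
    by (intro continuous_on_Pair continuous_on_compose2[OF a(4)] continuous_on_compose2[OF b(4)]
        continuous_on_fst continuous_on_snd continuous_on_id) auto
  moreover have "inv_into (U \<times> V) (map_prod \<phi> \<psi>) x = (inv_into U \<phi> (fst x), inv_into V \<psi> (snd x))"
    if "x \<in> \<phi> ` U \<times> \<psi> ` V" for x
    using inv_into_map_prod[OF a(5) b(5)] that by (cases x) simp
  ultimately have "continuous_on (\<phi> ` U \<times> \<psi> ` V) (inv_into (U \<times> V) (map_prod \<phi> \<psi>))"
    using continuous_on_cong by (metis (no_types, lifting))
  moreover have "inj_on (map_prod \<phi> \<psi>) (U \<times> V)" using a(5) b(5) by (rule map_prod_inj_on)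
  ultimately have "homeomorphism (U \<times> V) (map_prod \<phi> \<psi> ` (U \<times> V)) (map_prod \<phi> \<psi>)
      (inv_into (U \<times> V) (map_prod \<phi> \<psi>))"
    using cont im inv_into_image_cancel[OF \<open>inj_on (map_prod \<phi> \<psi>) (U \<times> V)\<close>, of "U \<times> V"]
    unfolding homeomorphism_def by (simp add: f_inv_into_f del: map_prod_surj_on)
  moreover have "open (U \<times> V)" "open (map_prod \<phi> \<psi> ` (U \<times> V))"
    unfolding im using a b by (intro open_Times; simp)+
  ultimately show ?case by (simp add: c)
next
  case 3
  have "\<exists>U\<phi>\<in>prod_atlas A B. x \<in> fst U\<phi>" for x
  proof -
    obtain U \<phi> where "(U, \<phi>) \<in> A" "fst x \<in> U" using smooth_atlas_cover[OF A] by metis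
    moreover obtain V \<psi> where "(V, \<psi>) \<in> B" "snd x \<in> V" using smooth_atlas_cover[OF B] by metis
    ultimately show ?thesis unfolding prod_atlas_def
      by (intro bexI[of _ "(U \<times> V, map_prod \<phi> \<psi>)"]) (auto simp: mem_Times_iff)
  qed
  then show ?case by (auto simp: case_prod_beta)
next
  case (4 c)
  then obtain U \<phi> V \<psi> where c: "c = (U \<times> V, map_prod \<phi> \<psi>)" "(U, \<phi>) \<in> A" "(V, \<psi>) \<in> B"
    unfolding prod_atlas_def by auto
  have "case d of (V', \<psi>') \<Rightarrow>
      smooth_on (\<psi>' \<circ> inv_into (U \<times> V) (map_prod \<phi> \<psi>)) (map_prod \<phi> \<psi> ` ((U \<times> V) \<inter> V'))"
    if dd: "d \<in> prod_atlas A B" for d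
  proof -
  from dd obtain U' \<phi>' V' \<psi>' where d: "d = (U' \<times> V', map_prod \<phi>' \<psi>')" "(U', \<phi>') \<in> A" "(V', \<psi>') \<in> B"
    unfolding prod_atlas_def by auto
  have inj: "inj_on \<phi> U" "inj_on \<psi> V" using smooth_atlasD(5) A B c by blast+
  have s: "smooth_on (\<phi>' \<circ> inv_into U \<phi>) (\<phi> ` (U \<inter> U'))" "smooth_on (\<psi>' \<circ> inv_into V \<psi>) (\<psi> ` (V \<inter> V'))"
    using A B c d unfolding smooth_atlas_def by blast+
  let ?S = "\<phi> ` (U \<inter> U') \<times> \<psi> ` (V \<inter> V')"
  have oS: "open ?S"
    using chart_open_image[OF A c(2) smooth_atlasD(1)[OF A d(2)]]
       chart_open_image[OF B c(3) smooth_atlasD(1)[OF B d(3)]] by (rule open_Times)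
  have "smooth_on (\<lambda>x. ((\<phi>' \<circ> inv_into U \<phi>) (fst x), (\<psi>' \<circ> inv_into V \<psi>) (snd x))) ?S"
    by (intro smooth_on_Pair smooth_on_compose[OF smooth_atlas_fin_dim[OF A] s(1)]
        smooth_on_compose[OF smooth_atlas_fin_dim[OF B] s(2)]
        smooth_on_bounded_linear bounded_linear_fst bounded_linear_snd) auto
  then have "smooth_on (map_prod \<phi>' \<psi>' \<circ> inv_into (U \<times> V) (map_prod \<phi> \<psi>)) ?S"
    by (rule smooth_on_cong[OF oS, rotated]) (auto simp: inv_into_map_prod[OF inj] inj)
  moreover have "map_prod \<phi> \<psi> ` ((U \<times> V) \<inter> (U' \<times> V')) = ?S" by auto
  ultimately show ?thesis by (simp add: d)
  qed
  then show ?case by (simp add: c)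
qed

section \<open>Tangent vectors\<close>

locale manifold =
  fixes A :: "('g::topological_space, 'e::real_inner) chart set"
  assumes atlas: "smooth_atlas A"
begin

lemmas fin = smooth_atlas_fin_dim[OF atlas]

lemmas std_real = smooth_atlas_std[OF fin_dim_euclidean[where 'a = real]]

text \<open>The last conclusion matters because tangent vectors vanish by convention at functions
  that are not smooth at the base point: on \<open>W'\<close> this default never occurs.\<close>

lemma smooth_at_compose_map:
  fixes B :: "('h::topological_space, 'f::real_inner) chart set"
  assumes B: "smooth_atlas B" and F: "smooth_map B A F W" "open W" "x \<in> W" and f: "smooth_at A f (F x)"
  shows "\<exists>W'. open W' \<and> x \<in> W' \<and> W' \<subseteq> W \<and> smooth_fun B (\<lambda>y. f (F y)) W' \<and>
    (\<forall>y\<in>W'. smooth_at A f (F y))"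
proof -
  obtain V where V: "open V" "F x \<in> V" "smooth_fun A f V" using f unfolding smooth_at_def by blast
  let ?W = "{y \<in> W. F y \<in> V}"
  have o: "open ?W" by (rule smooth_map_preimage_open[OF F(2) smooth_mapD(1)[OF F(1)] V(1)])
  have "smooth_map B std_atlas (\<lambda>y. f (F y)) ?W"
    by (rule smooth_map_compose[OF B atlas std_real smooth_map_subset[OF F(1)] V(3) o V(1)]) auto
  then show ?thesis using o F(3) V unfolding smooth_at_def by (intro exI[of _ ?W]) blast
qed

lemma smooth_fun_iff:
  assumes "open W"
  shows "smooth_fun A f W \<longleftrightarrow> (\<forall>p\<in>W. smooth_at A f p)"
proof
  assume f: "\<forall>p\<in>W. smooth_at A f p"
  show "smooth_fun A f W"
  proof (rule smooth_map_local[OF atlas std_real assms])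
    fix p assume "p \<in> W"
    then obtain V where "open V" "p \<in> V" "smooth_fun A f V" using f unfolding smooth_at_def by blast
    then show "\<exists>W'. open W' \<and> p \<in> W' \<and> smooth_fun A f (W' \<inter> W)"
      using smooth_map_subset[of A std_atlas f V "V \<inter> W"] by blast
  qed
qed (use assms in \<open>auto simp: smooth_at_def\<close>)

lemma smooth_at_chart_iff:
  assumes U: "(U, \<phi>) \<in> A" and p: "p \<in> U"
  shows "smooth_at A f p \<longleftrightarrow>
    (\<exists>W. open W \<and> \<phi> p \<in> W \<and> W \<subseteq> \<phi> ` U \<and> smooth_on (\<lambda>x. f (inv_into U \<phi> x)) W)"
proof
  note c = smooth_atlasD[OF atlas U]
  assume f: "smooth_at A f p"
  then have *: "smooth_at A f (inv_into U \<phi> (\<phi> p))" using smooth_atlas_inv[OF atlas U p] by simp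
  obtain W where "open W" "\<phi> p \<in> W" "W \<subseteq> \<phi> ` U" "smooth_fun std_atlas (\<lambda>x. f (inv_into U \<phi> x)) W"
    using smooth_at_compose_map[OF smooth_atlas_std[OF fin] smooth_map_inv_chart[OF atlas U] c(2) imageI[OF p] *]
    by blast
  then show "\<exists>W. open W \<and> \<phi> p \<in> W \<and> W \<subseteq> \<phi> ` U \<and> smooth_on (\<lambda>x. f (inv_into U \<phi> x)) W"
    unfolding smooth_map_std_std by blast
next
  note c = smooth_atlasD[OF atlas U]
  assume "\<exists>W. open W \<and> \<phi> p \<in> W \<and> W \<subseteq> \<phi> ` U \<and> smooth_on (\<lambda>x. f (inv_into U \<phi> x)) W"
  then obtain W where W: "open W" "\<phi> p \<in> W" "W \<subseteq> \<phi> ` U" "smooth_on (\<lambda>x. f (inv_into U \<phi> x)) W" by blast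
  let ?V = "{q \<in> U. \<phi> q \<in> W}"
  have o: "open ?V" by (rule smooth_map_preimage_open[OF c(1) c(3) W(1)])
  have "smooth_map A std_atlas (\<lambda>q. f (inv_into U \<phi> (\<phi> q))) ?V"
    by (rule smooth_map_compose[OF atlas smooth_atlas_std[OF fin] std_real
          smooth_map_subset[OF smooth_map_chart[OF atlas U]] _ o W(1)])
      (use W(4) in \<open>auto simp: smooth_map_std_std\<close>)
  then have "smooth_map A std_atlas f ?V"
    by (rule smooth_map_cong[OF atlas std_real o, rotated]) (simp add: smooth_atlas_inv[OF atlas U])
  then show "smooth_at A f p" unfolding smooth_at_def using o p W(2) by blast
qed

lemma smooth_at_binop:
  fixes K :: "real \<Rightarrow> real \<Rightarrow> real"
  assumes K: "\<And>W (f::'e \<Rightarrow> real) h. smooth_on f W \<Longrightarrow> smooth_on h W \<Longrightarrow> smooth_on (\<lambda>x. K (f x) (h x)) W"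
    and f: "smooth_at A f p" and h: "smooth_at A h p"
  shows "smooth_at A (\<lambda>q. K (f q) (h q)) p"
proof -
  obtain U \<phi> where U: "(U, \<phi>) \<in> A" "p \<in> U" using smooth_atlas_cover[OF atlas] by metis
  obtain W where W: "open W" "\<phi> p \<in> W" "W \<subseteq> \<phi> ` U" "smooth_on (\<lambda>x. f (inv_into U \<phi> x)) W"
    using f smooth_at_chart_iff[OF U] by blast
  obtain V where V: "open V" "\<phi> p \<in> V" "V \<subseteq> \<phi> ` U" "smooth_on (\<lambda>x. h (inv_into U \<phi> x)) V"
    using h smooth_at_chart_iff[OF U] by blast
  have "smooth_on (\<lambda>x. K (f (inv_into U \<phi> x)) (h (inv_into U \<phi> x))) (W \<inter> V)"
    by (intro K smooth_on_subset[OF W(4)] smooth_on_subset[OF V(4)]) auto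
  then show ?thesis unfolding smooth_at_chart_iff[OF U]
    using W V by (intro exI[of _ "W \<inter> V"]) auto
qed

lemma smooth_at_add: "smooth_at A f p \<Longrightarrow> smooth_at A h p \<Longrightarrow> smooth_at A (\<lambda>q. f q + h q) p"
  by (rule smooth_at_binop[OF smooth_on_add])

lemma smooth_at_mult: "smooth_at A f p \<Longrightarrow> smooth_at A h p \<Longrightarrow> smooth_at A (\<lambda>q. f q * h q) p"
  by (rule smooth_at_binop[OF smooth_on_mult])

lemma smooth_at_const [simp]: "smooth_at A (\<lambda>q. c) p"
  unfolding smooth_at_def using smooth_map_const by blast

lemma smooth_at_sum: "(\<And>i. i \<in> I \<Longrightarrow> smooth_at A (f i) p) \<Longrightarrow> smooth_at A (\<lambda>q. \<Sum>i\<in>I. f i q) p"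
  by (induction I rule: infinite_finite_induct) (auto intro: smooth_at_add)

lemma smooth_at_diff: "smooth_at A f p \<Longrightarrow> smooth_at A h p \<Longrightarrow> smooth_at A (\<lambda>q. f q - h q) p"
  using smooth_at_add[of f p "\<lambda>q. -1 * h q"] smooth_at_mult[of "\<lambda>q. -1" p h] by simp

lemma smooth_at_coordinate:
  assumes U: "(U, \<phi>) \<in> A" and p: "p \<in> U"
  shows "smooth_at A (\<lambda>q. \<phi> q \<bullet> b) p"
  unfolding smooth_at_chart_iff[OF assms]
proof (intro exI conjI)
  note c = smooth_atlasD[OF atlas U]
  show "open (\<phi> ` U)" "\<phi> p \<in> \<phi> ` U" using c p by auto
  show "smooth_on (\<lambda>x. \<phi> (inv_into U \<phi> x) \<bullet> b) (\<phi> ` U)"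
    by (rule smooth_on_cong[OF c(2) _ smooth_on_bounded_linear[OF bounded_linear_inner_left[of b]]])
      (simp add: f_inv_into_f)
qed simp

text \<open>The tangent vector with chart components \<open>a\<close>. The default 0 is the one in
  \<open>velocity\<close>, so that vectors from both sources can be equal as functions.\<close>

definition tvec :: "'g set \<Rightarrow> ('g \<Rightarrow> 'e) \<Rightarrow> 'g \<Rightarrow> 'e \<Rightarrow> 'g tangent" where
  "tvec U \<phi> p a = (\<lambda>f. if smooth_at A f p
     then frechet_derivative (\<lambda>x. f (inv_into U \<phi> x)) (at (\<phi> p)) a else 0)"

lemma chart_has_derivative:
  assumes U: "(U, \<phi>) \<in> A" "p \<in> U" and f: "smooth_at A f p"
  shows "((\<lambda>x. f (inv_into U \<phi> x)) has_derivative (\<lambda>a. tvec U \<phi> p a f)) (at (\<phi> p))"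
  using f smooth_on_has_derivative unfolding smooth_at_chart_iff[OF U] tvec_def by (simp, blast)

lemma tvec_linear:
  assumes U: "(U, \<phi>) \<in> A" "p \<in> U"
  shows "linear (\<lambda>a. tvec U \<phi> p a f)"
proof (cases "smooth_at A f p")
  case True
  from has_derivative_linear[OF chart_has_derivative[OF U True]] show ?thesis .
next
  case False
  then show ?thesis by (simp add: tvec_def linear_iff)
qed

text \<open>The chain rule in a chart. The second conclusion records actual differentiability, which
  the operator \<open>deriv\<close> in \<open>velocity\<close> does not carry.\<close>

lemma velocity_eq_tvec:
  assumes U: "(U, \<phi>) \<in> A" "c t \<in> U" and d: "((\<lambda>s. \<phi> (c s)) has_vector_derivative a) (at t)"
    and c: "\<forall>\<^sub>F s in at t. c s \<in> U"
  shows "velocity A c t = tvec U \<phi> (c t) a"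
    "\<And>f. smooth_at A f (c t) \<Longrightarrow> ((\<lambda>s. f (c s)) has_real_derivative velocity A c t f) (at t)"
proof -
  have *: "((\<lambda>s. f (c s)) has_real_derivative tvec U \<phi> (c t) a f) (at t)"
    if f: "smooth_at A f (c t)" for f
  proof -
    have "((\<lambda>s. f (inv_into U \<phi> (\<phi> (c s)))) has_derivative (\<lambda>s. tvec U \<phi> (c t) (s *\<^sub>R a) f)) (at t)"
      by (rule has_derivative_compose[OF d[unfolded has_vector_derivative_def] chart_has_derivative[OF U f]])
    also have "(\<lambda>s. tvec U \<phi> (c t) (s *\<^sub>R a) f) = (*) (tvec U \<phi> (c t) a f)"
      by (simp add: fun_eq_iff linear_scale[OF tvec_linear[OF U]] mult.commute)
    finally have d: "((\<lambda>s. f (inv_into U \<phi> (\<phi> (c s)))) has_real_derivative tvec U \<phi> (c t) a f) (at t)"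
      by (simp add: has_field_derivative_def)
    have ev: "\<forall>\<^sub>F s in nhds t. f (inv_into U \<phi> (\<phi> (c s))) = f (c s)"
      unfolding eventually_nhds_conv_at using c smooth_atlas_inv[OF atlas U(1)] U(2)
      by (auto elim!: eventually_mono)
    show ?thesis using d DERIV_cong_ev[OF refl ev refl] by simp
  qed
  have "velocity A c t f = tvec U \<phi> (c t) a f" for f
    using DERIV_imp_deriv[OF *] by (auto simp: velocity_def o_def tvec_def)
  then show v: "velocity A c t = tvec U \<phi> (c t) a" by blast
  fix f assume "smooth_at A f (c t)"
  then show "((\<lambda>s. f (c s)) has_real_derivative velocity A c t f) (at t)"
    unfolding v by (rule *)
qed

lemma smooth_curve_chart:
  assumes c: "smooth_curve A c I" "open I" "t \<in> I" and U: "(U, \<phi>) \<in> A" "c t \<in> U"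
  shows "\<forall>\<^sub>F s in at t. c s \<in> U"
    "\<exists>a. ((\<lambda>s. \<phi> (c s)) has_vector_derivative a) (at t)"
proof -
  let ?W = "{s \<in> I. c s \<in> U}"
  have o: "open ?W"
    by (rule smooth_map_preimage_open[OF c(2) smooth_mapD(1)[OF c(1)] smooth_atlasD(1)[OF atlas U(1)]])
  have tW: "t \<in> ?W" using c U by simp
  show "\<forall>\<^sub>F s in at t. c s \<in> U" using o tW by (auto simp: eventually_at_topological)
  have "smooth_map std_atlas std_atlas (\<lambda>s. \<phi> (c s)) ?W"
    by (rule smooth_map_compose[OF std_real atlas smooth_atlas_std[OF fin]
          smooth_map_subset[OF c(1)] smooth_map_chart[OF atlas U(1)] o smooth_atlasD(1)[OF atlas U(1)]]) auto
  then have *: "((\<lambda>s. \<phi> (c s)) has_derivative frechet_derivative (\<lambda>s. \<phi> (c s)) (at t)) (at t)"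
    unfolding smooth_map_std_std by (rule smooth_on_has_derivative) (rule tW)
  have "((\<lambda>s. \<phi> (c s)) has_vector_derivative frechet_derivative (\<lambda>s. \<phi> (c s)) (at t) 1) (at t)"
    unfolding has_vector_derivative_def
  proof (rule has_derivative_eq_rhs[OF *], rule ext)
    show "frechet_derivative (\<lambda>s. \<phi> (c s)) (at t) s = s *\<^sub>R frechet_derivative (\<lambda>s. \<phi> (c s)) (at t) 1" for s
      using linear_scale[OF has_derivative_linear[OF *], of s 1] by simp
  qed
  then show "\<exists>a. ((\<lambda>s. \<phi> (c s)) has_vector_derivative a) (at t)" by blast
qed

lemma velocity_has_real_derivative:
  assumes c: "smooth_curve A c I" "open I" "t \<in> I" and f: "smooth_at A f (c t)"
  shows "((\<lambda>s. f (c s)) has_real_derivative velocity A c t f) (at t)"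
proof -
  obtain U \<phi> where U: "(U, \<phi>) \<in> A" "c t \<in> U" using smooth_atlas_cover[OF atlas] by metis
  show ?thesis using velocity_eq_tvec(2)[where c = c and t = t, OF U _ _ f] smooth_curve_chart[OF c U] by blast
qed

text \<open>The curve is the inverse chart applied to the straight line through
  \<open>\<phi> p\<close> in direction \<open>a\<close>, on an interval short enough to stay in the
  chart image.\<close>

lemma tvec_velocity:
  assumes U: "(U, \<phi>) \<in> A" "p \<in> U"
  obtains c \<epsilon> where "c 0 = p" "\<epsilon> > 0" "smooth_curve A c {-\<epsilon><..<\<epsilon>}" "velocity A c 0 = tvec U \<phi> p a"
proof -
  note ch = smooth_atlasD[OF atlas U(1)]
  define l where "l = (\<lambda>s::real. \<phi> p + s *\<^sub>R a)"
  have cl: "continuous_on UNIV l" unfolding l_def by (intro continuous_intros)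
  have "open (l -` (\<phi> ` U))" using cl ch(2) open_vimage by blast
  moreover have "0 \<in> l -` (\<phi> ` U)" using U by (simp add: l_def)
  ultimately obtain \<epsilon> where e: "\<epsilon> > 0" "ball 0 \<epsilon> \<subseteq> l -` (\<phi> ` U)" using openE by blast
  have b: "ball 0 \<epsilon> = {-\<epsilon><..<\<epsilon>}" by (auto simp: dist_real_def)
  have "smooth_on l {-\<epsilon><..<\<epsilon>}" unfolding l_def
    by (intro smooth_on_add smooth_on_const smooth_on_bounded_linear bounded_linear_scaleR_left)
  then have "smooth_map std_atlas A (\<lambda>s. inv_into U \<phi> (l s)) {-\<epsilon><..<\<epsilon>}"
    by (intro smooth_map_compose[OF std_real smooth_atlas_std[OF fin] atlas _
          smooth_map_inv_chart[OF atlas U(1)] _ ch(2)])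
      (use e b in \<open>auto simp: smooth_map_std_std\<close>)
  note c = this
  have 0: "inv_into U \<phi> (l 0) = p" by (simp add: l_def smooth_atlas_inv[OF atlas U])
  have "\<forall>\<^sub>F s in at 0. s \<in> {-\<epsilon><..<\<epsilon>}"
    using e(1) by (intro eventually_at_in_open') auto
  then have ev: "\<forall>\<^sub>F s in at 0. l s \<in> \<phi> ` U" by eventually_elim (use e b in auto)
  have "(l has_vector_derivative a) (at 0)"
    unfolding l_def by (auto intro!: derivative_eq_intros)
  moreover have "\<forall>\<^sub>F s in at 0. l s = \<phi> (inv_into U \<phi> (l s))"
    using ev by eventually_elim (simp add: f_inv_into_f)
  ultimately have "((\<lambda>s. \<phi> (inv_into U \<phi> (l s))) has_vector_derivative a) (at 0)"
    unfolding has_vector_derivative_def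
    by (rule has_derivative_transform_eventually) (use U in \<open>auto simp: l_def f_inv_into_f\<close>)
  note vd = this
  have "\<forall>\<^sub>F s in at 0. inv_into U \<phi> (l s) \<in> U" using ev by eventually_elim (rule inv_into_into)
  with velocity_eq_tvec(1)[OF U(1) _ vd] have "velocity A (\<lambda>s. inv_into U \<phi> (l s)) 0 = tvec U \<phi> p a"
    using 0 U by simp
  then show ?thesis using that[of "\<lambda>s. inv_into U \<phi> (l s)" \<epsilon>] 0 e(1) c by blast
qed

text \<open>This is the source of the linear structure: as a set of velocities, the tangent space is
  not visibly closed under addition.\<close>

lemma tangent_space_eq_range:
  assumes U: "(U, \<phi>) \<in> A" "p \<in> U"
  shows "tangent_space A p = range (tvec U \<phi> p)"
proof
  show "tangent_space A p \<subseteq> range (tvec U \<phi> p)"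
  proof
    fix w assume "w \<in> tangent_space A p"
    then obtain c \<epsilon> where c: "w = velocity A c 0" "c 0 = p" "\<epsilon> > 0" "smooth_curve A c {-\<epsilon><..<\<epsilon>}"
      unfolding tangent_space_def by blast
    have U': "c 0 \<in> U" using c U by simp
    from smooth_curve_chart[OF c(4) _ _ U(1) U'] obtain a
      where "((\<lambda>s. \<phi> (c s)) has_vector_derivative a) (at 0)" "\<forall>\<^sub>F s in at 0. c s \<in> U" using c(3) by auto
    from velocity_eq_tvec(1)[OF U(1) U' this] show "w \<in> range (tvec U \<phi> p)" using c by simp
  qed
  show "range (tvec U \<phi> p) \<subseteq> tangent_space A p"
  proof
    fix w assume "w \<in> range (tvec U \<phi> p)"
    then obtain a where a: "w = tvec U \<phi> p a" by blast
    obtain c \<epsilon> where "c 0 = p" "\<epsilon> > 0" "smooth_curve A c {-\<epsilon><..<\<epsilon>}" "velocity A c 0 = w"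
      unfolding a by (rule tvec_velocity[OF U])
    then show "w \<in> tangent_space A p" unfolding tangent_space_def by blast
  qed
qed

lemma velocity_in_tangent_space:
  assumes c: "smooth_curve A c I" "open I" "t \<in> I"
  shows "velocity A c t \<in> tangent_space A (c t)"
proof -
  obtain U \<phi> where U: "(U, \<phi>) \<in> A" "c t \<in> U" using smooth_atlas_cover[OF atlas] by metis
  show ?thesis unfolding tangent_space_eq_range[OF U]
    using velocity_eq_tvec(1)[where c = c and t = t, OF U] smooth_curve_chart[OF c U] by blast
qed

text \<open>Coordinate functions recover the components of a tangent vector, hence the injectivity
  of \<open>tvec\<close> and the expansion of a tangent vector in a chart.\<close>

lemma tvec_coordinate:
  assumes U: "(U, \<phi>) \<in> A" "p \<in> U"
  shows "tvec U \<phi> p a (\<lambda>q. \<phi> q \<bullet> b) = a \<bullet> b"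
proof -
  have "((\<lambda>x. \<phi> (inv_into U \<phi> x) \<bullet> b) has_derivative (\<lambda>a. a \<bullet> b)) (at (\<phi> p))"
    by (rule has_derivative_transform_within_open[of "\<lambda>x. x \<bullet> b" _ _ _ "\<phi> ` U"])
      (use U smooth_atlasD(2)[OF atlas U(1)] in \<open>auto intro!: derivative_eq_intros simp: f_inv_into_f\<close>)
  from has_derivative_unique[OF this chart_has_derivative[OF U smooth_at_coordinate[OF U]]]
  show ?thesis by metis
qed

lemma tvec_inj:
  assumes U: "(U, \<phi>) \<in> A" "p \<in> U" and eq: "tvec U \<phi> p a = tvec U \<phi> p b"
  shows "a = b"
  using tvec_coordinate[OF U] eq by (metis vector_eq_rdot)

section \<open>Tangent vectors as point derivations\<close>

lemma tangent_obtain_curve: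
  assumes "w \<in> tangent_space A p"
  obtains c I where "c 0 = p" "smooth_curve A c I" "open I" "(0::real) \<in> I" "velocity A c 0 = w"
proof -
  obtain c \<epsilon> where c: "w = velocity A c 0" "c 0 = p" "\<epsilon> > 0" "smooth_curve A c {-\<epsilon><..<\<epsilon>}"
    using assms unfolding tangent_space_def by blast
  then show ?thesis by (intro that[of c "{-\<epsilon><..<\<epsilon>}"]) auto
qed

text \<open>One curve represents \<open>w\<close> on all functions smooth at \<open>p\<close>
  simultaneously, so additivity and the Leibniz rule for \<open>w\<close> reduce to uniqueness of
  one-variable derivatives.\<close>

lemma tangent_curve_derivative:
  assumes "w \<in> tangent_space A p"
  obtains c I where "c 0 = p" "smooth_curve A c I" "open I" "(0::real) \<in> I" "velocity A c 0 = w"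
    "\<And>f. smooth_at A f p \<Longrightarrow> ((\<lambda>s. f (c s)) has_real_derivative w f) (at 0)"
proof -
  obtain c I where c: "c 0 = p" "smooth_curve A c I" "open I" "(0::real) \<in> I" "velocity A c 0 = w"
    using tangent_obtain_curve[OF assms] by metis
  show ?thesis using that[OF c] velocity_has_real_derivative[OF c(2-4)] c by blast
qed

lemma tangent_not_smooth:
  assumes "w \<in> tangent_space A p" "\<not> smooth_at A f p" shows "w f = 0"
  using assms by (auto simp: tangent_space_def velocity_def)

lemma tangent_const:
  assumes w: "w \<in> tangent_space A p" shows "w (\<lambda>q. c) = 0"
proof -
  obtain k where k: "\<And>f. smooth_at A f p \<Longrightarrow> ((\<lambda>s. f (k s)) has_real_derivative w f) (at (0::real))"
    using tangent_curve_derivative[OF w] by metis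
  show ?thesis using DERIV_unique[OF k[OF smooth_at_const] DERIV_const] .
qed

lemma tangent_add:
  assumes w: "w \<in> tangent_space A p" and f: "smooth_at A f p" "smooth_at A h p"
  shows "w (\<lambda>q. f q + h q) = w f + w h"
proof -
  obtain c where "\<And>f. smooth_at A f p \<Longrightarrow> ((\<lambda>s. f (c s)) has_real_derivative w f) (at (0::real))"
    using tangent_curve_derivative[OF w] by metis
  note d = this[OF f(1)] this[OF f(2)] this[OF smooth_at_add[OF f]]
  show ?thesis using DERIV_unique[OF d(3) DERIV_add[OF d(1,2)]] .
qed

lemma tangent_mult:
  assumes w: "w \<in> tangent_space A p" and f: "smooth_at A f p" "smooth_at A h p"
  shows "w (\<lambda>q. f q * h q) = w f * h p + f p * w h"
proof -
  obtain c where c: "c 0 = p"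
    "\<And>f. smooth_at A f p \<Longrightarrow> ((\<lambda>s. f (c s)) has_real_derivative w f) (at (0::real))"
    using tangent_curve_derivative[OF w] by metis
  note d = c(2)[OF f(1)] c(2)[OF f(2)] c(2)[OF smooth_at_mult[OF f]]
  show ?thesis using DERIV_unique[OF d(3) DERIV_mult[OF d(1,2)]] c(1) by simp
qed

lemma tangent_scale:
  assumes w: "w \<in> tangent_space A p" and f: "smooth_at A f p"
  shows "w (\<lambda>q. k * f q) = k * w f"
  using tangent_mult[OF w smooth_at_const f] tangent_const[OF w] by simp

lemma tangent_sum:
  assumes w: "w \<in> tangent_space A p" and f: "\<And>i. i \<in> I \<Longrightarrow> smooth_at A (f i) p"
  shows "w (\<lambda>q. \<Sum>i\<in>I. f i q) = (\<Sum>i\<in>I. w (f i))"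
  using f by (induction I rule: infinite_finite_induct)
    (auto simp: tangent_const[OF w] tangent_add[OF w] smooth_at_sum)

lemma tangent_chart_expansion:
  assumes w: "w \<in> tangent_space A p" and U: "(U, \<phi>) \<in> A" "p \<in> U"
    and B: "\<And>x. (\<Sum>b\<in>B. (x \<bullet> b) *\<^sub>R b) = x"
  shows "w = tvec U \<phi> p (\<Sum>b\<in>B. w (\<lambda>q. \<phi> q \<bullet> b) *\<^sub>R b)"
proof -
  obtain a where a: "w = tvec U \<phi> p a" using w unfolding tangent_space_eq_range[OF U] by blast
  then show ?thesis by (simp add: tvec_coordinate[OF U] B)
qed

lemma tangent_space_zero: "(\<lambda>f. 0) \<in> tangent_space A p"
proof -
  obtain U \<phi> where U: "(U, \<phi>) \<in> A" "p \<in> U" using smooth_atlas_cover[OF atlas] by metis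
  have "(\<lambda>f. 0) = tvec U \<phi> p 0" using linear_0[OF tvec_linear[OF U]] by auto
  then show ?thesis unfolding tangent_space_eq_range[OF U] by blast
qed

lemma tangent_space_add:
  assumes "x \<in> tangent_space A p" "y \<in> tangent_space A p"
  shows "(\<lambda>f. x f + y f) \<in> tangent_space A p"
proof -
  obtain U \<phi> where U: "(U, \<phi>) \<in> A" "p \<in> U" using smooth_atlas_cover[OF atlas] by metis
  obtain a b where "x = tvec U \<phi> p a" "y = tvec U \<phi> p b"
    using assms unfolding tangent_space_eq_range[OF U] by blast
  then have "(\<lambda>f. x f + y f) = tvec U \<phi> p (a + b)" using linear_add[OF tvec_linear[OF U]] by auto
  then show ?thesis unfolding tangent_space_eq_range[OF U] by blast
qed

lemma tangent_space_scale:
  assumes "x \<in> tangent_space A p"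
  shows "(\<lambda>f. k * x f) \<in> tangent_space A p"
proof -
  obtain U \<phi> where U: "(U, \<phi>) \<in> A" "p \<in> U" using smooth_atlas_cover[OF atlas] by metis
  obtain a where "x = tvec U \<phi> p a"
    using assms unfolding tangent_space_eq_range[OF U] by blast
  then have "(\<lambda>f. k * x f) = tvec U \<phi> p (k *\<^sub>R a)" using linear_scale[OF tvec_linear[OF U]] by auto
  then show ?thesis unfolding tangent_space_eq_range[OF U] by blast
qed

section \<open>Pushforward of tangent vectors\<close>

lemma pushforward_velocity:
  assumes F: "smooth_map A A F UNIV" and c: "smooth_curve A c I" "open I" "t \<in> I"
  shows "pushforward A F (c t) (velocity A c t) = velocity A (\<lambda>s. F (c s)) t"
    "smooth_curve A (\<lambda>s. F (c s)) I"
proof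
  fix f
  have "smooth_at A (f \<circ> F) (c t)" if "smooth_at A f (F (c t))"
    using smooth_at_compose_map[OF atlas F _ _ that] unfolding smooth_at_def o_def by blast
  then show "pushforward A F (c t) (velocity A c t) f = velocity A (\<lambda>s. F (c s)) t f"
    by (auto simp: pushforward_def velocity_def o_def)
next
  show "smooth_curve A (\<lambda>s. F (c s)) I"
    by (rule smooth_map_compose[OF std_real atlas atlas c(1) F c(2)]) auto
qed

lemma smooth_at_compose:
  assumes F: "smooth_map A A F UNIV" and f: "smooth_at A f (F p)"
  shows "smooth_at A (\<lambda>q. f (F q)) p"
  using smooth_at_compose_map[OF atlas F _ _ f] unfolding smooth_at_def by blast

lemma pushforward_in_tangent_space:
  assumes F: "smooth_map A A F UNIV" and w: "w \<in> tangent_space A p"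
  shows "pushforward A F p w \<in> tangent_space A (F p)"
proof -
  obtain c I where c: "c 0 = p" "smooth_curve A c I" "open I" "(0::real) \<in> I" "velocity A c 0 = w"
    using tangent_obtain_curve[OF w] by metis
  show ?thesis using pushforward_velocity[OF F c(2-4)] c velocity_in_tangent_space[OF _ c(3,4)] by metis
qed

lemma pushforward_compose:
  assumes F: "smooth_map A A F UNIV" and H: "smooth_map A A H UNIV"
  shows "pushforward A H (F p) (pushforward A F p w) = pushforward A (\<lambda>q. H (F q)) p w"
proof
  fix f
  show "pushforward A H (F p) (pushforward A F p w) f = pushforward A (\<lambda>q. H (F q)) p w f"
    using smooth_at_compose[OF H, of f "F p"] by (auto simp: pushforward_def o_def)
qed

lemma pushforward_id:
  assumes "w \<in> tangent_space A p" shows "pushforward A (\<lambda>q. q) p w = w"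
  using tangent_not_smooth[OF assms] by (auto simp: pushforward_def o_def)

section \<open>Vector fields and fields along curves\<close>

lemma vector_field_iff:
  "vector_field A X \<longleftrightarrow> (\<forall>p. X p \<in> tangent_space A p) \<and>
     (\<forall>p f. smooth_at A f p \<longrightarrow> smooth_at A (\<lambda>q. X q f) p)"
proof
  assume X: "vector_field A X"
  show "(\<forall>p. X p \<in> tangent_space A p) \<and> (\<forall>p f. smooth_at A f p \<longrightarrow> smooth_at A (\<lambda>q. X q f) p)"
    using X unfolding vector_field_def smooth_at_def by blast
next
  assume "(\<forall>p. X p \<in> tangent_space A p) \<and> (\<forall>p f. smooth_at A f p \<longrightarrow> smooth_at A (\<lambda>q. X q f) p)"
  then show "vector_field A X" unfolding vector_field_def by (auto simp: smooth_fun_iff)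
qed

lemma vector_field_tangent: "vector_field A X \<Longrightarrow> X p \<in> tangent_space A p"
  by (simp add: vector_field_def)

lemma vector_field_smooth_at: "vector_field A X \<Longrightarrow> smooth_at A f p \<Longrightarrow> smooth_at A (\<lambda>q. X q f) p"
  by (simp add: vector_field_iff)

lemma vector_field_zero: "vector_field A (\<lambda>p f. 0)"
  by (simp add: vector_field_iff tangent_space_zero)

lemma vector_field_add:
  "vector_field A X \<Longrightarrow> vector_field A Y \<Longrightarrow> vector_field A (\<lambda>p f. X p f + Y p f)"
  by (simp add: vector_field_iff tangent_space_add smooth_at_add)

lemma vector_field_mult:
  "smooth_fun A h UNIV \<Longrightarrow> vector_field A X \<Longrightarrow> vector_field A (\<lambda>p f. h p * X p f)"
  by (simp add: vector_field_iff smooth_fun_iff tangent_space_scale smooth_at_mult)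

lemma vector_field_sum:
  "(\<And>i. i \<in> I \<Longrightarrow> vector_field A (X i)) \<Longrightarrow> vector_field A (\<lambda>p f. \<Sum>i\<in>I. X i p f)"
  by (induction I rule: infinite_finite_induct) (auto simp: vector_field_zero vector_field_add)

lemma smooth_fun_on_curve:
  assumes c: "smooth_curve A c J" "open J" and f: "open U" "smooth_fun A f U"
  shows "smooth_on (\<lambda>t. f (c t)) {t \<in> J. c t \<in> U}"
  unfolding smooth_map_std_std[symmetric]
  by (rule smooth_map_compose[OF std_real atlas std_real smooth_map_subset[OF c(1)] f(2)
        smooth_map_preimage_open[OF c(2) smooth_mapD(1)[OF c(1)] f(1)] f(1)]) auto

lemma field_alongD:
  assumes "field_along A c J V"
  shows "t \<in> J \<Longrightarrow> V t \<in> tangent_space A (c t)"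
    "open U \<Longrightarrow> smooth_fun A f U \<Longrightarrow> smooth_on (\<lambda>t. V t f) {t\<in>J. c t \<in> U}"
  using assms unfolding field_along_def by blast+

lemma field_along_zero: "field_along A c J (\<lambda>t f. 0)"
  by (simp add: field_along_def tangent_space_zero)

lemma field_along_add:
  "field_along A c J V \<Longrightarrow> field_along A c J W \<Longrightarrow> field_along A c J (\<lambda>t f. V t f + W t f)"
  by (simp add: field_along_def tangent_space_add smooth_on_add)

lemma field_along_mult:
  assumes "smooth_on h J" "field_along A c J V"
  shows "field_along A c J (\<lambda>t f. h t * V t f)"
  using assms unfolding field_along_def
  by (auto simp: tangent_space_scale intro!: smooth_on_mult smooth_on_subset[OF assms(1)])

lemma field_along_sum:
  "(\<And>i. i \<in> I \<Longrightarrow> field_along A c J (V i)) \<Longrightarrow> field_along A c J (\<lambda>t f. \<Sum>i\<in>I. V i t f)"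
  by (induction I rule: infinite_finite_induct) (auto simp: field_along_zero field_along_add)

lemma field_along_vector_field:
  assumes c: "smooth_curve A c J" "open J" and X: "vector_field A X"
  shows "field_along A c J (\<lambda>t. X (c t))"
  using X smooth_fun_on_curve[OF c] unfolding field_along_def vector_field_def by blast

lemma field_along_velocity:
  assumes c: "smooth_curve A c J" "open J"
  shows "field_along A c J (velocity A c)"
  unfolding field_along_def
proof (intro conjI ballI allI impI)
  show "velocity A c t \<in> tangent_space A (c t)" if "t \<in> J" for t
    by (rule velocity_in_tangent_space[OF c that])
  fix U f assume f: "open U \<and> smooth_fun A f U"
  let ?S = "{t \<in> J. c t \<in> U}"
  have o: "open ?S" using smooth_map_preimage_open[OF c(2) smooth_mapD(1)[OF c(1)]] f by blast
  have s: "smooth_on (\<lambda>t. f (c t)) ?S" using smooth_fun_on_curve[OF c] f by blast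
  show "smooth_on (\<lambda>t. velocity A c t f) ?S"
  proof (rule smooth_on_cong[OF o _ smooth_on_frechet_derivative[OF s o, of 1]])
    fix t assume t: "t \<in> ?S"
    have "smooth_at A f (c t)" using f t by (auto simp: smooth_at_def)
    then have "((\<lambda>s. f (c s)) has_derivative (\<lambda>x. velocity A c t f * x)) (at t)"
      using velocity_has_real_derivative[OF c] t by (simp add: has_field_derivative_def)
    from frechet_derivative_at[OF this]
    show "frechet_derivative (\<lambda>t. f (c t)) (at t) 1 = velocity A c t f" by (metis mult.right_neutral)
  qed
qed

end

section \<open>Left-invariant frames on a Lie group\<close>

text \<open>One fixed chart around the identity identifies the Lie algebra with the model space, so
  that metric, bracket and connection become maps on \<open>'e\<close>.\<close>

locale lie = manifold A
  for A :: "('g::{t2_space, second_countable_topology}, 'e::real_inner) chart set" +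
  fixes mul :: "'g \<Rightarrow> 'g \<Rightarrow> 'g" and e :: 'g and iv :: "'g \<Rightarrow> 'g"
    and U0 :: "'g set" and \<phi>0 :: "'g \<Rightarrow> 'e"
  assumes lie_group: "lie_group A mul e iv"
    and chart0: "(U0, \<phi>0) \<in> A" "e \<in> U0"
begin

sublocale group mul e iv
  using lie_group by (simp add: lie_group_def)

lemma mul_simps [simp]:
  "mul e a = a" "mul a e = a" "mul (iv a) a = e" "mul a (iv a) = e"
  "mul (iv a) (mul a b) = b" "mul a (mul (iv a) b) = b" "iv (iv a) = a"
  by (simp_all flip: assoc)

lemma smooth_map_mul:
  fixes B :: "('h::topological_space, 'f::real_inner) chart set"
  assumes B: "smooth_atlas B" and W: "open W" and F: "smooth_map B A F W" "smooth_map B A H W"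
  shows "smooth_map B A (\<lambda>x. mul (F x) (H x)) W"
proof -
  have "smooth_map (prod_atlas A A) A (\<lambda>(a, b). mul a b) UNIV"
    using lie_group by (simp add: lie_group_def)
  from smooth_map_compose[OF B smooth_atlas_prod[OF atlas atlas] atlas
      smooth_map_Pair[OF B atlas atlas F W] this W]
  show ?thesis by simp
qed

lemma smooth_map_iv:
  fixes B :: "('h::topological_space, 'f::real_inner) chart set"
  assumes B: "smooth_atlas B" and W: "open W" and F: "smooth_map B A F W"
  shows "smooth_map B A (\<lambda>x. iv (F x)) W"
proof -
  have "smooth_map A A iv UNIV" using lie_group by (simp add: lie_group_def)
  from smooth_map_compose[OF B atlas atlas F this W] show ?thesis by simp
qed

lemma smooth_map_left: "smooth_map A A (mul a) W"
  and smooth_map_right: "smooth_map A A (\<lambda>q. mul q a) W"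
  and smooth_map_conj: "smooth_map A A (\<lambda>q. mul (mul a q) b) W"
  by (rule smooth_map_subset[where W = UNIV],
      intro smooth_map_mul[OF atlas] smooth_map_id[OF atlas] smooth_map_const, simp_all)+

abbreviation T :: "'e \<Rightarrow> 'g tangent" where "T \<equiv> tvec U0 \<phi>0 e"

definition E :: "'e \<Rightarrow> 'g vfield" where "E a = left_field A mul e (T a)"

text \<open>The left trivialisation of the tangent bundle (the Maurer-Cartan form) in coordinates:
  on tangent vectors at \<open>p\<close> it inverts \<open>E\<close> at \<open>p\<close>.\<close>

definition coef :: "'g \<Rightarrow> 'g tangent \<Rightarrow> 'e" where
  "coef p w = inv T (pushforward A (mul (iv p)) p w)"

lemma T_tangent [simp]: "T a \<in> tangent_space A e"
  using tangent_space_eq_range[OF chart0] by blast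

lemma T_surj: "w \<in> tangent_space A e \<Longrightarrow> \<exists>a. w = T a"
  using tangent_space_eq_range[OF chart0] by blast

lemma inj_T: "inj T"
  using tvec_inj[OF chart0] by (auto simp: inj_def)

lemma T_eq_iff [simp]: "T a = T b \<longleftrightarrow> a = b"
  using inj_T by (auto simp: inj_def)

lemma T_inv: "w \<in> tangent_space A e \<Longrightarrow> T (inv T w) = w"
  by (metis T_surj f_inv_into_f rangeI)

lemma T_linear: "linear (\<lambda>a. T a f)"
  by (rule tvec_linear[OF chart0])

lemma E_tangent [simp]: "E a p \<in> tangent_space A p"
  using pushforward_in_tangent_space[OF smooth_map_left T_tangent] unfolding E_def left_field_def
  by (metis mul_simps(2))

lemma E_linear: "linear (\<lambda>a. E a p f)"
  using linear_add[OF T_linear] linear_scale[OF T_linear]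
  by (intro linearI) (auto simp: E_def left_field_def pushforward_def)

lemma E_identity: "E a e = T a"
proof -
  have "mul e = (\<lambda>q. q)" by (simp add: fun_eq_iff)
  then show ?thesis unfolding E_def left_field_def using pushforward_id[OF T_tangent] by simp
qed

lemma E_left: "E a (mul p q) = pushforward A (mul p) q (E a q)"
proof -
  have "mul (mul p q) = (\<lambda>x. mul p (mul q x))" by (simp add: fun_eq_iff assoc)
  then show ?thesis unfolding E_def left_field_def
    using pushforward_compose[OF smooth_map_left[of q] smooth_map_left[of p], of e "T a"] by simp
qed

text \<open>Translation by \<open>iv p\<close> inverts translation by \<open>p\<close>. The
  equivalence removes the case distinction in \<open>pushforward\<close>, so that
  \<open>E_apply_left\<close> and \<open>E_apply\<close> hold for every \<open>f\<close>.\<close>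

lemma smooth_at_left_iff: "smooth_at A (\<lambda>r. f (mul p r)) q \<longleftrightarrow> smooth_at A f (mul p q)"
proof
  assume "smooth_at A (\<lambda>r. f (mul p r)) q"
  then have "smooth_at A (\<lambda>r. f (mul p r)) (mul (iv p) (mul p q))" by simp
  from smooth_at_compose[OF smooth_map_left this] show "smooth_at A f (mul p q)" by simp
qed (rule smooth_at_compose[OF smooth_map_left])

lemma E_apply_left: "E a (mul p q) f = E a q (\<lambda>r. f (mul p r))"
  using tangent_not_smooth[OF E_tangent, of "\<lambda>r. f (mul p r)" q]
  by (auto simp: E_left pushforward_def o_def smooth_at_left_iff)

lemma E_apply: "E a p f = T a (\<lambda>r. f (mul p r))"
  using E_apply_left[of a p e f] by (simp add: E_identity)

lemma E_coef: 
  assumes "w \<in> tangent_space A p" shows "E (coef p w) p = w"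
proof -
  have "pushforward A (mul (iv p)) p w \<in> tangent_space A e"
    using pushforward_in_tangent_space[OF smooth_map_left assms, of "iv p"] by simp
  then have "E (coef p w) p = pushforward A (mul p) e (pushforward A (mul (iv p)) p w)"
    unfolding E_def left_field_def coef_def by (simp add: T_inv)
  also have "\<dots> = pushforward A (\<lambda>q. q) p w"
    using pushforward_compose[OF smooth_map_left[of "iv p"] smooth_map_left[of p], of p w] by simp
  finally show ?thesis using pushforward_id[OF assms] by simp
qed

lemma T_coef:
  assumes "w \<in> tangent_space A p" shows "T (coef p w) = pushforward A (mul (iv p)) p w"
  using pushforward_in_tangent_space[OF smooth_map_left assms, of "iv p"] T_inv
  by (simp add: coef_def)

lemma coef_E [simp]: "coef p (E a p) = a"
proof -
  have "pushforward A (mul (iv p)) p (E a p) = E a e" using E_left[of a "iv p" p] by simp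
  then show ?thesis by (simp add: coef_def E_identity inj_T)
qed

lemma E_eq_iff [simp]: "E a p = E b p \<longleftrightarrow> a = b"
  by (metis coef_E)

text \<open>The derivative in the curve parameter at 0 is the derivative of the joint function in
  the fixed direction \<open>(0, 1)\<close>, hence smooth in the remaining variable.\<close>

lemma smooth_map_param:
  fixes F :: "'x::real_inner \<times> real \<Rightarrow> 'g"
  assumes fx: "fin_dim TYPE('x)" and W: "open W" and F: "smooth_map std_atlas A F (W \<times> I)"
    and I: "open I" "0 \<in> I" and x: "x \<in> W" and f: "smooth_at A f (F (x, 0))"
  obtains V where "open V" "x \<in> V" "V \<subseteq> W" "\<And>y. y \<in> V \<Longrightarrow> smooth_at A f (F (y, 0))"
    "smooth_on (\<lambda>y. deriv (\<lambda>s. f (F (y, s))) 0) V"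
proof -
  have fin2: "fin_dim TYPE('x \<times> real)" by (rule fin_dim_prod[OF fx fin_dim_euclidean])
  have "open (W \<times> I)" "(x, 0) \<in> W \<times> I" using W I x by (auto intro: open_Times)
  from smooth_at_compose_map[OF smooth_atlas_std[OF fin2] F this f]
  obtain W' where W': "open W'" "(x, 0) \<in> W'" "W' \<subseteq> W \<times> I" "smooth_on (\<lambda>y. f (F y)) W'"
     "\<And>y. y \<in> W' \<Longrightarrow> smooth_at A f (F y)" unfolding smooth_map_std_std by blast
  let ?V = "(\<lambda>y. (y, 0::real)) -` W'"
  have o: "open ?V" by (intro open_vimage[OF W'(1)] continuous_intros)
  have "smooth_on (\<lambda>y. frechet_derivative (\<lambda>y. f (F y)) (at (y, 0)) (0, 1)) ?V"
    by (rule smooth_on_frechet_derivative_field[OF fin2 W'(4,1) _ _ _ o])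
      (auto intro: smooth_on_Pair smooth_on_const smooth_on_ident)
  then have "smooth_on (\<lambda>y. deriv (\<lambda>s. f (F (y, s))) 0) ?V"
  proof (rule smooth_on_cong[OF o, rotated])
    fix y assume "y \<in> ?V"
    then have d: "((\<lambda>y. f (F y)) has_derivative frechet_derivative (\<lambda>y. f (F y)) (at (y, 0))) (at (y, 0))"
      using smooth_on_has_derivative[OF W'(4)] by simp
    have "((\<lambda>s. f (F (y, s))) has_derivative (\<lambda>s. frechet_derivative (\<lambda>y. f (F y)) (at (y, 0)) (0, s))) (at 0)"
      by (rule has_derivative_compose[where f = "\<lambda>s. (y, s)", OF _ d]) (auto intro!: derivative_eq_intros)
    moreover have "(\<lambda>s. frechet_derivative (\<lambda>y. f (F y)) (at (y, 0)) (0, s)) =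
        (*) (frechet_derivative (\<lambda>y. f (F y)) (at (y, 0)) (0, 1))"
    proof
      fix s show "frechet_derivative (\<lambda>y. f (F y)) (at (y, 0)) (0, s) =
          frechet_derivative (\<lambda>y. f (F y)) (at (y, 0)) (0, 1) * s"
        using linear_scale[OF has_derivative_linear[OF d], of s "(0, 1)"] by (simp add: mult.commute)
    qed
    ultimately have "((\<lambda>s. f (F (y, s))) has_real_derivative
        frechet_derivative (\<lambda>y. f (F y)) (at (y, 0)) (0, 1)) (at 0)"
      by (simp only: has_field_derivative_def)
    then show "frechet_derivative (\<lambda>y. f (F y)) (at (y, 0)) (0, 1) = deriv (\<lambda>s. f (F (y, s))) 0"
      by (simp add: DERIV_imp_deriv)
  qed
  then show ?thesis using that[of ?V] o W' by auto
qed

lemma smooth_map_snd_curve: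
  fixes k :: "real \<Rightarrow> 'g"
  assumes "fin_dim TYPE('x::real_inner)" "smooth_curve A k I" "open I" "open W"
  shows "smooth_map std_atlas A (\<lambda>x. k (snd x)) ((W :: 'x set) \<times> I)"
  by (rule smooth_map_compose[OF smooth_atlas_std[OF fin_dim_prod[OF assms(1) fin_dim_euclidean]]
        std_real atlas _ assms(2) _ assms(3)])
    (auto simp: smooth_map_std_std assms intro: smooth_on_bounded_linear bounded_linear_snd open_Times)

lemma smooth_map_fst_map:
  fixes F :: "'x::real_inner \<Rightarrow> 'g"
  assumes "fin_dim TYPE('x::real_inner)" "smooth_map std_atlas A F W" "open (I::real set)" "open W"
  shows "smooth_map std_atlas A (\<lambda>x. F (fst x)) (W \<times> I)"
  by (rule smooth_map_compose[OF smooth_atlas_std[OF fin_dim_prod[OF assms(1) fin_dim_euclidean]]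
        smooth_atlas_std[OF assms(1)] atlas _ assms(2) _ assms(4)])
    (auto simp: smooth_map_std_std assms intro: smooth_on_bounded_linear bounded_linear_fst open_Times)

text \<open>With a curve \<open>k\<close> of velocity \<open>T a\<close> at the identity,
  \<open>E a q f\<close> is the derivative at \<open>s = 0\<close> of
  \<open>f (mul q (k s))\<close>, so smoothness in \<open>q\<close> is smooth dependence on a
  parameter.\<close>

lemma E_smooth_at:
  assumes f: "smooth_at A f p"
  shows "smooth_at A (\<lambda>q. E a q f) p"
proof -
  obtain U \<phi> where U: "(U, \<phi>) \<in> A" "p \<in> U" using smooth_atlas_cover[OF atlas] by metis
  note c = smooth_atlasD[OF atlas U(1)]
  obtain k I where k: "k 0 = e" "smooth_curve A k I" "open I" "(0::real) \<in> I" "velocity A k 0 = T a"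
    using tangent_obtain_curve[OF T_tangent] by metis
  let ?F = "\<lambda>x. mul (inv_into U \<phi> (fst x)) (k (snd x))"
  have "smooth_map std_atlas A ?F (\<phi> ` U \<times> I)"
    by (intro smooth_map_mul smooth_atlas_std fin_dim_prod fin fin_dim_euclidean open_Times c k
        smooth_map_snd_curve smooth_map_fst_map smooth_map_inv_chart[OF atlas U(1)])
  moreover have "smooth_at A f (?F (\<phi> p, 0))" using f k by (simp add: smooth_atlas_inv[OF atlas U])
  ultimately obtain V where V: "open V" "\<phi> p \<in> V" "V \<subseteq> \<phi> ` U"
    "\<And>y. y \<in> V \<Longrightarrow> smooth_at A f (?F (y, 0))"
    "smooth_on (\<lambda>y. deriv (\<lambda>s. f (?F (y, s))) 0) V"
    using smooth_map_param[OF fin c(2) _ k(3,4) imageI[OF U(2)], of ?F f] by blast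
  have "smooth_on (\<lambda>y. E a (inv_into U \<phi> y) f) V"
  proof (rule smooth_on_cong[OF V(1) _ V(5)])
    fix y assume "y \<in> V"
    then have "smooth_at A (\<lambda>r. f (mul (inv_into U \<phi> y) r)) e" using V(4) k by (simp add: smooth_at_left_iff)
    then show "deriv (\<lambda>s. f (?F (y, s))) 0 = E a (inv_into U \<phi> y) f"
      by (simp add: E_apply k(5)[symmetric] velocity_def k(1) o_def)
  qed
  then show ?thesis unfolding smooth_at_chart_iff[OF U] using V by blast
qed

lemma E_vector_field [simp]: "vector_field A (E a)"
  by (simp add: vector_field_iff E_smooth_at)

text \<open>At \<open>p\<close> and at the identity the bracket is built from the same vectors
  \<open>T a\<close> and \<open>T b\<close>; only the test function is translated by
  \<open>p\<close>.\<close>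

lemma vf_bracket_E_left:
  "vf_bracket A (E a) (E b) p = pushforward A (mul p) e (vf_bracket A (E a) (E b) e)"
proof
  fix f
  show "vf_bracket A (E a) (E b) p f = pushforward A (mul p) e (vf_bracket A (E a) (E b) e) f"
    using smooth_at_left_iff[of f p e]
    by (simp add: vf_bracket_def pushforward_def E_apply[of _ p] E_identity E_apply_left o_def)
qed

lemma lie_bracket_eq: "lie_bracket A mul e (T a) (T b) = vf_bracket A (E a) (E b) e"
  by (simp add: lie_bracket_def E_def)

text \<open>Each component is \<open>Y t\<close> applied to a test function that itself depends on
  \<open>t\<close>, whereas \<open>field_along\<close> controls fixed test functions only. Therefore
  \<open>Y t\<close> is expanded in a chart, and the component becomes a derivative of a jointly
  smooth function of \<open>t\<close> and the chart variable.\<close>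

lemma smooth_on_coef:
  assumes c: "smooth_curve A \<gamma> J" "open J" and Y: "field_along A \<gamma> J Y"
  shows "smooth_on (\<lambda>t. coef (\<gamma> t) (Y t)) J"
proof -
  obtain B :: "'e set" where B: "finite B" "\<And>x. (\<Sum>b\<in>B. (x \<bullet> b) *\<^sub>R b) = x"
    using fin_dim_frame[OF fin] by metis
  have cc: "coef (\<gamma> t) (Y t) \<bullet> b = Y t (\<lambda>q. \<phi>0 (mul (iv (\<gamma> t)) q) \<bullet> b)" if "t \<in> J" for t b
  proof -
    have "T (coef (\<gamma> t) (Y t)) (\<lambda>q. \<phi>0 q \<bullet> b) = Y t (\<lambda>q. \<phi>0 (mul (iv (\<gamma> t)) q) \<bullet> b)"
      using smooth_at_coordinate[OF chart0]
      by (simp add: T_coef[OF field_alongD(1)[OF Y that]] pushforward_def o_def)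
    then show ?thesis by (simp add: tvec_coordinate[OF chart0])
  qed
  have "smooth_on (\<lambda>t. coef (\<gamma> t) (Y t) \<bullet> b) J" for b
  proof (rule smooth_on_local[OF c(2)])
    fix t0 assume t0: "t0 \<in> J"
    let ?f = "\<lambda>q. \<phi>0 q \<bullet> b"
    obtain V \<psi> where V: "(V, \<psi>) \<in> A" "\<gamma> t0 \<in> V" using smooth_atlas_cover[OF atlas] by metis
    note ch = smooth_atlasD[OF atlas V(1)]
    note fin2 = fin_dim_prod[OF fin_dim_euclidean[where 'a = real] fin]
    let ?F = "\<lambda>x. mul (iv (\<gamma> (fst x))) (inv_into V \<psi> (snd x))"
    have o: "open (J \<times> \<psi> ` V)" by (intro open_Times c ch)
    have "smooth_map std_atlas A ?F (J \<times> \<psi> ` V)"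
    proof (intro smooth_map_mul smooth_map_iv smooth_atlas_std fin2 o)
      show "smooth_map std_atlas A (\<lambda>x. \<gamma> (fst x)) (J \<times> \<psi> ` V)"
        by (rule smooth_map_compose[OF smooth_atlas_std[OF fin2] std_real atlas _ c(1) o c(2)])
          (auto simp: smooth_map_std_std intro: smooth_on_bounded_linear bounded_linear_fst)
      show "smooth_map std_atlas A (\<lambda>x. inv_into V \<psi> (snd x)) (J \<times> \<psi> ` V)"
        by (rule smooth_map_compose[OF smooth_atlas_std[OF fin2] smooth_atlas_std[OF fin] atlas _
              smooth_map_inv_chart[OF atlas V(1)] o ch(2)])
          (auto simp: smooth_map_std_std intro: smooth_on_bounded_linear bounded_linear_snd)
    qed
    moreover have "smooth_at A ?f (?F (t0, \<psi> (\<gamma> t0)))"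
      using smooth_at_coordinate[OF chart0] by (simp add: smooth_atlas_inv[OF atlas V])
    moreover have "(t0, \<psi> (\<gamma> t0)) \<in> J \<times> \<psi> ` V" using t0 V by simp
    ultimately obtain W where W: "open W" "(t0, \<psi> (\<gamma> t0)) \<in> W" "W \<subseteq> J \<times> \<psi> ` V"
      "smooth_on (\<lambda>x. ?f (?F x)) W" "\<And>x. x \<in> W \<Longrightarrow> smooth_at A ?f (?F x)"
      using smooth_at_compose_map[OF smooth_atlas_std[OF fin2] _ o, of ?F "(t0, \<psi> (\<gamma> t0))" ?f]
      unfolding smooth_map_std_std by blast
    let ?J1 = "{t \<in> J. \<gamma> t \<in> V}"
    have J1: "open ?J1" by (rule smooth_map_preimage_open[OF c(2) smooth_mapD(1)[OF c(1)] ch(1)])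
    have s1: "smooth_on (\<lambda>t. (t, \<psi> (\<gamma> t))) ?J1"
    proof (intro smooth_on_Pair smooth_on_ident)
      show "smooth_on (\<lambda>t. \<psi> (\<gamma> t)) ?J1" unfolding smooth_map_std_std[symmetric]
        by (rule smooth_map_compose[OF std_real atlas smooth_atlas_std[OF fin]
              smooth_map_subset[OF c(1)] smooth_map_chart[OF atlas V(1)] J1 ch(1)]) auto
    qed
    let ?J2 = "{t \<in> ?J1. (t, \<psi> (\<gamma> t)) \<in> W}"
    have J2: "open ?J2" by (rule smooth_map_preimage_open[OF J1 smooth_on_imp_continuous_on[OF s1] W(1)])
    \<comment> \<open>The chart components of \<open>Y t\<close>; they are smooth because the
      coordinate functions of \<open>V\<close> are fixed test functions.\<close>
    let ?w = "\<lambda>t. \<Sum>b'\<in>B. Y t (\<lambda>q. \<psi> q \<bullet> b') *\<^sub>R b'"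
    have "smooth_fun A (\<lambda>q. \<psi> q \<bullet> b') V" for b'
      using smooth_at_coordinate[OF V(1)] by (simp add: smooth_fun_iff[OF ch(1)])
    then have sw: "smooth_on ?w ?J1"
      by (intro smooth_on_sum smooth_on_scaleR smooth_on_const field_alongD(2)[OF Y] ch(1))
    \<comment> \<open>The direction has first entry 0: the \<open>t\<close> inside
      \<open>iv (\<gamma> t)\<close> is frozen, and only the point of evaluation moves along
      \<open>Y t\<close>.\<close>
    have "smooth_on (\<lambda>t. frechet_derivative (\<lambda>x. ?f (?F x)) (at (t, \<psi> (\<gamma> t))) (0, ?w t)) ?J2"
      by (rule smooth_on_frechet_derivative_field[OF fin2 W(4,1) _ _ _ J2])
        (auto intro!: smooth_on_Pair smooth_on_const smooth_on_subset[OF s1] smooth_on_subset[OF sw])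
    then have "smooth_on (\<lambda>t. coef (\<gamma> t) (Y t) \<bullet> b) ?J2"
    proof (rule smooth_on_cong[OF J2, rotated])
      fix t assume t: "t \<in> ?J2"
      then have tV: "\<gamma> t \<in> V" and tJ: "t \<in> J" and tW: "(t, \<psi> (\<gamma> t)) \<in> W" by auto
      have sm: "smooth_at A (\<lambda>q. ?f (mul (iv (\<gamma> t)) q)) (\<gamma> t)"
        using smooth_at_left_iff[of ?f "iv (\<gamma> t)" "\<gamma> t"] smooth_at_coordinate[OF chart0] by simp
      have d: "((\<lambda>x. ?f (?F x)) has_derivative frechet_derivative (\<lambda>x. ?f (?F x)) (at (t, \<psi> (\<gamma> t)))) (at (t, \<psi> (\<gamma> t)))"
        by (rule smooth_on_has_derivative[OF W(4) tW])
      have "((\<lambda>x. ?f (?F (t, x))) has_derivative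
          (\<lambda>a. frechet_derivative (\<lambda>x. ?f (?F x)) (at (t, \<psi> (\<gamma> t))) (0, a))) (at (\<psi> (\<gamma> t)))"
        by (rule has_derivative_compose[where f = "\<lambda>x. (t, x)", OF _ d]) (auto intro!: derivative_eq_intros)
      then have "((\<lambda>x. ?f (mul (iv (\<gamma> t)) (inv_into V \<psi> x))) has_derivative
          (\<lambda>a. frechet_derivative (\<lambda>x. ?f (?F x)) (at (t, \<psi> (\<gamma> t))) (0, a))) (at (\<psi> (\<gamma> t)))" by simp
      from has_derivative_unique[OF this chart_has_derivative[OF V(1) tV sm]]
      have "frechet_derivative (\<lambda>x. ?f (?F x)) (at (t, \<psi> (\<gamma> t))) (0, ?w t) =
          tvec V \<psi> (\<gamma> t) (?w t) (\<lambda>q. ?f (mul (iv (\<gamma> t)) q))" by metis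
      also have "tvec V \<psi> (\<gamma> t) (?w t) = Y t"
        using tangent_chart_expansion[OF field_alongD(1)[OF Y tJ] V(1) tV B(2)] by simp
      finally show "frechet_derivative (\<lambda>x. ?f (?F x)) (at (t, \<psi> (\<gamma> t))) (0, ?w t) = coef (\<gamma> t) (Y t) \<bullet> b"
        using cc[OF tJ] by simp
    qed
    then show "\<exists>U. open U \<and> t0 \<in> U \<and> smooth_on (\<lambda>t. coef (\<gamma> t) (Y t) \<bullet> b) (U \<inter> J)"
      using J2 t0 V W(2) by (intro exI[of _ ?J2]) (auto elim!: smooth_on_subset)
  qed
  then have "smooth_on (\<lambda>t. \<Sum>b\<in>B. (coef (\<gamma> t) (Y t) \<bullet> b) *\<^sub>R b) J"
    by (intro smooth_on_sum smooth_on_scaleR smooth_on_const)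
  then show ?thesis by (simp add: B)
qed

end

section \<open>The Levi-Civita connection in the left-invariant frame\<close>

locale lie_riemannian = lie A mul e iv U0 \<phi>0
  for A :: "('g::{t2_space, second_countable_topology}, 'e::real_inner) chart set"
    and mul e iv U0 \<phi>0 +
  fixes g :: "'g \<Rightarrow> 'g tangent \<Rightarrow> 'g tangent \<Rightarrow> real"
    and nabla :: "'g vfield \<Rightarrow> 'g vfield \<Rightarrow> 'g vfield"
  assumes metric: "left_invariant_metric A mul g"
    and lc: "levi_civita A g nabla"
begin

definition G :: "'e \<Rightarrow> 'e \<Rightarrow> real" where "G a b = g e (T a) (T b)"
text \<open>Evaluated at the identity only; \<open>nabla_E\<close> and \<open>vf_bracket_E\<close>
  show that \<open>N\<close> and \<open>br\<close> give the coefficients at every point.\<close>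

definition N :: "'e \<Rightarrow> 'e \<Rightarrow> 'e" where "N a b = coef e (nabla (E a) (E b) e)"
definition br :: "'e \<Rightarrow> 'e \<Rightarrow> 'e" where "br a b = coef e (vf_bracket A (E a) (E b) e)"

lemma metric_props:
  assumes "x \<in> tangent_space A p" "y \<in> tangent_space A p"
  shows "g p x y = g p y x"
    "z \<in> tangent_space A p \<Longrightarrow> g p (\<lambda>f. x f + y f) z = g p x z + g p y z"
    "g p (\<lambda>f. k * x f) y = k * g p x y"
    "x \<noteq> (\<lambda>f. 0) \<Longrightarrow> g p x x > 0"
  using metric assms unfolding left_invariant_metric_def riemannian_metric_def by blast+

lemma metric_smooth_at:
  assumes "vector_field A X" "vector_field A Y"
  shows "smooth_at A (\<lambda>p. g p (X p) (Y p)) q"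
proof -
  have "smooth_fun A (\<lambda>p. g p (X p) (Y p)) UNIV"
    using metric assms unfolding left_invariant_metric_def riemannian_metric_def by blast
  then show ?thesis by (simp add: smooth_fun_iff)
qed

lemma metric_E: "g p (E a p) (E b p) = G a b"
proof -
  have "g (mul p e) (pushforward A (mul p) e (T a)) (pushforward A (mul p) e (T b)) = g e (T a) (T b)"
    using metric T_tangent unfolding left_invariant_metric_def by blast
  then show ?thesis by (simp add: G_def E_def left_field_def)
qed

lemma E_add: "E (a + b) p = (\<lambda>f. E a p f + E b p f)"
  using linear_add[OF E_linear] by blast

lemma E_scale: "E (k *\<^sub>R a) p = (\<lambda>f. k * E a p f)"
  using linear_scale[OF E_linear] by auto

lemma E_zero: "E 0 p = (\<lambda>f. 0)"
  using linear_0[OF E_linear] by blast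

lemma E_sum: "E (\<Sum>i\<in>I. h i) p = (\<lambda>f. \<Sum>i\<in>I. E (h i) p f)"
  using linear_sum[OF E_linear] by blast

lemma E_diff: "E (a - b) p = (\<lambda>f. E a p f - E b p f)"
  using linear_diff[OF E_linear] by blast

lemma E_diff2: "E (a - b - c) p = (\<lambda>f. E a p f - E b p f - E c p f)"
  by (simp add: E_diff)

lemma G_commute: "G a b = G b a"
  unfolding G_def by (rule metric_props(1)) auto

lemma G_add: "G (a + b) c = G a c + G b c"
  using metric_props(2)[of "E a e" e "E b e" "E c e"] by (simp add: E_add[symmetric] metric_E)

lemma G_scale: "G (k *\<^sub>R a) c = k * G a c"
  using metric_props(3)[of "E a e" e "E c e" k] by (simp add: E_scale[symmetric] metric_E)

lemma G_pos: "a \<noteq> 0 \<Longrightarrow> G a a > 0"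
  using metric_props(4)[of "E a e" e "E a e"] E_zero[of e] E_eq_iff[of a e 0] by (simp add: metric_E)

lemma bounded_bilinear_G: "bounded_bilinear G"
  by (intro bilinear_imp_bounded_bilinear_fin_dim fin linearI)
    (simp_all add: G_add G_scale G_commute[of _ "_ + _"] G_commute[of _ "_ *\<^sub>R _"],
     simp_all add: G_commute)

interpretation G: bounded_bilinear G by (rule bounded_bilinear_G)

lemma G_eqI:
  assumes "\<And>c. G a c = G b c" shows "a = b"
proof (rule ccontr)
  assume "a \<noteq> b"
  then have "G (a - b) (a - b) > 0" using G_pos by simp
  then show False using assms by (simp add: G.diff_left)
qed

lemma nabla_vector_field: "vector_field A X \<Longrightarrow> vector_field A Y \<Longrightarrow> vector_field A (nabla X Y)"
  using lc by (simp add: levi_civita_def affine_connection_def)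

lemma nabla_add_left:
  "vector_field A X \<Longrightarrow> vector_field A X' \<Longrightarrow> vector_field A Y \<Longrightarrow>
    nabla (\<lambda>p f. X p f + X' p f) Y = (\<lambda>p f. nabla X Y p f + nabla X' Y p f)"
  using lc by (simp add: levi_civita_def affine_connection_def)

lemma nabla_add_right:
  "vector_field A X \<Longrightarrow> vector_field A Y \<Longrightarrow> vector_field A Y' \<Longrightarrow>
    nabla X (\<lambda>p f. Y p f + Y' p f) = (\<lambda>p f. nabla X Y p f + nabla X Y' p f)"
  using lc by (simp add: levi_civita_def affine_connection_def)

lemma nabla_mult_left:
  "smooth_fun A h UNIV \<Longrightarrow> vector_field A X \<Longrightarrow> vector_field A Y \<Longrightarrow>
    nabla (\<lambda>p f. h p * X p f) Y = (\<lambda>p f. h p * nabla X Y p f)"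
  using lc by (simp add: levi_civita_def affine_connection_def)

lemma nabla_mult_right:
  "smooth_fun A h UNIV \<Longrightarrow> vector_field A X \<Longrightarrow> vector_field A Y \<Longrightarrow>
    nabla X (\<lambda>p f. h p * Y p f) = (\<lambda>p f. X p h * Y p f + h p * nabla X Y p f)"
  using lc by (simp add: levi_civita_def affine_connection_def)

lemma torsion_free:
  "vector_field A X \<Longrightarrow> vector_field A Y \<Longrightarrow>
    vf_bracket A X Y = (\<lambda>p f. nabla X Y p f - nabla Y X p f)"
  using lc by (simp add: levi_civita_def)

lemma nabla_metric:
  "vector_field A X \<Longrightarrow> vector_field A Y \<Longrightarrow> vector_field A Z \<Longrightarrow>
    X p (\<lambda>q. g q (Y q) (Z q)) = g p (nabla X Y p) (Z p) + g p (Y p) (nabla X Z p)"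
  using lc unfolding levi_civita_def by blast

lemma const_smooth_fun: "smooth_fun A (\<lambda>q. c) UNIV"
  by (simp add: smooth_fun_iff)

lemma vector_field_diff:
  assumes "vector_field A X" "vector_field A Y"
  shows "vector_field A (\<lambda>p f. X p f - Y p f)"
  using vector_field_add[OF assms(1) vector_field_mult[OF const_smooth_fun assms(2), of "-1"]] by simp

text \<open>Vanishing torsion writes the bracket as a difference of covariant derivatives, which are
  vector fields by the connection axioms.\<close>

lemma vf_bracket_vector_field:
  "vector_field A X \<Longrightarrow> vector_field A Y \<Longrightarrow> vector_field A (vf_bracket A X Y)"
  by (simp add: torsion_free vector_field_diff nabla_vector_field)

lemma vf_bracket_E: "vf_bracket A (E a) (E b) = E (br a b)"
proof
  fix p
  have "T (br a b) = vf_bracket A (E a) (E b) e"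
    unfolding br_def E_identity[symmetric]
    by (rule E_coef) (simp add: vector_field_tangent vf_bracket_vector_field)
  then show "vf_bracket A (E a) (E b) p = E (br a b) p"
    unfolding E_def[of "br a b"] left_field_def by (simp add: vf_bracket_E_left[of a b p])
qed

text \<open>The Koszul formula shows that the coefficients of \<open>nabla (E a) (E b)\<close> do not depend on the
  base point.\<close>

lemma nabla_E: "nabla (E a) (E b) = E (N a b)"
proof
  fix p
  define k where "k = (\<lambda>p a b. coef p (nabla (E a) (E b) p))"
  have k: "nabla (E a) (E b) p = E (k p a b) p" for p a b
    unfolding k_def by (rule E_coef[symmetric]) (simp add: vector_field_tangent nabla_vector_field)
  \<comment> \<open>Inner products of left-invariant fields are constant, so the left side of the
    metric axiom vanishes.\<close>
  have skew: "G (k p a b) c + G (k p a c) b = 0" for p a b c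
  proof -
    have "E a p (\<lambda>q. g q (E b q) (E c q)) = 0"
      unfolding metric_E by (rule tangent_const[OF E_tangent])
    then show ?thesis using nabla_metric[of "E a" "E b" "E c" p]
      by (simp add: k metric_E G_commute[of b])
  qed
  have tor: "G (k p a b) c - G (k p b a) c = G (br a b) c" for p a b c
  proof -
    have "E (br a b) p = E (k p a b - k p b a) p"
      unfolding vf_bracket_E[symmetric] E_diff by (simp add: torsion_free k)
    then show ?thesis by (simp add: G.diff_left)
  qed
  \<comment> \<open>Three skew relations and three torsion relations are solved for the unknown; the
    right side no longer contains \<open>p\<close>.\<close>
  have "2 * G (k p a b) c = G (br a b) c - G (br b c) a + G (br c a) b" for p a b c
    using skew[of p a b c] skew[of p b a c] skew[of p c a b]
      tor[of p a b c] tor[of p b c a] tor[of p c a b] by linarith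
  then have "2 * G (k p a b) c = 2 * G (k e a b) c" for c by metis
  then have "k p a b = k e a b" by (intro G_eqI) simp
  moreover have "N a b = k e a b" by (simp add: N_def k_def)
  ultimately show "nabla (E a) (E b) p = E (N a b) p" using k[of a b p] by simp
qed

lemma br_eq: "br a b = N a b - N b a"
proof -
  have "E (br a b) e = E (N a b - N b a) e"
    unfolding vf_bracket_E[symmetric] E_diff by (simp add: torsion_free nabla_E)
  then show ?thesis by simp
qed

text \<open>Metric compatibility for left-invariant fields, whose inner products are
  constant.\<close>

lemma N_skew: "G (N a b) c + G b (N a c) = 0"
  using nabla_metric[of "E a" "E b" "E c" e] tangent_const[OF E_tangent]
  by (simp add: nabla_E metric_E)

lemma bounded_bilinear_N: "bounded_bilinear N"
proof (intro bilinear_imp_bounded_bilinear_fin_dim fin linearI)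
  fix a a' b b' :: 'e and k :: real
  have ea: "E (x + y) = (\<lambda>p f. E x p f + E y p f)" for x y by (simp add: fun_eq_iff E_add)
  have es: "E (k *\<^sub>R x) = (\<lambda>p f. k * E x p f)" for x by (simp add: fun_eq_iff E_scale)
  have "E (N (a + a') b) e = E (N a b + N a' b) e"
    unfolding nabla_E[symmetric] E_add by (simp add: ea nabla_add_left nabla_E)
  then show "N (a + a') b = N a b + N a' b" by simp
  have "E (N a (b + b')) e = E (N a b + N a b') e"
    unfolding nabla_E[symmetric] E_add by (simp add: ea nabla_add_right nabla_E)
  then show "N a (b + b') = N a b + N a b'" by simp
  have "E (N (k *\<^sub>R a) b) e = E (k *\<^sub>R N a b) e"
    unfolding nabla_E[symmetric] E_scale by (simp add: es nabla_mult_left const_smooth_fun nabla_E)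
  then show "N (k *\<^sub>R a) b = k *\<^sub>R N a b" by simp
  have "E (N a (k *\<^sub>R b)) e = E (k *\<^sub>R N a b) e"
    unfolding nabla_E[symmetric] E_scale
    by (simp add: es nabla_mult_right const_smooth_fun nabla_E tangent_const[OF E_tangent])
  then show "N a (k *\<^sub>R b) = k *\<^sub>R N a b" by simp
qed

interpretation N: bounded_bilinear N by (rule bounded_bilinear_N)

section \<open>Connection and curvature of arbitrary vector fields in a metric-orthonormal
  frame\<close>

lemma G_frame:
  obtains C where "finite C" "\<And>a b. a \<in> C \<Longrightarrow> b \<in> C \<Longrightarrow> G a b = (if a = b then 1 else 0)"
    "\<And>x. (\<Sum>c\<in>C. G x c *\<^sub>R c) = x"
proof -
  obtain B :: "'e set" where "finite B" "span B = UNIV" using fin by (auto simp: fin_dim_def)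
  from orthonormal_expansion_exists[OF this, of G] obtain C
    where "finite C" "\<forall>a\<in>C. \<forall>b\<in>C. G a b = (if a = b then 1 else 0)"
      "\<forall>x. (\<Sum>c\<in>C. G x c *\<^sub>R c) = x"
    using G_add G_scale G_commute G_pos by blast
  then show ?thesis using that by blast
qed

text \<open>The component equals the inner product of \<open>X\<close> with the left-invariant field
  \<open>E c\<close>, which is smooth by the definition of a Riemannian metric.\<close>

lemma component_smooth_at:
  assumes "vector_field A X"
  shows "smooth_at A (\<lambda>q. G (coef q (X q)) c) p"
proof -
  have "G (coef q (X q)) c = g q (X q) (E c q)" for q
    using E_coef[OF vector_field_tangent[OF assms]] metric_E by metis
  then show ?thesis using metric_smooth_at[OF assms E_vector_field] by simp
qed

lemma nabla_zero_right:
  assumes "vector_field A X" shows "nabla X (\<lambda>p f. 0) = (\<lambda>p f. 0)"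
  using nabla_mult_right[OF const_smooth_fun assms vector_field_zero, of 0] by simp

lemma nabla_zero_left:
  assumes "vector_field A X" shows "nabla (\<lambda>p f. 0) X = (\<lambda>p f. 0)"
  using nabla_mult_left[OF const_smooth_fun vector_field_zero assms, of 0] by simp

lemma nabla_sum_left:
  assumes "\<And>i. i \<in> I \<Longrightarrow> smooth_fun A (h i) UNIV" "\<And>i. i \<in> I \<Longrightarrow> vector_field A (X i)" "vector_field A Y"
  shows "nabla (\<lambda>p f. \<Sum>i\<in>I. h i p * X i p f) Y = (\<lambda>p f. \<Sum>i\<in>I. h i p * nabla (X i) Y p f)"
  using assms
  by (induction I rule: infinite_finite_induct)
    (auto simp: nabla_zero_left nabla_add_left nabla_mult_left vector_field_mult vector_field_sum)

lemma nabla_sum_right: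
  assumes "\<And>i. i \<in> I \<Longrightarrow> smooth_fun A (h i) UNIV" "\<And>i. i \<in> I \<Longrightarrow> vector_field A (Y i)" "vector_field A X"
  shows "nabla X (\<lambda>p f. \<Sum>i\<in>I. h i p * Y i p f) =
    (\<lambda>p f. \<Sum>i\<in>I. X p (h i) * Y i p f + h i p * nabla X (Y i) p f)"
  using assms
  by (induction I rule: infinite_finite_induct)
    (auto simp: nabla_zero_right nabla_add_right nabla_mult_right vector_field_mult vector_field_sum)

context
  fixes C :: "'e set"
  assumes C: "finite C" "\<And>a b. a \<in> C \<Longrightarrow> b \<in> C \<Longrightarrow> G a b = (if a = b then 1 else 0)"
    "\<And>x. (\<Sum>c\<in>C. G x c *\<^sub>R c) = x"
begin

text \<open>The derivative along \<open>X\<close> of a function with values in the model space,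
  taken componentwise: the flat connection of the left trivialisation.\<close>

definition dfield :: "'g vfield \<Rightarrow> ('g \<Rightarrow> 'e) \<Rightarrow> 'g \<Rightarrow> 'e" where
  "dfield X \<eta> p = (\<Sum>c\<in>C. X p (\<lambda>q. G (\<eta> q) c) *\<^sub>R c)"

lemma G_sum_C:
  assumes "c \<in> C" shows "G (\<Sum>b\<in>C. h b *\<^sub>R b) c = h c"
proof -
  have "G (\<Sum>b\<in>C. h b *\<^sub>R b) c = (\<Sum>b\<in>C. if b = c then h b else 0)"
    unfolding G.sum_left by (rule sum.cong) (auto simp: G.scaleR_left C(2) assms)
  then show ?thesis using C(1) assms by simp
qed

lemma field_expansion:
  assumes "vector_field A X"
  shows "X = (\<lambda>p f. \<Sum>c\<in>C. G (coef p (X p)) c * E c p f)"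
proof (intro ext)
  fix p f
  have "X p f = E (coef p (X p)) p f" using E_coef[OF vector_field_tangent[OF assms]] by simp
  also have "\<dots> = E (\<Sum>c\<in>C. G (coef p (X p)) c *\<^sub>R c) p f" by (simp add: C)
  also have "\<dots> = (\<Sum>c\<in>C. G (coef p (X p)) c * E c p f)" by (simp add: E_sum E_scale)
  finally show "X p f = (\<Sum>c\<in>C. G (coef p (X p)) c * E c p f)" .
qed

text \<open>Both fields are expanded in the global frame. Linearity over functions in
  \<open>X\<close> and the Leibniz rule in \<open>Y\<close> split the connection into the flat
  derivative plus \<open>N\<close>.\<close>

lemma nabla_eq:
  assumes X: "vector_field A X" and Y: "vector_field A Y"
  shows "nabla X Y p = E (dfield X (\<lambda>q. coef q (Y q)) p + N (coef p (X p)) (coef p (Y p))) p"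
proof
  fix f
  let ?\<xi> = "\<lambda>p. coef p (X p)" and ?\<eta> = "\<lambda>p. coef p (Y p)"
  have sm: "smooth_fun A (\<lambda>p. G (coef p (Z p)) c) UNIV" if "vector_field A Z" for Z c
    using component_smooth_at[OF that] by (simp add: smooth_fun_iff)
  have XE: "nabla X (E b) p f = E (N (?\<xi> p) b) p f" for b
  proof -
    have "nabla X (E b) p f = (\<Sum>c\<in>C. G (?\<xi> p) c * E (N c b) p f)"
      by (subst field_expansion[OF X]) (simp add: nabla_sum_left sm[OF X] nabla_E)
    also have "\<dots> = E (N (\<Sum>c\<in>C. G (?\<xi> p) c *\<^sub>R c) b) p f"
      by (simp add: N.sum_left N.scaleR_left E_sum E_scale)
    finally show ?thesis by (simp add: C)
  qed
  have "nabla X Y p f = (\<Sum>c\<in>C. X p (\<lambda>p. G (?\<eta> p) c) * E c p f + G (?\<eta> p) c * nabla X (E c) p f)"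
    by (subst field_expansion[OF Y]) (simp add: nabla_sum_right sm[OF Y] X)
  also have "\<dots> = E (dfield X ?\<eta> p) p f + E (N (?\<xi> p) (\<Sum>c\<in>C. G (?\<eta> p) c *\<^sub>R c)) p f"
    by (simp add: XE dfield_def N.sum_right N.scaleR_right E_sum E_scale sum.distrib)
  finally show "nabla X Y p f = E (dfield X ?\<eta> p + N (?\<xi> p) (?\<eta> p)) p f" by (simp add: C E_add)
qed

text \<open>A product rule: \<open>N\<close> is bilinear with coefficients
  \<open>G (N a b) c\<close> that do not depend on the point, so only its two arguments are
  differentiated.\<close>

lemma dfield_N:
  assumes X: "vector_field A X" and Y: "vector_field A Y" and Z: "vector_field A Z"
  shows "dfield X (\<lambda>q. N (coef q (Y q)) (coef q (Z q))) p =
    N (dfield X (\<lambda>q. coef q (Y q)) p) (coef p (Z p)) + N (coef p (Y p)) (dfield X (\<lambda>q. coef q (Z q)) p)"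
proof -
  let ?\<eta> = "\<lambda>p. coef p (Y p)" and ?\<zeta> = "\<lambda>p. coef p (Z p)"
  have Xp: "X p \<in> tangent_space A p" by (rule vector_field_tangent[OF X])
  have ex: "G (N y z) c = (\<Sum>a\<in>C. \<Sum>b\<in>C. G (N a b) c * (G y a * G z b))" for y z c
  proof -
    have "G (N y z) c = G (N (\<Sum>a\<in>C. G y a *\<^sub>R a) (\<Sum>b\<in>C. G z b *\<^sub>R b)) c" by (simp add: C)
    then show ?thesis
      by (simp only: N.sum_left N.sum_right N.scaleR_left N.scaleR_right G.sum_left G.scaleR_left
          real_scaleR_def) (simp add: sum_distrib_left mult_ac, subst sum.swap, rule refl)
  qed
  have d: "X p (\<lambda>q. G (N (?\<eta> q) (?\<zeta> q)) c) =
      G (N (dfield X ?\<eta> p) (?\<zeta> p)) c + G (N (?\<eta> p) (dfield X ?\<zeta> p)) c" for c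
  proof -
    have s: "smooth_at A (\<lambda>q. G (?\<eta> q) a) p" "smooth_at A (\<lambda>q. G (?\<zeta> q) a) p" for a
      using component_smooth_at Y Z by blast+
    have "X p (\<lambda>q. G (N (?\<eta> q) (?\<zeta> q)) c) = (\<Sum>a\<in>C. \<Sum>b\<in>C. G (N a b) c *
        (X p (\<lambda>q. G (?\<eta> q) a) * G (?\<zeta> p) b + G (?\<eta> p) a * X p (\<lambda>q. G (?\<zeta> q) b)))"
      unfolding ex[of "?\<eta> _"]
      by (simp add: tangent_sum[OF Xp] tangent_scale[OF Xp] tangent_mult[OF Xp] s smooth_at_sum smooth_at_mult)
    also have "\<dots> = G (N (dfield X ?\<eta> p) (?\<zeta> p)) c + G (N (?\<eta> p) (dfield X ?\<zeta> p)) c"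
      unfolding ex[of "dfield X ?\<eta> p"] ex[of _ "dfield X ?\<zeta> p"]
      by (simp add: G_sum_C dfield_def flip: sum.distrib, simp add: algebra_simps)
    finally show ?thesis .
  qed
  have "dfield X (\<lambda>q. N (?\<eta> q) (?\<zeta> q)) p =
      (\<Sum>c\<in>C. G (N (dfield X ?\<eta> p) (?\<zeta> p) + N (?\<eta> p) (dfield X ?\<zeta> p)) c *\<^sub>R c)"
    unfolding dfield_def[of _ "\<lambda>q. N (?\<eta> q) (?\<zeta> q)"] d by (simp add: G_add)
  then show ?thesis by (simp add: C)
qed

lemma dfield_add:
  assumes X: "vector_field A X"
    and "\<And>c. smooth_at A (\<lambda>q. G (\<eta> q) c) p" "\<And>c. smooth_at A (\<lambda>q. G (\<zeta> q) c) p"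
  shows "dfield X (\<lambda>q. \<eta> q + \<zeta> q) p = dfield X \<eta> p + dfield X \<zeta> p"
  by (simp add: dfield_def G_add tangent_add[OF vector_field_tangent[OF X] assms(2,3)]
      scaleR_add_left sum.distrib)

text \<open>All derivatives of the components of \<open>X\<close>, \<open>Y\<close> and
  \<open>Z\<close> cancel, so the value depends on the three vectors at \<open>p\<close> alone. This
  tensoriality is what evaluating \<open>curvature_at\<close> on chosen extensions rests on.\<close>

lemma curvature_eq:
  assumes X: "vector_field A X" and Y: "vector_field A Y" and Z: "vector_field A Z"
    and x: "x = coef p (X p)" "y = coef p (Y p)" "z = coef p (Z p)"
  shows "curvature A nabla X Y Z p = E (N x (N y z) - N y (N x z) - N (br x y) z) p"
proof -
  let ?\<zeta> = "\<lambda>q. coef q (Z q)"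
  have sm: "smooth_at A (\<lambda>q. G (dfield W ?\<zeta> q) c) p" "smooth_at A (\<lambda>q. G (N (coef q (W q)) (?\<zeta> q)) c) p"
    if W: "vector_field A W" for W c
  proof -
    have s: "smooth_at A (\<lambda>q. G (coef q (V q)) a) p" if "vector_field A V" for V a
      using component_smooth_at that by blast
    have "G (dfield W ?\<zeta> q) c = (\<Sum>b\<in>C. W q (\<lambda>q. G (?\<zeta> q) b) * G b c)" for q
      by (simp add: dfield_def G.sum_left G.scaleR_left)
    then show d: "smooth_at A (\<lambda>q. G (dfield W ?\<zeta> q) c) p"
      by (simp add: smooth_at_sum smooth_at_mult vector_field_smooth_at[OF W] s[OF Z])
    \<comment> \<open>The \<open>N\<close> term is isolated as the difference between the components
      of \<open>nabla W Z\<close> and the flat derivative, both already known to be smooth.\<close>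
    have "G (N (coef q (W q)) (?\<zeta> q)) c = G (coef q (nabla W Z q)) c - G (dfield W ?\<zeta> q) c" for q
      by (simp add: nabla_eq[OF W Z] G.add_left)
    then show "smooth_at A (\<lambda>q. G (N (coef q (W q)) (?\<zeta> q)) c) p"
      by (simp add: smooth_at_diff s[OF nabla_vector_field[OF W Z]] d)
  qed
  have second: "nabla V (nabla W Z) p = E (dfield V (dfield W ?\<zeta>) p +
      N (dfield V (\<lambda>q. coef q (W q)) p) (?\<zeta> p) + N (coef p (W p)) (dfield V ?\<zeta> p) +
      N (coef p (V p)) (dfield W ?\<zeta> p) + N (coef p (V p)) (N (coef p (W p)) (?\<zeta> p))) p"
    if V: "vector_field A V" and W: "vector_field A W" for V W
    using nabla_eq[OF V nabla_vector_field[OF W Z], of p] sm[OF W]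
    by (simp add: nabla_eq[OF W Z] dfield_add[OF V] dfield_N[OF V W Z] N.add_right add_ac)
  have B: "vector_field A (vf_bracket A X Y)" by (rule vf_bracket_vector_field[OF X Y])
  have cb: "coef p (vf_bracket A X Y p) =
      dfield X (\<lambda>q. coef q (Y q)) p + N x y - (dfield Y (\<lambda>q. coef q (X q)) p + N y x)"
    using x by (simp add: torsion_free[OF X Y] nabla_eq X Y E_diff[symmetric])
  \<comment> \<open>On each component function the bracket acts as the commutator of the two
    derivations; this accounts for the second derivatives left over in the curvature.\<close>
  have db: "dfield (vf_bracket A X Y) ?\<zeta> p = dfield X (dfield Y ?\<zeta>) p - dfield Y (dfield X ?\<zeta>) p"
  proof -
    have "vf_bracket A X Y p (\<lambda>q. G (?\<zeta> q) c) =
        X p (\<lambda>q. G (dfield Y ?\<zeta> q) c) - Y p (\<lambda>q. G (dfield X ?\<zeta> q) c)" if "c \<in> C" for c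
    proof -
      have "G (dfield W ?\<zeta> q) c = W q (\<lambda>q. G (?\<zeta> q) c)" for W q
        unfolding dfield_def using G_sum_C[OF that] by simp
      then show ?thesis by (simp add: vf_bracket_def component_smooth_at[OF Z])
    qed
    then show ?thesis
      by (simp add: dfield_def[of "vf_bracket A X Y"] dfield_def[of _ "dfield _ _"]
          scaleR_diff_left sum_subtractf)
  qed
  have "curvature A nabla X Y Z p = (\<lambda>f. nabla X (nabla Y Z) p f - nabla Y (nabla X Z) p f
      - nabla (vf_bracket A X Y) Z p f)" by (simp add: curvature_def)
  also have "\<dots> = E (N x (N y z) - N y (N x z) - N (br x y) z) p"
    unfolding second[OF X Y] second[OF Y X] nabla_eq[OF B Z] cb db E_diff2[symmetric] x[symmetric]
    by (simp add: N.add_left N.diff_left br_eq algebra_simps)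
  finally show ?thesis .
qed

end

text \<open>The extensions behind the choice operator are unknown beyond their values at
  \<open>p\<close>, but \<open>curvature_eq\<close> uses nothing else.\<close>

lemma curvature_at_eq:
  assumes "x \<in> tangent_space A p" "y \<in> tangent_space A p" "z \<in> tangent_space A p"
  shows "curvature_at A nabla p x y z = E (N (coef p x) (N (coef p y) (coef p z))
    - N (coef p y) (N (coef p x) (coef p z)) - N (br (coef p x) (coef p y)) (coef p z)) p"
proof -
  define ext where "ext = (\<lambda>w. SOME X. vector_field A X \<and> X p = w)"
  have ext: "vector_field A (ext w) \<and> ext w p = w" if "w \<in> tangent_space A p" for w
    \<comment> \<open>The left-invariant field through \<open>w\<close> shows that a global
      extension exists, so the choice is well behaved.\<close>
    unfolding ext_def by (rule someI[of _ "E (coef p w)"]) (simp add: E_coef[OF that])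
  have ca: "curvature_at A nabla p x y z = curvature A nabla (ext x) (ext y) (ext z) p"
    by (simp only: curvature_at_def ext_def Let_def)
  obtain C where C: "finite C" "\<And>a b. a \<in> C \<Longrightarrow> b \<in> C \<Longrightarrow> G a b = (if a = b then 1 else 0)"
    "\<And>x. (\<Sum>c\<in>C. G x c *\<^sub>R c) = x" using G_frame by metis
  show ?thesis unfolding ca by (rule curvature_eq[OF C]) (use ext assms in auto)
qed

text \<open>The field is expanded in the restrictions of the \<open>E c\<close> to the curve: the
  product rule for \<open>D\<close> differentiates the coefficients, and the last axiom with
  \<open>nabla_E\<close> supplies \<open>N\<close>.\<close>

lemma covariant_derivative_along_eq:
  assumes D: "covariant_derivative_along A nabla \<gamma> J D"
    and \<gamma>: "smooth_curve A \<gamma> J" "open J" and V: "field_along A \<gamma> J V" and t: "t \<in> J"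
    and d: "((\<lambda>s. coef (\<gamma> s) (V s)) has_vector_derivative a) (at t)"
  shows "D V t = E (a + N (coef (\<gamma> t) (velocity A \<gamma> t)) (coef (\<gamma> t) (V t))) (\<gamma> t)"
proof -
  have Dadd: "D (\<lambda>s f. V s f + W s f) t = (\<lambda>f. D V t f + D W t f)"
    if "field_along A \<gamma> J V" "field_along A \<gamma> J W" for V W
    using D that t unfolding covariant_derivative_along_def by blast
  have Dmult: "D (\<lambda>s f. h s * V s f) t = (\<lambda>f. deriv h t * V t f + h t * D V t f)"
    if "smooth_on h J" "field_along A \<gamma> J V" for h V
    using D that t unfolding covariant_derivative_along_def by blast
  have Dzero: "D (\<lambda>s f. 0) t = (\<lambda>f. 0)"
    using Dmult[OF smooth_on_const field_along_zero, of 0] by simp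
  have Dsum: "D (\<lambda>s f. \<Sum>i\<in>I. h i s * W i s f) t =
      (\<lambda>f. \<Sum>i\<in>I. deriv (h i) t * W i t f + h i t * D (W i) t f)"
    if "\<And>i. i \<in> I \<Longrightarrow> smooth_on (h i) J" "\<And>i. i \<in> I \<Longrightarrow> field_along A \<gamma> J (W i)" for h W and I :: "'e set"
    using that by (induction I rule: infinite_finite_induct)
      (simp_all add: Dzero Dadd Dmult field_along_mult field_along_sum)
  let ?\<eta> = "\<lambda>s. coef (\<gamma> s) (V s)"
  let ?\<chi> = "\<lambda>s. if s \<in> J then 1 else 0 :: real"
  have vt: "velocity A \<gamma> t \<in> tangent_space A (\<gamma> t)" by (rule velocity_in_tangent_space[OF \<gamma> t])
  obtain C where C: "finite C" "\<And>x. (\<Sum>c\<in>C. G x c *\<^sub>R c) = x" using G_frame by metis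
  define W where "W = (\<lambda>s f. \<Sum>c\<in>C. G (?\<eta> s) c * E c (\<gamma> s) f)"
  have s\<eta>: "smooth_on (\<lambda>s. G (?\<eta> s) c) J" for c
    by (intro smooth_on_linear_compose[OF G.bounded_linear_left] smooth_on_coef[OF \<gamma> V])
  have fE: "field_along A \<gamma> J (\<lambda>s. E c (\<gamma> s))" for c by (rule field_along_vector_field[OF \<gamma> E_vector_field])
  have W: "field_along A \<gamma> J W" unfolding W_def
    by (intro field_along_sum field_along_mult s\<eta> fE)
  have VW: "V s = W s" if "s \<in> J" for s
  proof -
    have "V s = E (\<Sum>c\<in>C. G (?\<eta> s) c *\<^sub>R c) (\<gamma> s)"
      using E_coef[OF field_alongD(1)[OF V that]] by (simp add: C)
    then show ?thesis by (simp add: W_def E_sum E_scale)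
  qed
  have s\<chi>: "smooth_on ?\<chi> J"
    by (rule smooth_on_cong[OF \<gamma>(2) _ smooth_on_const[of 1]]) simp
  have d\<chi>: "deriv ?\<chi> t = 0"
  proof -
    have "(?\<chi> has_real_derivative 0) (at t)"
      by (rule has_field_derivative_transform_within_open[OF DERIV_const \<gamma>(2) t, of 1]) simp
    then show ?thesis by (rule DERIV_imp_deriv)
  qed
  \<comment> \<open>\<open>D\<close> is local: cutting off outside \<open>J\<close> does not change it on \<open>J\<close>.\<close>
  have "D V t = D (\<lambda>s f. ?\<chi> s * V s f) t" using Dmult[OF s\<chi> V] d\<chi> t by simp
  also have "(\<lambda>s f. ?\<chi> s * V s f) = (\<lambda>s f. ?\<chi> s * W s f)" using VW by (auto simp: fun_eq_iff)
  also have "D (\<lambda>s f. ?\<chi> s * W s f) t = D W t" using Dmult[OF s\<chi> W] d\<chi> t by simp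
  finally have "D V t = D W t" .
  also have "\<dots> = (\<lambda>f. \<Sum>c\<in>C. deriv (\<lambda>s. G (?\<eta> s) c) t * E c (\<gamma> t) f
      + G (?\<eta> t) c * D (\<lambda>s. E c (\<gamma> s)) t f)"
    unfolding W_def by (rule Dsum[OF s\<eta> fE])
  also have "\<dots> = (\<lambda>f. \<Sum>c\<in>C. G a c * E c (\<gamma> t) f
      + G (?\<eta> t) c * E (N (coef (\<gamma> t) (velocity A \<gamma> t)) c) (\<gamma> t) f)"
  proof -
    have "deriv (\<lambda>s. G (?\<eta> s) c) t = G a c" for c
      using bounded_linear.has_vector_derivative[OF G.bounded_linear_left d, of c]
      by (intro DERIV_imp_deriv) (simp add: has_real_derivative_iff_has_vector_derivative)
    moreover have "D (\<lambda>s. E c (\<gamma> s)) t = nabla (E (coef (\<gamma> t) (velocity A \<gamma> t))) (E c) (\<gamma> t)" for c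
      using D t E_coef[OF vt] unfolding covariant_derivative_along_def by simp
    ultimately show ?thesis by (simp add: nabla_E)
  qed
  also have "\<dots> = E ((\<Sum>c\<in>C. G a c *\<^sub>R c) +
      N (coef (\<gamma> t) (velocity A \<gamma> t)) (\<Sum>c\<in>C. G (?\<eta> t) c *\<^sub>R c)) (\<gamma> t)"
    by (simp add: E_add E_sum E_scale N.sum_right N.scaleR_right sum.distrib)
  finally show ?thesis by (simp add: C)
qed

end

section \<open>The adjoint representation along a curve\<close>

text \<open>Total differentiability at \<open>(t, t)\<close> makes the derivative along the diagonal
  the sum of the two partial derivatives. It separates the two occurrences of a curve in one
  product.\<close>

lemma diagonal_has_real_derivative:
  fixes Q :: "real \<times> real \<Rightarrow> real"
  assumes Q: "(Q has_derivative Q') (at (t, t))"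
    and a: "((\<lambda>s. Q (s, t)) has_real_derivative a) (at t)"
    and b: "((\<lambda>s. Q (t, s)) has_real_derivative b) (at t)"
  shows "((\<lambda>s. Q (s, s)) has_real_derivative a + b) (at t)"
proof -
  have l: "linear Q'" by (rule has_derivative_linear[OF Q])
  have "((\<lambda>s. Q (s, t)) has_derivative (\<lambda>s. Q' (s, 0))) (at t)"
    by (rule has_derivative_compose[where f = "\<lambda>s. (s, t)", OF _ Q]) (auto intro!: derivative_eq_intros)
  from has_derivative_unique[OF this a[unfolded has_field_derivative_def]]
  have a': "Q' (s, 0) = a * s" for s by metis
  have "((\<lambda>s. Q (t, s)) has_derivative (\<lambda>s. Q' (0, s))) (at t)"
    by (rule has_derivative_compose[where f = "\<lambda>s. (t, s)", OF _ Q]) (auto intro!: derivative_eq_intros)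
  from has_derivative_unique[OF this b[unfolded has_field_derivative_def]]
  have b': "Q' (0, s) = b * s" for s by metis
  have "((\<lambda>s. Q (s, s)) has_derivative (\<lambda>s. Q' (s, s))) (at t)"
    by (rule has_derivative_compose[where f = "\<lambda>s. (s, s)", OF _ Q]) (auto intro!: derivative_eq_intros)
  moreover have "Q' (s, s) = (a + b) * s" for s
    using linear_add[OF l, of "(s, 0)" "(0, s)"] a' b' by (simp add: distrib_right)
  ultimately show ?thesis by (simp add: has_field_derivative_def)
qed

lemma has_derivative_along_line:
  fixes H :: "'a::real_normed_vector \<Rightarrow> real"
  assumes H: "(H has_derivative H') (at x)" and p: "(p has_vector_derivative v) (at t)" "p t = x"
  shows "((\<lambda>s. H (p s)) has_real_derivative H' v) (at t)"
proof -
  have "((\<lambda>s. H (p s)) has_derivative (\<lambda>s. H' (s *\<^sub>R v))) (at t)"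
    by (rule has_derivative_compose[OF p(1)[unfolded has_vector_derivative_def]]) (use H p(2) in simp)
  moreover have "(\<lambda>s. H' (s *\<^sub>R v)) = (*) (H' v)"
    using linear_scale[OF has_derivative_linear[OF H]] by (auto simp: mult.commute)
  ultimately show ?thesis by (simp only: has_field_derivative_def)
qed

context lie_riemannian
begin

abbreviation conj_by :: "'g \<Rightarrow> 'g \<Rightarrow> 'g" where "conj_by p q \<equiv> mul (mul p q) (iv p)"

definition ad :: "'g \<Rightarrow> 'e \<Rightarrow> 'e" where "ad p a = inv T (Ad A mul e iv p (T a))"

lemma iv_e [simp]: "iv e = e"
  by (metis mul_simps(2,3))

lemma iv_mul: "iv (mul p q) = mul (iv q) (iv p)"
proof -
  have "mul (iv q) (iv p) = mul (iv (mul p q)) (mul (mul p q) (mul (iv q) (iv p)))" by simp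
  then show ?thesis by (simp add: assoc)
qed

lemma conj_by_mul: "conj_by (mul p q) r = conj_by p (conj_by q r)"
  by (simp add: iv_mul assoc)

lemma conj_by_hom: "mul (conj_by p q) (conj_by p r) = conj_by p (mul q r)"
  by (simp add: assoc)

lemma smooth_at_conj_iff: "smooth_at A (\<lambda>q. f (conj_by p q)) e \<longleftrightarrow> smooth_at A f e"
proof
  assume "smooth_at A (\<lambda>q. f (conj_by p q)) e"
  then have "smooth_at A (\<lambda>q. f (conj_by p q)) (conj_by (iv p) e)" by simp
  from smooth_at_compose[OF smooth_map_conj this] have "smooth_at A (\<lambda>q. f (conj_by p (conj_by (iv p) q))) e" .
  then show "smooth_at A f e" unfolding conj_by_mul[symmetric] by simp
next
  assume "smooth_at A f e"
  then have "smooth_at A f (conj_by p e)" by simp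
  from smooth_at_compose[OF smooth_map_conj this] show "smooth_at A (\<lambda>q. f (conj_by p q)) e" .
qed

lemma T_ad: "T (ad p a) = Ad A mul e iv p (T a)"
proof -
  have "Ad A mul e iv p (T a) \<in> tangent_space A e"
    using pushforward_in_tangent_space[OF smooth_map_conj T_tangent, of p "iv p" a] by (simp add: Ad_def)
  then show ?thesis by (simp add: ad_def T_inv)
qed

lemma T_ad_apply: "T (ad p a) f = T a (\<lambda>q. f (conj_by p q))"
  using tangent_not_smooth[OF T_tangent, of "\<lambda>q. f (conj_by p q)" a]
  by (auto simp: T_ad Ad_def pushforward_def o_def smooth_at_conj_iff)

lemma ad_mul: "ad (mul p q) a = ad p (ad q a)"
proof -
  have "T (ad (mul p q) a) = T (ad p (ad q a))"
    by (rule ext) (simp only: T_ad_apply conj_by_mul)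
  then show ?thesis by simp
qed

lemma ad_e [simp]: "ad e a = a"
proof -
  have "T (ad e a) = T a" by (rule ext) (simp add: T_ad_apply)
  then show ?thesis by simp
qed

lemma ad_iv [simp]: "ad (iv p) (ad p a) = a" "ad p (ad (iv p) a) = a"
  by (simp_all flip: ad_mul)

lemma linear_ad: "linear (ad p)"
proof (rule linearI)
  fix a b and k :: real
  have "T (ad p (a + b)) = T (ad p a + ad p b)"
    by (rule ext) (simp add: T_ad_apply linear_add[OF T_linear])
  then show "ad p (a + b) = ad p a + ad p b" by simp
  have "T (ad p (k *\<^sub>R a)) = T (k *\<^sub>R ad p a)"
    by (rule ext) (simp add: T_ad_apply linear_scale[OF T_linear])
  then show "ad p (k *\<^sub>R a) = k *\<^sub>R ad p a" by simp
qed

lemma T_br: "T (br a b) = vf_bracket A (E a) (E b) e"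
  by (simp add: vf_bracket_E E_identity)

lemma T_br_apply: "smooth_at A f e \<Longrightarrow> T (br a b) f = T a (\<lambda>q. E b q f) - T b (\<lambda>q. E a q f)"
  by (simp add: T_br vf_bracket_def E_identity)

text \<open>Conjugation is a group homomorphism, so it carries the left-invariant field of
  \<open>b\<close> to that of \<open>ad p b\<close>; this is \<open>E_ad\<close>, and brackets are
  transported accordingly.\<close>

lemma ad_br: "ad p (br a b) = br (ad p a) (ad p b)"
proof -
  have E_ad: "E (ad p b) (conj_by p r) f = E b r (\<lambda>q. f (conj_by p q))" for b r f
    unfolding E_apply[of "ad p b"] T_ad_apply conj_by_hom by (rule E_apply[symmetric])
  have "T (ad p (br a b)) f = T (br (ad p a) (ad p b)) f" for f
  proof (cases "smooth_at A f e")
    case True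
    then have "smooth_at A (\<lambda>q. f (conj_by p q)) e" by (simp only: smooth_at_conj_iff)
    then show ?thesis using True by (simp only: T_ad_apply T_br_apply E_ad)
  next
    case False
    then show ?thesis by (simp add: tangent_not_smooth[OF T_tangent])
  qed
  then have "T (ad p (br a b)) = T (br (ad p a) (ad p b))" by blast
  then show ?thesis by simp
qed

text \<open>The product of \<open>c s\<close> and \<open>iv (c s)\<close> is constant. Its
  derivative along the diagonal is the sum of the velocities of \<open>c\<close> and of the inverse
  curve, so these are opposite.\<close>

lemma smooth_curve_iv_velocity:
  assumes c: "smooth_curve A c J" "open J" "t \<in> J" "c t = e" "velocity A c t = T u"
  shows "smooth_curve A (\<lambda>s. iv (c s)) J" "velocity A (\<lambda>s. iv (c s)) t = T (- u)"
proof -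
  show ic: "smooth_curve A (\<lambda>s. iv (c s)) J" by (rule smooth_map_iv[OF std_real c(2,1)])
  show "velocity A (\<lambda>s. iv (c s)) t = T (- u)"
  proof
    fix f
    show "velocity A (\<lambda>s. iv (c s)) t f = T (- u) f"
    proof (cases "smooth_at A f e")
      case f: True
      note fin2 = fin_dim_euclidean[where 'a = "real \<times> real"]
      let ?F = "\<lambda>x. mul (c (fst x)) (iv (c (snd x)))"
      have o: "open (J \<times> J)" by (intro open_Times c)
      have "smooth_map std_atlas A ?F (J \<times> J)"
        by (intro smooth_map_mul smooth_map_iv smooth_atlas_std fin2 o c
            smooth_map_snd_curve smooth_map_fst_map fin_dim_euclidean)
      moreover have "smooth_at A f (?F (t, t))" using f c by simp
      moreover have "(t, t) \<in> J \<times> J" using c by simp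
      ultimately obtain W where W: "(t, t) \<in> W" "smooth_on (\<lambda>x. f (?F x)) W"
        using smooth_at_compose_map[OF smooth_atlas_std[OF fin2] _ o, of ?F "(t, t)" f]
        unfolding smooth_map_std_std by blast
      have "((\<lambda>s. f (?F (s, t))) has_real_derivative T u f) (at t)"
        using velocity_has_real_derivative[OF c(1-3), of f] f c by simp
      moreover have "((\<lambda>s. f (?F (t, s))) has_real_derivative velocity A (\<lambda>s. iv (c s)) t f) (at t)"
        using velocity_has_real_derivative[OF ic c(2,3), of f] f c by simp
      ultimately have "((\<lambda>s. f (?F (s, s))) has_real_derivative T u f + velocity A (\<lambda>s. iv (c s)) t f) (at t)"
        by (rule diagonal_has_real_derivative[OF smooth_on_has_derivative[OF W(2,1)]])
      moreover have "((\<lambda>s. f (?F (s, s))) has_real_derivative 0) (at t)" by simp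
      ultimately have "T u f + velocity A (\<lambda>s. iv (c s)) t f = 0" by (rule DERIV_unique)
      then show ?thesis using linear_neg[OF T_linear, of u f] by simp
    next
      case False
      then show ?thesis using c by (simp add: velocity_def tvec_def)
    qed
  qed
qed

text \<open>The derivative of \<open>c k c\<^sup>-\<^sup>1\<close> splits into that of \<open>c k\<close> and that of \<open>k c\<^sup>-\<^sup>1\<close>; exchanging the
  two derivatives in the second part produces the two terms of the bracket.\<close>

lemma ad_has_real_derivative_identity:
  assumes c: "smooth_curve A c J" "open J" "t \<in> J" "c t = e" "velocity A c t = T u"
    and h: "smooth_at A h e"
  shows "((\<lambda>s. T (ad (c s) x) h) has_real_derivative T (br u x) h) (at t)"
proof -
  obtain k I where k: "k 0 = e" "smooth_curve A k I" "open I" "(0::real) \<in> I" "velocity A k 0 = T x"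
    using tangent_obtain_curve[OF T_tangent] by metis
  note fin2 = fin_dim_euclidean[where 'a = "real \<times> real"]
  note fin3 = fin_dim_euclidean[where 'a = "real \<times> real \<times> real"]
  \<comment> \<open>A map of three variables \<open>(s, s', r)\<close>: the two occurrences of
    \<open>c\<close> in the conjugation get separate parameters, and \<open>r\<close> runs along the
    curve \<open>k\<close> that represents \<open>x\<close>.\<close>
  let ?F = "\<lambda>x. mul (mul (c (fst x)) (k (snd (snd x)))) (iv (c (fst (snd x))))"
  have o: "open (J \<times> J \<times> I)" by (intro open_Times c k)
  have "smooth_map std_atlas A ?F (J \<times> J \<times> I)"
  proof (intro smooth_map_mul smooth_map_iv smooth_atlas_std fin3 o)
    show "smooth_map std_atlas A (\<lambda>x. c (fst x)) (J \<times> J \<times> I)"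
      by (rule smooth_map_compose[OF smooth_atlas_std[OF fin3] std_real atlas _ c(1) o c(2)])
        (auto simp: smooth_map_std_std intro: smooth_on_bounded_linear bounded_linear_fst)
    show "smooth_map std_atlas A (\<lambda>x. c (fst (snd x))) (J \<times> J \<times> I)"
      by (rule smooth_map_compose[OF smooth_atlas_std[OF fin3] std_real atlas _ c(1) o c(2)])
        (auto simp: smooth_map_std_std intro: smooth_on_bounded_linear
          bounded_linear_compose[OF bounded_linear_fst bounded_linear_snd])
    show "smooth_map std_atlas A (\<lambda>x. k (snd (snd x))) (J \<times> J \<times> I)"
      by (rule smooth_map_compose[OF smooth_atlas_std[OF fin3] std_real atlas _ k(2) o k(3)])
        (auto simp: smooth_map_std_std intro: smooth_on_bounded_linear
          bounded_linear_compose[OF bounded_linear_snd bounded_linear_snd])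
  qed
  moreover have "smooth_at A h (?F (t, t, 0))" using h c k by simp
  moreover have "(t, t, 0) \<in> J \<times> J \<times> I" using c k by simp
  ultimately obtain W where W: "open W" "(t, t, 0) \<in> W" "W \<subseteq> J \<times> J \<times> I"
    "smooth_on (\<lambda>x. h (?F x)) W" "\<And>x. x \<in> W \<Longrightarrow> smooth_at A h (?F x)"
    using smooth_at_compose_map[OF smooth_atlas_std[OF fin3] _ o, of ?F "(t, t, 0)" h]
    unfolding smooth_map_std_std by blast
  define H where "H = (\<lambda>x. h (?F x))"
  have H: "smooth_on H W" using W(4) by (simp add: H_def)
  \<comment> \<open>\<open>P\<close> differentiates in \<open>r\<close>, and on the diagonal
    \<open>s = s'\<close> at \<open>r = 0\<close> it is the adjoint action tested on
    \<open>h\<close>; \<open>P2\<close> differentiates in \<open>s'\<close>.\<close>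
  define P where "P = (\<lambda>y. frechet_derivative H (at y) (0, 0, 1))"
  define P2 where "P2 = (\<lambda>y. frechet_derivative H (at y) (0, 1, 0))"
  have P: "smooth_on P W" and P2: "smooth_on P2 W"
    unfolding P_def P2_def using smooth_on_frechet_derivative[OF H W(1)] by blast+
  let ?DP = "frechet_derivative P (at (t, t, 0))"
  have DP: "(P has_derivative ?DP) (at (t, t, 0))" by (rule smooth_on_has_derivative[OF P W(2)])
  have P_eq: "P (s, s', 0) = deriv (\<lambda>r. H (s, s', r)) 0" if "(s, s', 0) \<in> W" for s s'
  proof -
    have "((\<lambda>r. H (s, s', r)) has_real_derivative P (s, s', 0)) (at 0)"
      unfolding P_def
      by (rule has_derivative_along_line[OF smooth_on_has_derivative[OF H that]])
        (auto intro!: derivative_eq_intros has_vector_derivative_Pair)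
    then show ?thesis by (simp add: DERIV_imp_deriv)
  qed
  have ev: "\<forall>\<^sub>F s in nhds t. p s \<in> W" if "isCont p t" "p t = (t, t, 0)" for p
    using that W(1,2) by (metis continuous_within eventually_nhds_conv_at topological_tendstoD isCont_def)
  \<comment> \<open>With \<open>s' = t\<close> the inverse factor is the identity, so
    \<open>P\<close> is the left-invariant field of \<open>x\<close> along \<open>c\<close>.\<close>
  have 1: "((\<lambda>s. P (s, t, 0)) has_real_derivative T u (\<lambda>q. E x q h)) (at t)"
  proof -
    have "\<forall>\<^sub>F s in nhds t. (s, t, 0) \<in> W" by (rule ev) (auto intro!: continuous_intros)
    then have "\<forall>\<^sub>F s in nhds t. P (s, t, 0) = E x (c s) h"
    proof eventually_elim
      case (elim s)
      have "smooth_at A (\<lambda>r. h (mul (c s) r)) e" using W(5)[OF elim] c(4) k(1) by (simp add: smooth_at_left_iff)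
      then show ?case
        by (simp add: P_eq[OF elim] H_def c(4) E_apply k(5)[symmetric] velocity_def k(1) o_def)
    qed
    moreover have "((\<lambda>s. E x (c s) h) has_real_derivative T u (\<lambda>q. E x q h)) (at t)"
      using velocity_has_real_derivative[OF c(1-3), of "\<lambda>q. E x q h"] E_smooth_at h c by simp
    ultimately show ?thesis using DERIV_cong_ev[OF refl _ refl] by fast
  qed
  \<comment> \<open>With \<open>s = t\<close> the first factor is the identity. Differentiating in
    \<open>s'\<close> first gives a left-invariant field along \<open>k\<close>, with
    \<open>- u\<close> because the curve is inverted; the \<open>r\<close> derivative is taken
    afterwards.\<close>
  have 2: "((\<lambda>s. P (t, s, 0)) has_real_derivative - T x (\<lambda>q. E u q h)) (at t)"
  proof -
    note ic = smooth_curve_iv_velocity[OF c]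
    have "\<forall>\<^sub>F r in nhds 0. (t, t, r) \<in> W"
    proof -
      have "isCont (\<lambda>r. (t, t, r)) 0" by (intro continuous_intros)
      then show ?thesis using W(1,2) by (metis continuous_within eventually_nhds_conv_at topological_tendstoD isCont_def)
    qed
    then have "\<forall>\<^sub>F r in nhds 0. P2 (t, t, r) = E (- u) (k r) h"
    proof eventually_elim
      case (elim r)
      have "((\<lambda>s'. H (t, s', r)) has_real_derivative P2 (t, t, r)) (at t)"
        unfolding P2_def
        by (rule has_derivative_along_line[OF smooth_on_has_derivative[OF H elim]])
          (auto intro!: derivative_eq_intros has_vector_derivative_Pair)
      moreover have sm: "smooth_at A (\<lambda>q. h (mul (k r) q)) e"
        using W(5)[OF elim] c(4) by (simp add: smooth_at_left_iff)
      have "((\<lambda>s'. h (mul (k r) (iv (c s')))) has_real_derivative T (- u) (\<lambda>q. h (mul (k r) q))) (at t)"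
        using velocity_has_real_derivative[OF ic(1) c(2,3), of "\<lambda>q. h (mul (k r) q)"] sm c(4) ic(2) by simp
      then have "((\<lambda>s'. H (t, s', r)) has_real_derivative E (- u) (k r) h) (at t)"
        by (simp add: H_def c(4) E_apply)
      ultimately show ?case by (rule DERIV_unique)
    qed
    moreover have "((\<lambda>r. E (- u) (k r) h) has_real_derivative T x (\<lambda>q. E (- u) q h)) (at 0)"
      using velocity_has_real_derivative[OF k(2-4), of "\<lambda>q. E (- u) q h"] E_smooth_at h k by simp
    ultimately have d: "((\<lambda>r. P2 (t, t, r)) has_real_derivative T x (\<lambda>q. E (- u) q h)) (at 0)"
      using DERIV_cong_ev[OF refl _ refl] by fast
    have "((\<lambda>r. P2 (t, t, r)) has_real_derivative frechet_derivative P2 (at (t, t, 0)) (0, 0, 1)) (at 0)"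
      by (rule has_derivative_along_line[OF smooth_on_has_derivative[OF P2 W(2)]])
        (auto intro!: derivative_eq_intros has_vector_derivative_Pair)
    then have "frechet_derivative P2 (at (t, t, 0)) (0, 0, 1) = T x (\<lambda>q. E (- u) q h)"
      using d by (rule DERIV_unique)
    \<comment> \<open>The order of the derivatives in \<open>r\<close> and \<open>s'\<close> is
      exchanged here.\<close>
    moreover have "frechet_derivative P2 (at (t, t, 0)) (0, 0, 1) = ?DP (0, 1, 0)"
      unfolding P_def P2_def by (rule second_derivative_commute[OF H W(1,2)])
    moreover have "((\<lambda>s. P (t, s, 0)) has_real_derivative ?DP (0, 1, 0)) (at t)"
      by (rule has_derivative_along_line[OF DP])
        (auto intro!: derivative_eq_intros has_vector_derivative_Pair)
    moreover have "T x (\<lambda>q. E (- u) q h) = - T x (\<lambda>q. E u q h)"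
      using tangent_scale[OF T_tangent E_smooth_at[OF h], of x "-1" u] linear_neg[OF E_linear] by simp
    ultimately show ?thesis by simp
  qed
  have "((\<lambda>x. P (fst x, snd x, 0)) has_derivative (\<lambda>x. ?DP (fst x, snd x, 0))) (at (t, t))"
    by (rule has_derivative_compose[where f = "\<lambda>x. (fst x, snd x, 0)" and g = P])
      (use DP in \<open>auto intro!: derivative_eq_intros\<close>)
  from diagonal_has_real_derivative[OF this, of "T u (\<lambda>q. E x q h)" "- T x (\<lambda>q. E u q h)"]
  have "((\<lambda>s. P (s, s, 0)) has_real_derivative T (br u x) h) (at t)"
    using 1 2 by (simp add: T_br_apply[OF h])
  moreover have "\<forall>\<^sub>F s in nhds t. (s, s, 0) \<in> W" by (rule ev) (auto intro!: continuous_intros)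
  then have "\<forall>\<^sub>F s in nhds t. P (s, s, 0) = T (ad (c s) x) h"
  proof eventually_elim
    case (elim s)
    have "smooth_at A (\<lambda>q. h (conj_by (c s) q)) e" using h by (simp only: smooth_at_conj_iff)
    then show ?case
      by (simp add: P_eq[OF elim] H_def T_ad_apply k(5)[symmetric] velocity_def k(1) o_def)
  qed
  ultimately show ?thesis using DERIV_cong_ev[OF refl _ refl] by fast
qed

text \<open>Translating the curve by \<open>iv (\<gamma> t)\<close> makes it pass through the
  identity at time \<open>t\<close>; the remaining factor \<open>ad (\<gamma> t)\<close> is moved
  into the test function by conjugation.\<close>

lemma ad_has_real_derivative_const:
  assumes \<gamma>: "smooth_curve A \<gamma> J" "open J" "t \<in> J"
  shows "((\<lambda>s. T (ad (\<gamma> s) x) f) has_real_derivative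
    T (ad (\<gamma> t) (br (coef (\<gamma> t) (velocity A \<gamma> t)) x)) f) (at t)"
proof (cases "smooth_at A f e")
  case True
  let ?c = "\<lambda>s. mul (iv (\<gamma> t)) (\<gamma> s)" and ?h = "\<lambda>q. f (conj_by (\<gamma> t) q)"
  have c: "smooth_curve A ?c J" "velocity A ?c t = T (coef (\<gamma> t) (velocity A \<gamma> t))"
    using pushforward_velocity[OF smooth_map_left \<gamma>, of "iv (\<gamma> t)"]
    by (simp_all add: T_coef[OF velocity_in_tangent_space[OF \<gamma>]])
  have h: "smooth_at A ?h e" using True by (simp only: smooth_at_conj_iff)
  have "T (ad (?c s) x) ?h = T (ad (\<gamma> s) x) f" for s
    unfolding T_ad_apply[of "\<gamma> t", symmetric] ad_mul[symmetric] by simp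
  then show ?thesis using ad_has_real_derivative_identity[OF c(1) \<gamma>(2,3) _ c(2) h, of x]
    by (simp add: T_ad_apply[of "\<gamma> t", symmetric])
next
  case False
  then show ?thesis by (simp add: tangent_not_smooth[OF T_tangent])
qed

text \<open>A product rule, obtained by expanding \<open>\<eta> s\<close> in a fixed frame so that
  the adjoint action is differentiated on constant vectors only.\<close>

lemma ad_has_real_derivative:
  assumes \<gamma>: "smooth_curve A \<gamma> J" "open J" "t \<in> J"
    and \<eta>: "(\<eta> has_vector_derivative a) (at t)"
  shows "((\<lambda>s. T (ad (\<gamma> s) (\<eta> s)) f) has_real_derivative
    T (ad (\<gamma> t) (a + br (coef (\<gamma> t) (velocity A \<gamma> t)) (\<eta> t))) f) (at t)"
proof -
  let ?u = "coef (\<gamma> t) (velocity A \<gamma> t)"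
  obtain B :: "'e set" where B: "finite B" "\<And>x. (\<Sum>b\<in>B. (x \<bullet> b) *\<^sub>R b) = x"
    using fin_dim_frame[OF fin] by metis
  have lin: "linear (\<lambda>a. T (ad p a) f)" for p
    using linear_compose[OF linear_ad T_linear] by (simp add: o_def)
  have ex: "T (ad p a) f = (\<Sum>b\<in>B. (a \<bullet> b) * T (ad p b) f)" for p a
  proof -
    have "T (ad p a) f = T (ad p (\<Sum>b\<in>B. (a \<bullet> b) *\<^sub>R b)) f" by (simp add: B)
    also have "\<dots> = (\<Sum>b\<in>B. (a \<bullet> b) * T (ad p b) f)" by (simp add: linear_sum[OF lin] linear_scale[OF lin])
    finally show ?thesis .
  qed
  interpret N: bounded_bilinear N by (rule bounded_bilinear_N)
  have lin_br: "linear (br ?u)"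
    by (rule linearI) (simp_all add: br_eq N.add_left N.add_right N.scaleR_left N.scaleR_right scaleR_diff_right)
  have br: "T (ad p (br ?u a)) f = (\<Sum>b\<in>B. (a \<bullet> b) * T (ad p (br ?u b)) f)" for p a
  proof -
    have "T (ad p (br ?u a)) f = T (ad p (br ?u (\<Sum>b\<in>B. (a \<bullet> b) *\<^sub>R b))) f" by (simp add: B)
    also have "\<dots> = (\<Sum>b\<in>B. (a \<bullet> b) * T (ad p (br ?u b)) f)"
      by (simp add: linear_sum[OF lin] linear_scale[OF lin] linear_sum[OF lin_br] linear_scale[OF lin_br])
    finally show ?thesis .
  qed
  have "((\<lambda>s. \<Sum>b\<in>B. (\<eta> s \<bullet> b) * T (ad (\<gamma> s) b) f) has_real_derivative
      (\<Sum>b\<in>B. (a \<bullet> b) * T (ad (\<gamma> t) b) f + (\<eta> t \<bullet> b) * T (ad (\<gamma> t) (br ?u b)) f)) (at t)"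
  proof (rule DERIV_sum)
    fix b
    have "((\<lambda>s. \<eta> s \<bullet> b) has_real_derivative a \<bullet> b) (at t)"
      using bounded_linear.has_vector_derivative[OF bounded_linear_inner_left \<eta>, of b]
      by (simp add: has_real_derivative_iff_has_vector_derivative)
    from DERIV_mult[OF this ad_has_real_derivative_const[OF \<gamma>]]
    show "((\<lambda>s. (\<eta> s \<bullet> b) * T (ad (\<gamma> s) b) f) has_real_derivative
        (a \<bullet> b) * T (ad (\<gamma> t) b) f + (\<eta> t \<bullet> b) * T (ad (\<gamma> t) (br ?u b)) f) (at t)"
      by (simp add: mult.commute)
  qed
  then show ?thesis
    by (simp add: ex[symmetric] sum.distrib br[symmetric] linear_add[OF lin])
qed

text \<open>The inverse curve shows componentwise that a derivative exists; its value then comes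
  from the constancy of \<open>ad (\<gamma> s) (ad (iv (\<gamma> s)) x)\<close>.\<close>

lemma ad_inverse_has_vector_derivative:
  assumes \<gamma>: "smooth_curve A \<gamma> J" "open J" "t \<in> J"
  shows "((\<lambda>s. ad (iv (\<gamma> s)) x) has_vector_derivative
    - br (coef (\<gamma> t) (velocity A \<gamma> t)) (ad (iv (\<gamma> t)) x)) (at t)"
proof -
  let ?w = "\<lambda>s. ad (iv (\<gamma> s)) x"
  obtain B :: "'e set" where B: "finite B" "\<And>x. (\<Sum>b\<in>B. (x \<bullet> b) *\<^sub>R b) = x"
    using fin_dim_frame[OF fin] by metis
  have "\<exists>d. ((\<lambda>s. ?w s \<bullet> b) has_real_derivative d) (at t)" for b
    using ad_has_real_derivative_const[OF smooth_map_iv[OF std_real \<gamma>(2,1)] \<gamma>(2,3), of x "\<lambda>q. \<phi>0 q \<bullet> b"]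
    by (auto simp: tvec_coordinate[OF chart0])
  then obtain d where d: "\<And>b. ((\<lambda>s. ?w s \<bullet> b) has_real_derivative d b) (at t)" by metis
  have "((\<lambda>s. \<Sum>b\<in>B. (?w s \<bullet> b) *\<^sub>R b) has_vector_derivative (\<Sum>b\<in>B. d b *\<^sub>R b)) (at t)"
    using d by (intro has_vector_derivative_sum bounded_linear.has_vector_derivative[OF bounded_linear_scaleR_left])
      (simp add: has_real_derivative_iff_has_vector_derivative)
  then obtain w' where w': "(?w has_vector_derivative w') (at t)" by (simp add: B)
  \<comment> \<open>By the product rule \<open>ad (\<gamma> t) ?r\<close> is the derivative of that
    constant, and \<open>ad (\<gamma> t)\<close> is injective, so \<open>?r\<close> must
    vanish.\<close>
  let ?r = "w' + br (coef (\<gamma> t) (velocity A \<gamma> t)) (?w t)"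
  have "T (ad (\<gamma> t) ?r) f = T 0 f" for f
  proof -
    have "((\<lambda>s. T x f) has_real_derivative T (ad (\<gamma> t) ?r) f) (at t)"
      using ad_has_real_derivative[OF \<gamma> w', of f] by simp
    then show ?thesis using DERIV_unique[OF DERIV_const] linear_0[OF T_linear] by metis
  qed
  then have "T (ad (\<gamma> t) ?r) = T 0" by blast
  then have "ad (\<gamma> t) ?r = ad (\<gamma> t) 0" using linear_0[OF linear_ad] by simp
  then have "?r = 0" by (metis ad_iv(1))
  then have "w' = - br (coef (\<gamma> t) (velocity A \<gamma> t)) (?w t)" by (simp add: eq_neg_iff_add_eq_0)
  then show ?thesis using w' by simp
qed

end

section \<open>The index form\<close>

text \<open>\<open>F\<close> and \<open>K\<close> are integrable together or not at all; in the
  second case both integrals take the same default value, so the equality holds either way.\<close>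

lemma integral_eq_of_difference_has_integral_0:
  fixes F :: "real \<Rightarrow> real"
  assumes "\<And>t. t \<in> S \<Longrightarrow> F t = K t + B t" and B: "(B has_integral 0) S"
  shows "integral S F = integral S K"
proof (cases "K integrable_on S")
  case True
  have "((\<lambda>t. K t + B t) has_integral integral S K + 0) S"
    by (intro has_integral_add integrable_integral True B)
  then have "(F has_integral integral S K + 0) S" by (rule has_integral_eq[rotated]) (simp add: assms)
  then show ?thesis by (simp add: integral_unique)
next
  case False
  have "\<not> F integrable_on S"
  proof
    assume "F integrable_on S"
    then have "(\<lambda>t. F t - B t) integrable_on S" using B integrable_diff by blast
    then have "K integrable_on S" by (rule integrable_eq) (simp add: assms)
    then show False using False by simp
  qed
  then show ?thesis using False by (simp add: not_integrable_integral)
qed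

context lie_riemannian
begin

interpretation G: bounded_bilinear G by (rule bounded_bilinear_G)
interpretation N: bounded_bilinear N by (rule bounded_bilinear_N)

lemma G_N_self: "G (N a b) b = 0"
  using N_skew[of a b b] by (simp add: G_commute)

lemma G_N_flip: "G (N a b) c = - G (N a c) b"
  using N_skew[of a b c] by (simp add: G_commute)

text \<open>Along a geodesic \<open>u' = - N u u\<close>, so the last summand is the derivative of \<open>G (N y u) y\<close>.\<close>

lemma index_integrand_identity:
  assumes "z = y' + br u y"
  shows "G (y' + N u y) (y' + N u y)
      - G (N y (N u u) - N u (N y u) - N (br y u) u) y =
    G z z - G (br y z) u + (G (N y u) y' + G (N y' u + N y (- N u u)) y)"
proof -
  \<comment> \<open>Eliminating \<open>y'\<close> turns \<open>y' + N u y\<close> into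
    \<open>z + N y u\<close>. What remains is bilinear expansion and skew-symmetry of
    \<open>N\<close>; the Jacobi identity does not enter.\<close>
  have y': "y' = z - N u y + N y u" using assms by (simp add: br_eq)
  note bil = G.add_left G.add_right G.diff_left G.diff_right G.minus_left G.minus_right
    N.add_left N.add_right N.diff_left N.diff_right N.minus_left N.minus_right
  have a: "G (N u (N y u)) y = - G (N u y) (N y u)" by (rule G_N_flip)
  have b: "G (N y z) u = - G (N y u) z" "G (N z y) u = - G (N z u) y" by (rule G_N_flip)+
  show ?thesis unfolding y' br_eq
    using a b G_commute[of z "N y u"] G_commute[of "N u y" "N y u"] by (simp add: bil)
qed

context
  fixes \<gamma> :: "real \<Rightarrow> 'g" and J :: "real set" and D :: "(real \<Rightarrow> 'g tangent) \<Rightarrow> real \<Rightarrow> 'g tangent"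
  assumes J: "open J" "is_interval J" "0 \<in> J"
    and D: "covariant_derivative_along A nabla \<gamma> J D"
    and geo: "geodesic A D \<gamma> J" and \<gamma>0: "\<gamma> 0 = e"
begin

abbreviation uc :: "real \<Rightarrow> 'e" where "uc t \<equiv> coef (\<gamma> t) (velocity A \<gamma> t)"

lemma \<gamma>_smooth: "smooth_curve A \<gamma> J"
  using geo by (simp add: geodesic_def)

lemma coef_differentiable:
  assumes "field_along A \<gamma> J V" "t \<in> J"
  shows "\<exists>a. ((\<lambda>s. coef (\<gamma> s) (V s)) has_vector_derivative a) (at t)"
proof -
  have "(\<lambda>s. coef (\<gamma> s) (V s)) differentiable at t"
    using smooth_on_has_derivative[OF smooth_on_coef[OF \<gamma>_smooth J(1) assms(1)] assms(2)] differentiableI by blast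
  then show ?thesis using vector_derivative_works by blast
qed

lemma geodesic_equation:
  assumes t: "t \<in> J"
  shows "(uc has_vector_derivative - N (uc t) (uc t)) (at t)"
proof -
  note V = field_along_velocity[OF \<gamma>_smooth J(1)]
  obtain a where a: "(uc has_vector_derivative a) (at t)" using coef_differentiable[OF V t] by blast
  have "E (a + N (uc t) (uc t)) (\<gamma> t) = (\<lambda>f. 0)"
    using covariant_derivative_along_eq[OF D \<gamma>_smooth J(1) V t a] geo t by (simp add: geodesic_def)
  then have "a + N (uc t) (uc t) = 0" using E_zero E_eq_iff by metis
  then have "a = - N (uc t) (uc t)" by (simp add: eq_neg_iff_add_eq_0)
  then show ?thesis using a by simp
qed

text \<open>For \<open>w s = ad (iv (\<gamma> s)) c\<close> the contributions of \<open>w' = - [u, w]\<close> and \<open>u' = - N u u\<close> to the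
  derivative of \<open>G w u\<close> cancel.\<close>

lemma momentum:
  assumes t: "t \<in> J"
  shows "G (ad (\<gamma> t) a) (uc 0) = G a (uc t)"
proof -
  let ?c = "ad (\<gamma> t) a"
  \<comment> \<open>The vector \<open>?c\<close> is held fixed and transported back along the curve:
    \<open>?w\<close> equals \<open>a\<close> at time \<open>t\<close> and \<open>?c\<close> at time
    0, where the curve is at the identity. Constancy of the pairing on the interval \<open>J\<close>
    compares the two.\<close>
  let ?w = "\<lambda>s. ad (iv (\<gamma> s)) ?c"
  have "((\<lambda>s. G (?w s) (uc s)) has_real_derivative 0) (at s within J)" if s: "s \<in> J" for s
  proof -
    have "((\<lambda>s. G (?w s) (uc s)) has_vector_derivative
        G (?w s) (- N (uc s) (uc s)) + G (- br (uc s) (?w s)) (uc s)) (at s)"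
      by (intro G.has_vector_derivative geodesic_equation s
          ad_inverse_has_vector_derivative[OF \<gamma>_smooth J(1) s])
    moreover have "G (?w s) (- N (uc s) (uc s)) + G (- br (uc s) (?w s)) (uc s) = 0"
      using G_N_self[of "?w s" "uc s"] N_skew[of "uc s" "?w s" "uc s"]
      by (simp add: G.minus_left G.minus_right br_eq G.diff_left)
    ultimately show ?thesis
      by (simp add: has_real_derivative_iff_has_vector_derivative has_vector_derivative_at_within)
  qed
  from has_field_derivative_zero_constant[OF is_interval_convex[OF J(2)] this]
  obtain k where k: "\<And>s. s \<in> J \<Longrightarrow> G (?w s) (uc s) = k" by blast
  show ?thesis using k[OF t] k[OF J(3)] by (simp add: \<gamma>0)
qed

text \<open>Both claimed integrands equal the same function \<open>?K\<close> of the coefficient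
  curves on the interval of integration, so a single comparison with the index form
  suffices.\<close>

lemma index_form_eq:
  assumes \<tau>: "\<tau> \<in> J" "0 < \<tau>" and Y: "field_along A \<gamma> J Y" "Y 0 = (\<lambda>f. 0)" "Y \<tau> = (\<lambda>f. 0)"
    and u: "\<And>t. u t = pushforward A (mul (iv (\<gamma> t))) (\<gamma> t) (velocity A \<gamma> t)"
    and y: "\<And>t. y t = pushforward A (mul (iv (\<gamma> t))) (\<gamma> t) (Y t)"
    and z: "\<And>t. z t = (\<lambda>f. tderiv y t f + lie_bracket A mul e (u t) (y t) f)"
    and v: "\<And>t. v t = pushforward A (\<lambda>q. mul q (iv (\<gamma> t))) (\<gamma> t) (Y t)"
    and u0: "velocity A \<gamma> 0 = u0"
  shows "index_form A g nabla D \<gamma> \<tau> Y =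
      integral {0..\<tau>} (\<lambda>t. g e (z t) (z t) - g e (lie_bracket A mul e (y t) (z t)) (u t))"
    "index_form A g nabla D \<gamma> \<tau> Y =
      integral {0..\<tau>} (\<lambda>t.
        g e (Ad A mul e iv (iv (\<gamma> t)) (tderiv v t)) (Ad A mul e iv (iv (\<gamma> t)) (tderiv v t))
        - g e (lie_bracket A mul e (v t) (tderiv v t)) u0)"
proof -
  let ?\<eta> = "\<lambda>t. coef (\<gamma> t) (Y t)"
  have sub: "t \<in> J" if "t \<in> {0..\<tau>}" for t
    using mem_is_interval_1_I[OF J(2,3) \<tau>(1)] that by simp
  have vel: "velocity A \<gamma> t \<in> tangent_space A (\<gamma> t)" if "t \<in> J" for t
    by (rule velocity_in_tangent_space[OF \<gamma>_smooth J(1) that])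
  have "\<forall>t\<in>J. \<exists>a. (?\<eta> has_vector_derivative a) (at t)"
    using coef_differentiable[OF Y(1)] by blast
  then obtain \<eta>' where \<eta>': "\<And>t. t \<in> J \<Longrightarrow> (?\<eta> has_vector_derivative \<eta>' t) (at t)" by metis
  define \<zeta> where "\<zeta> = (\<lambda>t. \<eta>' t + br (uc t) (?\<eta> t))"
  have lb: "lie_bracket A mul e (T a) (T b) = T (br a b)" for a b
    by (simp add: lie_bracket_eq T_br)
  have yT: "y t = T (?\<eta> t)" if "t \<in> J" for t
    unfolding y by (rule T_coef[OF field_alongD(1)[OF Y(1) that], symmetric])
  have uT: "u t = T (uc t)" if "t \<in> J" for t
    unfolding u by (rule T_coef[OF vel[OF that], symmetric])
  have ty: "tderiv y t = T (\<eta>' t)" if t: "t \<in> J" for t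
  proof
    fix f
    have "((\<lambda>s. T (?\<eta> s) f) has_real_derivative T (\<eta>' t) f) (at t)"
      using bounded_linear.has_vector_derivative[OF
          linear_imp_bounded_linear_fin_dim[OF fin T_linear] \<eta>'[OF t]]
      by (simp add: has_real_derivative_iff_has_vector_derivative)
    then have "((\<lambda>s. y s f) has_real_derivative T (\<eta>' t) f) (at t)"
      by (rule has_field_derivative_transform_within_open[OF _ J(1) t]) (simp add: yT)
    then show "tderiv y t f = T (\<eta>' t) f" unfolding tderiv_def by (rule DERIV_imp_deriv)
  qed
  have zT: "z t = T (\<zeta> t)" if t: "t \<in> J" for t
    by (simp add: fun_eq_iff z ty yT uT lb t \<zeta>_def linear_add[OF T_linear])
  \<comment> \<open>Right translation by the inverse is left translation by the inverse followed by
    conjugation, so \<open>v\<close> is the adjoint image of \<open>y\<close>.\<close>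
  have vT: "v t = T (ad (\<gamma> t) (?\<eta> t))" if t: "t \<in> J" for t
  proof -
    have "T (ad (\<gamma> t) (?\<eta> t)) = pushforward A (\<lambda>q. mul q (iv (\<gamma> t))) (\<gamma> t) (E (?\<eta> t) (\<gamma> t))"
      unfolding T_ad Ad_def E_def left_field_def
      using pushforward_compose[OF smooth_map_left[of "\<gamma> t"] smooth_map_right[of "iv (\<gamma> t)"], of e] by simp
    then show ?thesis using E_coef[OF field_alongD(1)[OF Y(1) t]] v by simp
  qed
  have tv: "tderiv v t = T (ad (\<gamma> t) (\<zeta> t))" if t: "t \<in> J" for t
  proof
    fix f
    have "((\<lambda>s. v s f) has_real_derivative T (ad (\<gamma> t) (\<zeta> t)) f) (at t)"
      unfolding \<zeta>_def
      by (rule has_field_derivative_transform_within_open[OF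
            ad_has_real_derivative[OF \<gamma>_smooth J(1) t \<eta>'[OF t]] J(1) t]) (simp add: vT)
    then show "tderiv v t f = T (ad (\<gamma> t) (\<zeta> t)) f" unfolding tderiv_def by (rule DERIV_imp_deriv)
  qed
  let ?K = "\<lambda>t. G (\<zeta> t) (\<zeta> t) - G (br (?\<eta> t) (\<zeta> t)) (uc t)"
  let ?B = "\<lambda>t. G (N (?\<eta> t) (uc t)) (?\<eta> t)"
  let ?B' = "\<lambda>t. G (N (?\<eta> t) (uc t)) (\<eta>' t)
      + G (N (\<eta>' t) (uc t) + N (?\<eta> t) (- N (uc t) (uc t))) (?\<eta> t)"
  have integrand: "g (\<gamma> t) (D Y t) (D Y t) -
      g (\<gamma> t) (curvature_at A nabla (\<gamma> t) (Y t) (velocity A \<gamma> t) (velocity A \<gamma> t)) (Y t) =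
      ?K t + ?B' t" if t: "t \<in> J" for t
  proof -
    have gY: "g (\<gamma> t) (E a (\<gamma> t)) (Y t) = G a (?\<eta> t)" for a
      using metric_E[of "\<gamma> t" a "?\<eta> t"] E_coef[OF field_alongD(1)[OF Y(1) t]] by simp
    have "g (\<gamma> t) (D Y t) (D Y t) = G (\<eta>' t + N (uc t) (?\<eta> t)) (\<eta>' t + N (uc t) (?\<eta> t))"
      by (simp add: covariant_derivative_along_eq[OF D \<gamma>_smooth J(1) Y(1) t \<eta>'[OF t]] metric_E)
    moreover have "g (\<gamma> t) (curvature_at A nabla (\<gamma> t) (Y t) (velocity A \<gamma> t) (velocity A \<gamma> t)) (Y t) =
        G (N (?\<eta> t) (N (uc t) (uc t)) - N (uc t) (N (?\<eta> t) (uc t)) - N (br (?\<eta> t) (uc t)) (uc t)) (?\<eta> t)"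
      unfolding curvature_at_eq[OF field_alongD(1)[OF Y(1) t] vel[OF t] vel[OF t]]
      by (rule gY)
    ultimately show ?thesis using index_integrand_identity[OF \<zeta>_def[THEN fun_cong]] by simp
  qed
  \<comment> \<open>The endpoint conditions on \<open>Y\<close> make the boundary term
    \<open>?B\<close> vanish at 0 and at \<open>\<tau>\<close>, so its derivative \<open>?B'\<close>
    integrates to 0.\<close>
  have \<eta>0: "?\<eta> 0 = 0" "?\<eta> \<tau> = 0" using coef_E[of _ 0] by (simp_all add: Y(2,3) E_zero)
  have "(?B' has_integral (?B \<tau> - ?B 0)) {0..\<tau>}"
  proof (rule fundamental_theorem_of_calculus)
    fix t assume "t \<in> {0..\<tau>}"
    then have t: "t \<in> J" by (rule sub)
    have "((\<lambda>t. N (?\<eta> t) (uc t)) has_vector_derivative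
        N (?\<eta> t) (- N (uc t) (uc t)) + N (\<eta>' t) (uc t)) (at t)"
      by (rule N.has_vector_derivative[OF \<eta>'[OF t] geodesic_equation[OF t]])
    from G.has_vector_derivative[OF this \<eta>'[OF t]]
    show "(?B has_vector_derivative ?B' t) (at t within {0..\<tau>})"
      by (simp add: add.commute has_vector_derivative_at_within)
  qed (use \<tau> in simp)
  then have B': "(?B' has_integral 0) {0..\<tau>}" by (simp add: \<eta>0 N.zero_left G.zero_left)
  have I: "index_form A g nabla D \<gamma> \<tau> Y = integral {0..\<tau>} ?K"
    unfolding index_form_def
    by (rule integral_eq_of_difference_has_integral_0[OF integrand[OF sub] B'])
  have "?K t = g e (z t) (z t) - g e (lie_bracket A mul e (y t) (z t)) (u t)" if "t \<in> {0..\<tau>}" for t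
    by (simp add: zT yT uT lb sub[OF that] G_def)
  then show "index_form A g nabla D \<gamma> \<tau> Y =
      integral {0..\<tau>} (\<lambda>t. g e (z t) (z t) - g e (lie_bracket A mul e (y t) (z t)) (u t))"
    unfolding I by (rule integral_cong)
  have "u0 = T (uc 0)"
    using E_coef[OF vel[OF J(3)]] by (simp add: \<gamma>0 u0 E_identity)
  \<comment> \<open>The inverse adjoint action takes the derivative of \<open>v\<close> back to
    \<open>\<zeta>\<close>. In the second term the bracket of the adjoint images is the adjoint
    image of the bracket, and \<open>momentum\<close> trades it against the initial velocity for the
    bracket itself against \<open>uc t\<close>.\<close>
  then have "?K t = g e (Ad A mul e iv (iv (\<gamma> t)) (tderiv v t)) (Ad A mul e iv (iv (\<gamma> t)) (tderiv v t))
        - g e (lie_bracket A mul e (v t) (tderiv v t)) u0" if "t \<in> {0..\<tau>}" for t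
    by (simp add: tv vT lb sub[OF that] T_ad[symmetric] ad_br[symmetric] G_def[symmetric] momentum)
  then show "index_form A g nabla D \<gamma> \<tau> Y =
      integral {0..\<tau>} (\<lambda>t.
        g e (Ad A mul e iv (iv (\<gamma> t)) (tderiv v t)) (Ad A mul e iv (iv (\<gamma> t)) (tderiv v t))
        - g e (lie_bracket A mul e (v t) (tderiv v t)) u0)"
    unfolding I by (rule integral_cong)
qed

end

end

theorem lemma3p1:
  fixes A :: "('g::{t2_space, second_countable_topology}, 'e::real_inner) chart set"
    and mul :: "'g \<Rightarrow> 'g \<Rightarrow> 'g" and e :: 'g and iv :: "'g \<Rightarrow> 'g"
    and g :: "'g \<Rightarrow> 'g tangent \<Rightarrow> 'g tangent \<Rightarrow> real"
    and nabla :: "'g vfield \<Rightarrow> 'g vfield \<Rightarrow> 'g vfield"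
    and D :: "(real \<Rightarrow> 'g tangent) \<Rightarrow> real \<Rightarrow> 'g tangent"
    and \<gamma> :: "real \<Rightarrow> 'g" and J :: "real set" and \<tau> :: real
    and Y u y z v :: "real \<Rightarrow> 'g tangent" and u0 :: "'g tangent"
  assumes "lie_group A mul e iv"
    and "left_invariant_metric A mul g"
    and "levi_civita A g nabla"
    and "open J" and "is_interval J" and "0 \<in> J" and "\<tau> \<in> J" and "0 < \<tau>"
    and "covariant_derivative_along A nabla \<gamma> J D"
    and "geodesic A D \<gamma> J"
    and "\<gamma> 0 = e" and "velocity A \<gamma> 0 = u0"
    and "field_along A \<gamma> J Y"
    and "Y 0 = (\<lambda>f. 0)" and "Y \<tau> = (\<lambda>f. 0)"
    and "\<And>t. u t = pushforward A (mul (iv (\<gamma> t))) (\<gamma> t) (velocity A \<gamma> t)"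
    and "\<And>t. y t = pushforward A (mul (iv (\<gamma> t))) (\<gamma> t) (Y t)"
    and "\<And>t. z t = (\<lambda>f. tderiv y t f + lie_bracket A mul e (u t) (y t) f)"
    and "\<And>t. v t = pushforward A (\<lambda>q. mul q (iv (\<gamma> t))) (\<gamma> t) (Y t)"
  shows "index_form A g nabla D \<gamma> \<tau> Y =
      integral {0..\<tau>} (\<lambda>t. g e (z t) (z t) - g e (lie_bracket A mul e (y t) (z t)) (u t)) \<and>
    index_form A g nabla D \<gamma> \<tau> Y =
      integral {0..\<tau>} (\<lambda>t.
        g e (Ad A mul e iv (iv (\<gamma> t)) (tderiv v t)) (Ad A mul e iv (iv (\<gamma> t)) (tderiv v t))
        - g e (lie_bracket A mul e (v t) (tderiv v t)) u0)"
proof -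
  have atlas: "smooth_atlas A" using assms(1) by (simp add: lie_group_def)
  obtain U0 \<phi>0 where chart: "(U0, \<phi>0) \<in> A" "e \<in> U0" using smooth_atlas_cover[OF atlas] by metis
  interpret lie_riemannian A mul e iv U0 \<phi>0 g nabla
    by unfold_locales (fact atlas assms(1-3) chart)+
  show ?thesis
    using index_form_eq[OF assms(4-6,9-11,7,8,13-15) assms(16-19) assms(12)] by (intro conjI)
qed

end
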